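(* Let $n\ge 1$, $\theta\in(0,2]$, $p=p_\theta:=1+\theta/n$, and $T_*\in(0,\infty)$. Then there exists $\epsilon>0$ such that if $\varphi\in \mathfrak L^{1,\infty}_{\rm ul}(\log\mathfrak L)^{n/\theta}$ satisfies $$|||\varphi|||_{1,n/\theta;T^{1/\theta}}\le \epsilon\quad\text{for some } T\in(0,T_*],$$ then problem (P) possesses a solution $u\in C((0,T):\mathfrak L^{1,\infty}_{\rm ul}(\log\mathfrak L)^{n/\theta})\cap L^\infty_{\rm loc}((0,T):L^\infty)$ in $\mathbb R^n\times(0,T)$ satisfying $$\sup_{t\in(0,T)}|||u(t)|||_{1,n/\theta;T^{1/\theta}}+\sup_{t\in(0,T)} t^{\frac n\theta}\Big[\log\Big(e+\frac1t\Big)\Big]^{\frac n\theta}\|u(t)\|_{L^\infty}<\infty .$$ Furthermore, $$\lim_{t\to+0}\|u(t)-S_\theta(t)\varphi\|_{\mathfrak L^{1,\infty}_{\rm ul}(\log\mathfrak L)^{\gamma}}=0\quad\text{for every }\gamma\in[0,n/\theta),$$ and $u(t)\to\varphi$ as $t\to+0$ in the sense of distributions.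
   Context: Problem (P) is the Cauchy problem $\partial_t u+(-\Delta)^{\theta/2}u=|u|^{p-1}u$ in $\mathbb R^n\times(0,\infty)$, $u(x,0)=\varphi(x)$. Let $G_\theta$ be the fundamental solution of $\partial_t v+(-\Delta)^{\theta/2}v=0$ in $\mathbb R^n\times(0,\infty)$ and $(S_\theta(t)\varphi)(x)=\int_{\mathbb R^n}G_\theta(x-y,t)\varphi(y)\,dy$. Setting $F_p(s)=|s|^{p-1}s$, a measurable, a.e. finite function $u$ on $\mathbb R^n\times(0,T)$ is a solution of (P) in $\mathbb R^n\times(0,T)$ if for a.a. $(x,t)\in\mathbb R^n\times(0,T)$: $y\mapsto G_\theta(x-y,t)\varphi(y)$ is integrable on $\mathbb R^n$, $(y,s)\mapsto G_\theta(x-y,t-s)F_p(u(y,s))$ is integrable on $\mathbb R^n\times(0,t)$, and $u(x,t)=[S_\theta(t)\varphi](x)+\int_0^t[S_\theta(t-s)F_p(u(s))](x)\,ds$. For $q\in[1,\infty)$, $\alpha\ge0$ and $f\in L^1_{\rm loc}(\mathbb R^n)$, $\|f\|_{\mathfrak L^{q,\infty}(\log\mathfrak L)^\alpha}:=\sup_{s>0}\{[\log(e+1/s)]^\alpha\sup_{|E|=s}\int_E|f|^q\,dx\}^{1/q}$ (sup over Lebesgue measurable $E$ with $|E|=s$); for $q=\infty$ it is $\|f\|_{L^\infty}$. For $\rho>0$, $|||f|||_{q,\alpha;\rho}:=\sup_{z\in\mathbb R^n}\|f\chi_{B(z,\rho)}\|_{\mathfrak L^{q,\infty}(\log\mathfrak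 L)^\alpha}$, and $\mathfrak L^{q,\infty}_{\rm ul}(\log\mathfrak L)^\alpha$ is the space of $f\in L^1_{\rm loc}$ with $\|f\|_{\mathfrak L^{q,\infty}_{\rm ul}(\log\mathfrak L)^\alpha}:=|||f|||_{q,\alpha;1}<\infty$. *)

theory Defs
  imports "HOL-Analysis.Analysis" "HOL-Probability.Essential_Supremum"
begin

text \<open>Fundamental solution of d/dt v + (-Delta)^(theta/2) v = 0, as inverse Fourier transform
  of exp(-t |xi|^theta):  G(x,t) = (2 pi)^(-n) int exp(i x.xi) exp(-t|xi|^theta) dxi
  (the imaginary part vanishes by symmetry, so the cosine is used).\<close>
definition frac_heat_kernel :: "real \<Rightarrow> 'a::euclidean_space \<Rightarrow> real \<Rightarrow> real" where
  "frac_heat_kernel \<theta> x t =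
     (2 * pi) powr (- real DIM('a)) *
     (\<integral>\<xi>. cos (x \<bullet> \<xi>) * exp (- t * norm \<xi> powr \<theta>) \<partial>lebesgue)"

definition frac_semigroup :: "real \<Rightarrow> real \<Rightarrow> ('a::euclidean_space \<Rightarrow> real) \<Rightarrow> 'a \<Rightarrow> real" where
  "frac_semigroup \<theta> t \<phi> x = (\<integral>y. frac_heat_kernel \<theta> (x - y) t * \<phi> y \<partial>lebesgue)"

definition Fp :: "real \<Rightarrow> real \<Rightarrow> real" where
  "Fp p s = \<bar>s\<bar> powr (p - 1) * s"

definition enn_root :: "real \<Rightarrow> ennreal \<Rightarrow> ennreal" where
  "enn_root q x = (if x = \<infinity> then \<infinity> else ennreal (enn2real x powr (1 / q)))"

definition LlogL_norm :: "real \<Rightarrow> real \<Rightarrow> ('a::euclidean_space \<Rightarrow> real) \<Rightarrow> ennreal" where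
  "LlogL_norm q \<alpha> f =
     (SUP s\<in>{0<..}. enn_root q
        (ennreal (ln (exp 1 + 1 / s) powr \<alpha>) *
         (SUP E\<in>{E \<in> sets lebesgue. emeasure lebesgue E = ennreal s}.
            (\<integral>\<^sup>+ x\<in>E. ennreal (\<bar>f x\<bar> powr q) \<partial>lebesgue))))"

definition triple_norm :: "real \<Rightarrow> real \<Rightarrow> real \<Rightarrow> ('a::euclidean_space \<Rightarrow> real) \<Rightarrow> ennreal" where
  "triple_norm q \<alpha> \<rho> f = (SUP z. LlogL_norm q \<alpha> (\<lambda>x. f x * indicator (ball z \<rho>) x))"

definition ul_norm :: "real \<Rightarrow> real \<Rightarrow> ('a::euclidean_space \<Rightarrow> real) \<Rightarrow> ennreal" where
  "ul_norm q \<alpha> f = triple_norm q \<alpha> 1 f"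

definition locally_integrable :: "('a::euclidean_space \<Rightarrow> real) \<Rightarrow> bool" where
  "locally_integrable f \<longleftrightarrow> f \<in> borel_measurable lebesgue \<and>
     (\<forall>K. compact K \<longrightarrow> set_integrable lebesgue K f)"

definition ul_space :: "real \<Rightarrow> real \<Rightarrow> ('a::euclidean_space \<Rightarrow> real) set" where
  "ul_space q \<alpha> = {f. locally_integrable f \<and> ul_norm q \<alpha> f < \<infinity>}"

definition Linf_norm :: "('a::euclidean_space \<Rightarrow> real) \<Rightarrow> ereal" where
  "Linf_norm f = esssup lebesgue (\<lambda>x. ereal \<bar>f x\<bar>)"

definition is_solution ::
  "real \<Rightarrow> real \<Rightarrow> ('a::euclidean_space \<Rightarrow> real) \<Rightarrow> real \<Rightarrow> ('a \<Rightarrow> real \<Rightarrow> real) \<Rightarrow> bool" where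
  "is_solution \<theta> p \<phi> T u \<longleftrightarrow>
     (\<lambda>(x, t). u x t) \<in> borel_measurable (restrict_space lebesgue (UNIV \<times> {0<..<T})) \<and>
     (AE z in (lebesgue :: ('a \<times> real) measure). z \<in> UNIV \<times> {0<..<T} \<longrightarrow>
        (case z of (x, t) \<Rightarrow>
          integrable lebesgue (\<lambda>y. frac_heat_kernel \<theta> (x - y) t * \<phi> y) \<and>
          set_integrable (lebesgue :: ('a \<times> real) measure) (UNIV \<times> {0<..<t})
             (\<lambda>(y, s). frac_heat_kernel \<theta> (x - y) (t - s) * Fp p (u y s)) \<and>
          u x t = frac_semigroup \<theta> t \<phi> x +
             (LINT s:{0<..<t}|lebesgue. frac_semigroup \<theta> (t - s) (\<lambda>y. Fp p (u y s)) x)))"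

definition dir_deriv :: "'a::euclidean_space \<Rightarrow> ('a \<Rightarrow> real) \<Rightarrow> 'a \<Rightarrow> real" where
  "dir_deriv v f x = (THE D. ((\<lambda>h. f (x + h *\<^sub>R v)) has_real_derivative D) (at 0))"

fun iter_pd :: "'a::euclidean_space list \<Rightarrow> ('a \<Rightarrow> real) \<Rightarrow> 'a \<Rightarrow> real" where
  "iter_pd [] f = f"
| "iter_pd (v # vs) f = dir_deriv v (iter_pd vs f)"

definition smooth_fun :: "('a::euclidean_space \<Rightarrow> real) \<Rightarrow> bool" where
  "smooth_fun f \<longleftrightarrow> (\<forall>vs. set vs \<subseteq> Basis \<longrightarrow>
      continuous_on UNIV (iter_pd vs f) \<and>
      (\<forall>v\<in>Basis. \<forall>x. ((\<lambda>h. iter_pd vs f (x + h *\<^sub>R v)) has_real_derivative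
                          iter_pd (v # vs) f x) (at 0)))"

definition test_fun :: "('a::euclidean_space \<Rightarrow> real) \<Rightarrow> bool" where
  "test_fun \<psi> \<longleftrightarrow> smooth_fun \<psi> \<and> compact (closure {x. \<psi> x \<noteq> 0})"

end

theory Submission
  imports Defs "HOL-Probability.Characteristic_Functions"
begin

text \<open>The symbol exp(-|xi|^theta) is a pointwise limit of nonnegative combinations of Gaussians. Hence the
  kernel is nonnegative and radially decreasing, and its increments in time are dominated by the kernel at a
  comparable time; no further decay of the kernel is needed. With N = n/theta and L(s) = log(e + 1/s), data of
  norm K satisfy |S(t) phi| <= C K (t L(t))^(-N). If u(s) obeys the norm bound and this sup bound with a
  constant K, then the mass of |u(s)|^p on balls of radius T^(1/theta) is at most C K^p / (s L(s)^(N+1)),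
  which is integrable at s = 0 with integral of order L(t)^(-N). The Duhamel term therefore satisfies the same
  two bounds with constant C K^p, and Picard iteration converges, at every point, for small K. The bound
  L(t)^(-N) on the mass of the Duhamel term also gives both statements about the limit t -> 0.\<close>

section \<open>Gaussian integrals\<close>

text \<open>The obstacle is a logarithm. With p = 1 + 1/N, estimating the mass of |u(s)|^p by the
  sup bound to the power 1/N times the mass of u(s) gives only 1/(s L(s)), whose integral diverges
  at s = 0. The missing factor L(s)^(-N) must come from the norm, which forces small sets to carry
  little mass: above a suitable level |u(s)| lives on a set whose measure is s^N up to logarithms.
  The exponent N of the weight reproduces itself because the derivative of L(s)^(-N) is comparable
  to 1/(s L(s)^(N+1)) on bounded intervals, so the Duhamel map preserves the class. Smallness enters
  through the Lipschitz constant of that map, a multiple of K^(1/N). Estimates are made for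
  nonnegative extended integrals of Borel functions at every point x, and integrability is read off
  from finiteness; Lebesgue measurable data are replaced by a Borel representative.\<close>

lemma nn_integral_lborel_affine:
  fixes t :: "'a::euclidean_space"
  assumes [measurable]: "f \<in> borel_measurable borel" and c: "c \<noteq> 0"
  shows "(\<integral>\<^sup>+x. f x \<partial>lborel) = ennreal (\<bar>c\<bar> ^ DIM('a)) * (\<integral>\<^sup>+x. f (t + c *\<^sub>R x) \<partial>lborel)"
  by (subst lborel_affine[OF c, of t])
     (simp add: nn_integral_density nn_integral_distr nn_integral_cmult)

lemma nn_integral_lborel_shift:
  fixes t :: "'a::euclidean_space"
  assumes [measurable]: "f \<in> borel_measurable borel"
  shows "(\<integral>\<^sup>+x. f (t + x) \<partial>lborel) = (\<integral>\<^sup>+x. f x \<partial>lborel)"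
  using nn_integral_lborel_affine[of f 1 t] by simp

lemma nn_integral_lborel_reflect:
  fixes t :: "'a::euclidean_space"
  assumes [measurable]: "f \<in> borel_measurable borel"
  shows "(\<integral>\<^sup>+x. f (t - x) \<partial>lborel) = (\<integral>\<^sup>+x. f x \<partial>lborel)"
  using nn_integral_lborel_affine[of f "-1" t] by simp

lemma integrable_lborel_affine:
  fixes f :: "'a::euclidean_space \<Rightarrow> real"
  assumes f: "integrable lborel f" and c: "c \<noteq> 0"
  shows "integrable lborel (\<lambda>x. f (t + c *\<^sub>R x))"
proof -
  have [measurable]: "f \<in> borel_measurable borel" using f by simp
  show ?thesis
    using f c nn_integral_lborel_affine[of "\<lambda>x. ennreal (norm (f x))" c t]
    unfolding integrable_iff_bounded
    by (auto simp: ennreal_mult_less_top)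
qed

lemma integral_lborel_affine:
  fixes f :: "'a::euclidean_space \<Rightarrow> real"
  assumes f: "integrable lborel f" and c: "c \<noteq> 0"
  shows "(\<integral>x. f x \<partial>lborel) = \<bar>c\<bar> ^ DIM('a) * (\<integral>x. f (t + c *\<^sub>R x) \<partial>lborel)"
proof -
  have [measurable]: "f \<in> borel_measurable borel" using f by simp
  show ?thesis
    using integrable_lborel_affine[OF f c, of t]
    by (subst lborel_affine[OF c, of t]) (simp add: integral_density integral_distr)
qed

lemma lborel_prod_Basis:
  fixes f :: "'a::euclidean_space \<Rightarrow> real \<Rightarrow> complex"
  assumes int: "\<And>b. b \<in> Basis \<Longrightarrow> integrable lborel (f b)"
  shows integrable_lborel_prod_Basis: "integrable lborel (\<lambda>x::'a. \<Prod>b\<in>Basis. f b (x \<bullet> b))"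
    and integral_lborel_prod_Basis:
      "(\<integral>x. (\<Prod>b\<in>Basis. f b (x \<bullet> b)) \<partial>(lborel :: 'a measure)) = (\<Prod>b\<in>Basis. integral\<^sup>L lborel (f b))"
proof -
  interpret product_sigma_finite "\<lambda>_::'a. lborel :: real measure" ..
  have [measurable]: "\<And>b. b \<in> Basis \<Longrightarrow> f b \<in> borel_measurable borel"
    using int by (auto dest: borel_measurable_integrable)
  have [measurable]: "(\<lambda>x::'a. \<Prod>b\<in>Basis. f b (x \<bullet> b)) \<in> borel_measurable borel"
    by measurable
  have *: "(\<Prod>b\<in>Basis. f b ((\<Sum>i\<in>Basis. g i *\<^sub>R i) \<bullet> b)) = (\<Prod>b\<in>Basis. f b (g b))" for g :: "'a \<Rightarrow> real"
    by (intro prod.cong) auto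
  show "integrable lborel (\<lambda>x::'a. \<Prod>b\<in>Basis. f b (x \<bullet> b))"
    by (subst lborel_eq) (simp add: integrable_distr_eq * product_integrable_prod int)
  show "(\<integral>x. (\<Prod>b\<in>Basis. f b (x \<bullet> b)) \<partial>(lborel :: 'a measure)) = (\<Prod>b\<in>Basis. integral\<^sup>L lborel (f b))"
    by (subst lborel_eq) (simp add: integral_distr * product_integral_prod int)
qed

text \<open>This is the characteristic function of the standard normal law after the substitution y
  -> c y with \<open>c = sqrt (2 * s)\<close>, which turns the exponent y^2/2 into s y^2.\<close>

lemma gaussian_fourier_1d:
  assumes s: "0 < s"
  shows "integrable lborel (\<lambda>y::real. iexp (a * y) * complex_of_real (exp (- s * y\<^sup>2)))"
    and "(\<integral>y. iexp (a * y) * complex_of_real (exp (- s * y\<^sup>2)) \<partial>lborel)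
          = complex_of_real (sqrt (pi / s) * exp (- a\<^sup>2 / (4 * s)))"
proof -
  define c where "c = sqrt (2 * s)"
  have c: "0 < c" "c\<^sup>2 = 2 * s" "c \<noteq> 0" using s by (auto simp: c_def)
  let ?g = "\<lambda>y. iexp ((a / c) * y) * complex_of_real (std_normal_density y)"
  have int: "integrable lborel ?g"
  proof (rule Bochner_Integration.integrable_bound)
    show "integrable lborel std_normal_density" by (simp add: integrable_normal_density)
  qed (auto simp: norm_mult)
  have val: "integral\<^sup>L lborel ?g = complex_of_real (exp (- ((a / c)\<^sup>2) / 2))"
  proof -
    have "char std_normal_distribution (a / c) = integral\<^sup>L lborel ?g"
      unfolding char_def
      by (subst integral_density) (auto simp: normal_density_nonneg scaleR_conv_of_real mult.commute)
    then show ?thesis by (simp add: char_std_normal_distribution)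
  qed
  have eq: "?g (0 + c * y) = complex_of_real (1 / sqrt (2 * pi)) * (iexp (a * y) * complex_of_real (exp (- s * y\<^sup>2)))" for y
    using c by (simp add: normal_density_def power_mult_distrib)
  have "integrable lborel (\<lambda>y. ?g (0 + c * y))"
    using int c by (subst lborel_integrable_real_affine_iff) auto
  then have "integrable lborel (\<lambda>y. complex_of_real (sqrt (2 * pi)) * ?g (0 + c * y))"
    by (intro integrable_mult_right)
  moreover have "complex_of_real (sqrt (2 * pi)) * ?g (0 + c * y) = iexp (a * y) * complex_of_real (exp (- s * y\<^sup>2))" for y
    unfolding eq by (simp add: mult.assoc[symmetric] flip: of_real_mult)
  ultimately show "integrable lborel (\<lambda>y::real. iexp (a * y) * complex_of_real (exp (- s * y\<^sup>2)))"
    by simp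
  have "integral\<^sup>L lborel ?g = c *\<^sub>R (\<integral>y. ?g (0 + c * y) \<partial>lborel)"
    using lborel_integral_real_affine[OF c(3), of ?g 0] c by simp
  also have "\<dots> = complex_of_real (c / sqrt (2 * pi)) * (\<integral>y. iexp (a * y) * complex_of_real (exp (- s * y\<^sup>2)) \<partial>lborel)"
    unfolding eq integral_mult_right_zero by (simp add: scaleR_conv_of_real)
  finally have "(\<integral>y. iexp (a * y) * complex_of_real (exp (- s * y\<^sup>2)) \<partial>lborel) =
     complex_of_real (sqrt (2 * pi) / c * exp (- ((a / c)\<^sup>2) / 2))"
    unfolding val using c by (simp add: field_simps)
  also have "sqrt (2 * pi) / c * exp (- ((a / c)\<^sup>2) / 2) = sqrt (pi / s) * exp (- a\<^sup>2 / (4 * s))"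
  proof -
    have "sqrt (2 * pi) / c = sqrt (pi / s)" by (simp add: c_def flip: real_sqrt_divide)
    moreover have "- ((a / c)\<^sup>2) / 2 = - a\<^sup>2 / (4 * s)" using c by (simp add: power_divide)
    ultimately show ?thesis by simp
  qed
  finally show "(\<integral>y. iexp (a * y) * complex_of_real (exp (- s * y\<^sup>2)) \<partial>lborel)
          = complex_of_real (sqrt (pi / s) * exp (- a\<^sup>2 / (4 * s)))" .
qed

text \<open>A cosine of a sum does not factor over the coordinates, but the complex exponential
  does. The computation is therefore a product of one-dimensional integrals, and the real part is
  taken at the end.\<close>

lemma gaussian_fourier:
  fixes x :: "'a::euclidean_space"
  assumes s: "0 < s"
  shows integrable_gaussian_fourier: "integrable lborel (\<lambda>\<xi>::'a. cos (x \<bullet> \<xi>) * exp (- s * (norm \<xi>)\<^sup>2))"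
    and integral_gaussian_fourier: "(\<integral>\<xi>. cos (x \<bullet> \<xi>) * exp (- s * (norm \<xi>)\<^sup>2) \<partial>lborel)
          = sqrt (pi / s) ^ DIM('a) * exp (- (norm x)\<^sup>2 / (4 * s))"
proof -
  let ?f = "\<lambda>b y. iexp ((x \<bullet> b) * y) * complex_of_real (exp (- s * y\<^sup>2))"
  have prod: "(\<Prod>b\<in>Basis. ?f b (\<xi> \<bullet> b)) = iexp (x \<bullet> \<xi>) * complex_of_real (exp (- s * (norm \<xi>)\<^sup>2))" for \<xi> :: 'a
  proof -
    have "(\<Prod>b\<in>Basis. iexp ((x \<bullet> b) * (\<xi> \<bullet> b))) = iexp (x \<bullet> \<xi>)"
      by (subst euclidean_inner[of x \<xi>]) (simp add: exp_sum[symmetric] sum_distrib_left)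
    moreover have "(\<Prod>b\<in>Basis. complex_of_real (exp (- s * (\<xi> \<bullet> b)\<^sup>2))) = complex_of_real (exp (- s * (norm \<xi>)\<^sup>2))"
    proof -
      have "(norm \<xi>)\<^sup>2 = (\<Sum>b\<in>Basis. (\<xi> \<bullet> b)\<^sup>2)"
        by (subst power2_norm_eq_inner, subst euclidean_inner) (simp add: power2_eq_square)
      then show ?thesis
        by (simp add: exp_sum[symmetric] sum_distrib_left sum_negf flip: of_real_prod)
    qed
    ultimately show ?thesis by (simp add: prod.distrib)
  qed
  have nx: "(norm x)\<^sup>2 = (\<Sum>b\<in>Basis. (x \<bullet> b)\<^sup>2)"
    by (subst power2_norm_eq_inner, subst euclidean_inner) (simp add: power2_eq_square)
  have int: "integrable lborel (\<lambda>\<xi>. iexp (x \<bullet> \<xi>) * complex_of_real (exp (- s * (norm \<xi>)\<^sup>2)))"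
    using integrable_lborel_prod_Basis[of ?f] gaussian_fourier_1d(1)[OF s] unfolding prod by blast
  have "(\<integral>\<xi>. iexp (x \<bullet> \<xi>) * complex_of_real (exp (- s * (norm \<xi>)\<^sup>2)) \<partial>lborel)
     = (\<Prod>b\<in>Basis. complex_of_real (sqrt (pi / s) * exp (- (x \<bullet> b)\<^sup>2 / (4 * s))))"
    using integral_lborel_prod_Basis[of ?f] gaussian_fourier_1d[OF s] unfolding prod by simp
  also have "\<dots> = complex_of_real (sqrt (pi / s) ^ DIM('a) * exp (- (norm x)\<^sup>2 / (4 * s)))"
    by (simp add: nx prod.distrib exp_sum[symmetric] sum_negf sum_divide_distrib flip: of_real_prod)
  finally have val: "(\<integral>\<xi>. iexp (x \<bullet> \<xi>) * complex_of_real (exp (- s * (norm \<xi>)\<^sup>2)) \<partial>lborel)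
      = complex_of_real (sqrt (pi / s) ^ DIM('a) * exp (- (norm x)\<^sup>2 / (4 * s)))" .
  have re: "Re (iexp (x \<bullet> \<xi>) * complex_of_real (exp (- s * (norm \<xi>)\<^sup>2))) = cos (x \<bullet> \<xi>) * exp (- s * (norm \<xi>)\<^sup>2)" for \<xi>
    by (simp add: Re_exp)
  show "integrable lborel (\<lambda>\<xi>::'a. cos (x \<bullet> \<xi>) * exp (- s * (norm \<xi>)\<^sup>2))"
    using integrable_Re[OF int] unfolding re .
  show "(\<integral>\<xi>. cos (x \<bullet> \<xi>) * exp (- s * (norm \<xi>)\<^sup>2) \<partial>lborel)
          = sqrt (pi / s) ^ DIM('a) * exp (- (norm x)\<^sup>2 / (4 * s))"
    using integral_Re[OF int] unfolding re val by simp
qed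

section \<open>Mixtures of Gaussians\<close>

text \<open>Layer cake: exp(-a) is the integral of exp(-v) over v \<ge> a. After Tonelli the inner
  integral is the volume of a ball of radius (v/t)^(1/\<theta>), and a Gamma integral
  remains.\<close>

lemma integrable_exp_norm_powr:
  assumes "0 < \<theta>" "0 < t"
  shows "integrable lborel (\<lambda>\<xi>::'a::euclidean_space. exp (- t * norm \<xi> powr \<theta>))"
proof -
  let ?I = "\<lambda>(\<xi>::'a) v. indicator {t * norm \<xi> powr \<theta>..} v * ennreal (exp (- v))"
  have inner: "(\<integral>\<^sup>+v. ?I \<xi> v \<partial>lborel) = ennreal (exp (- t * norm \<xi> powr \<theta>))" for \<xi>
  proof -
    have "(\<integral>\<^sup>+v. ennreal (exp (- v)) * indicator {t * norm \<xi> powr \<theta>..} v \<partial>lborel)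
        = ennreal (0 - (- exp (- (t * norm \<xi> powr \<theta>))))"
    proof (rule nn_integral_FTC_atLeast)
      show "((\<lambda>v. - exp (- v)) \<longlongrightarrow> (0::real)) at_top"
        using tendsto_minus[OF filterlim_compose[OF exp_at_bot filterlim_uminus_at_bot_at_top]] by simp
    qed (auto intro!: derivative_eq_intros)
    then show ?thesis by (simp add: mult.commute)
  qed
  define N where "N = real DIM('a) / \<theta>"
  \<comment> \<open>The exponent is written \<open>N + 1 - 1\<close> so that the integrand has the
    form of the Gamma integral at N + 1.\<close>
  have outer: "(\<integral>\<^sup>+\<xi>. ?I \<xi> v \<partial>lborel) \<le> ennreal (unit_ball_vol (DIM('a)) * (1 / t) powr N) *
      ennreal (indicator {0..} v * v powr (N + 1 - 1) / exp v)" for v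
  proof (cases "0 \<le> v")
    case True
    have eq: "indicator {t * norm \<xi> powr \<theta>..} v = (indicator (cball 0 ((v / t) powr (1 / \<theta>))) \<xi> :: ennreal)" for \<xi> :: 'a
    proof -
      have "t * norm \<xi> powr \<theta> \<le> v \<longleftrightarrow> norm \<xi> powr \<theta> \<le> v / t" using assms by (simp add: field_simps)
      also have "\<dots> \<longleftrightarrow> norm \<xi> \<le> (v / t) powr (1 / \<theta>)"
      proof
        assume "norm \<xi> powr \<theta> \<le> v / t"
        then have "(norm \<xi> powr \<theta>) powr (1 / \<theta>) \<le> (v / t) powr (1 / \<theta>)"
          using assms by (intro powr_mono2) auto
        then show "norm \<xi> \<le> (v / t) powr (1 / \<theta>)" using assms by (simp add: powr_powr)
      next
        assume "norm \<xi> \<le> (v / t) powr (1 / \<theta>)"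
        then have "norm \<xi> powr \<theta> \<le> ((v / t) powr (1 / \<theta>)) powr \<theta>"
          using assms by (intro powr_mono2) auto
        then show "norm \<xi> powr \<theta> \<le> v / t" using assms True by (simp add: powr_powr)
      qed
      finally show ?thesis by (simp add: indicator_def)
    qed
    have "(\<integral>\<^sup>+\<xi>. ?I \<xi> v \<partial>lborel) = emeasure lborel (cball (0::'a) ((v / t) powr (1 / \<theta>))) * ennreal (exp (- v))"
      unfolding eq by (subst nn_integral_multc) (auto intro!: borel_measurable_indicator)
    also have "\<dots> = ennreal (unit_ball_vol (DIM('a)) * ((v / t) powr (1 / \<theta>)) ^ DIM('a) * exp (- v))"
      by (subst emeasure_cball) (auto simp: ennreal_mult')
    also have "((v / t) powr (1 / \<theta>)) ^ DIM('a) = v powr N * (1 / t) powr N"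
      using assms True
      by (cases "v = 0") (auto simp: N_def powr_powr powr_mult powr_divide powr_realpow[symmetric])
    finally show ?thesis using True
      by (simp add: ennreal_mult[symmetric] exp_minus field_simps)
  next
    case False
    moreover have "0 \<le> t * norm \<xi> powr \<theta>" for \<xi> :: 'a using assms(2) by simp
    ultimately have "indicator {t * norm \<xi> powr \<theta>..} v = (0::ennreal)" for \<xi> :: 'a
      by (auto simp: indicator_def intro: order_trans)
    then show ?thesis by simp
  qed
  have "(\<integral>\<^sup>+\<xi>. ennreal (exp (- t * norm (\<xi>::'a) powr \<theta>)) \<partial>lborel) = (\<integral>\<^sup>+\<xi>. \<integral>\<^sup>+v. ?I \<xi> v \<partial>lborel \<partial>lborel)"
    by (simp add: inner)
  also have "\<dots> = (\<integral>\<^sup>+v. \<integral>\<^sup>+\<xi>. ?I \<xi> v \<partial>lborel \<partial>lborel)"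
  proof (rule lborel_pair.Fubini'[symmetric])
    show "(\<lambda>(\<xi>, v). ?I \<xi> v) \<in> borel_measurable (lborel \<Otimes>\<^sub>M lborel)"
      unfolding indicator_def atLeast_iff by measurable
  qed
  also have "\<dots> \<le> (\<integral>\<^sup>+v. ennreal (unit_ball_vol (DIM('a)) * (1 / t) powr N) *
      ennreal (indicator {0..} v * v powr (N + 1 - 1) / exp v) \<partial>lborel)"
    by (intro nn_integral_mono outer)
  also have "\<dots> = ennreal (unit_ball_vol (DIM('a)) * (1 / t) powr N) * ennreal (Gamma (N + 1))"
    using assms by (subst nn_integral_cmult, simp, subst Gamma_conv_nn_integral_real) (auto simp: N_def add_pos_pos)
  also have "\<dots> < \<infinity>" by (simp add: ennreal_mult_less_top)
  finally show ?thesis by (simp add: integrable_iff_bounded)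
qed

text \<open>Both conditions hold for centred Gaussians and survive nonnegative combinations and pointwise
  limits. The second one is a substitute for a bound on the time derivative of the kernel: by scaling it
  compares the kernel at two times.\<close>

definition radial_cone :: "('a::euclidean_space \<Rightarrow> real) \<Rightarrow> bool" where
  "radial_cone K \<longleftrightarrow> (\<forall>x y. norm x \<le> norm y \<longrightarrow> 0 \<le> K y \<and> K y \<le> K x) \<and>
     (\<forall>x r q. 0 < r \<and> r \<le> q \<longrightarrow> K (r *\<^sub>R x) - K (q *\<^sub>R x) \<le> 2 * (q\<^sup>2 / r\<^sup>2 - 1) * K ((r / sqrt 2) *\<^sub>R x))"

text \<open>With a = |r x|^2/(4s) and h = q^2/r^2 - 1, the increment is exp(-a) (1 - exp(-a h))
  \<le> a h exp(-a). Half of the exponential absorbs the factor a, since (a/2) exp(-a/2) \<le> 1;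
  this produces the constant 2. The other half is the Gaussian at radius r / sqrt 2.\<close>

lemma radial_cone_gaussian:
  assumes "0 < s"
  shows "radial_cone (\<lambda>x::'a::euclidean_space. exp (- (norm x)\<^sup>2 / (4 * s)))"
  unfolding radial_cone_def
proof (intro conjI allI impI)
  fix x y :: 'a assume "norm x \<le> norm y"
  then have "(norm x)\<^sup>2 \<le> (norm y)\<^sup>2" by (intro power_mono) auto
  then show "exp (- (norm y)\<^sup>2 / (4 * s)) \<le> exp (- (norm x)\<^sup>2 / (4 * s))"
    using assms by (simp add: divide_right_mono)
next
  fix x :: 'a and r q :: real assume rq: "0 < r \<and> r \<le> q"
  define a where "a = r\<^sup>2 * (norm x)\<^sup>2 / (4 * s)"
  define h where "h = q\<^sup>2 / r\<^sup>2 - 1"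
  have a: "0 \<le> a" using assms by (simp add: a_def)
  have rq': "r\<^sup>2 \<le> q\<^sup>2" "0 < r\<^sup>2" using rq by (auto intro: power_mono)
  then have h: "0 \<le> h" by (simp add: h_def)
  have "q\<^sup>2 = r\<^sup>2 * (1 + h)" using rq by (simp add: h_def)
  then have b: "q\<^sup>2 * (norm x)\<^sup>2 / (4 * s) = a + a * h"
    by (simp only: a_def) (simp add: algebra_simps add_divide_distrib)
  have "exp (- a) - exp (- (a + a * h)) = exp (- a) * (1 - exp (- (a * h)))"
    by (simp add: algebra_simps flip: exp_add)
  also have "\<dots> \<le> exp (- a) * (a * h)"
    using exp_ge_add_one_self[of "- (a * h)"] by (intro mult_left_mono) auto
  also have "\<dots> = 2 * h * ((a / 2 * exp (- (a / 2))) * exp (- (a / 2)))"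
    by (simp add: field_simps flip: exp_add)
  also have "\<dots> \<le> 2 * h * (1 * exp (- (a / 2)))"
  proof (intro mult_left_mono mult_right_mono)
    show "a / 2 * exp (- (a / 2)) \<le> 1"
      using exp_ge_add_one_self[of "a / 2"] by (simp add: exp_minus field_simps)
  qed (use h in auto)
  finally have "exp (- a) - exp (- (a + a * h)) \<le> 2 * h * exp (- (a / 2))" by simp
  moreover have "(norm (r *\<^sub>R x))\<^sup>2 / (4 * s) = a" "(norm (q *\<^sub>R x))\<^sup>2 / (4 * s) = a + a * h"
     "(norm ((r / sqrt 2) *\<^sub>R x))\<^sup>2 / (4 * s) = a / 2"
    using b by (auto simp: a_def power_mult_distrib power_divide)
  ultimately show "exp (- (norm (r *\<^sub>R x))\<^sup>2 / (4 * s)) - exp (- (norm (q *\<^sub>R x))\<^sup>2 / (4 * s))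
        \<le> 2 * (q\<^sup>2 / r\<^sup>2 - 1) * exp (- (norm ((r / sqrt 2) *\<^sub>R x))\<^sup>2 / (4 * s))"
    by (simp only: minus_divide_left[symmetric] h_def[symmetric])
qed auto

lemma radial_cone_cmult:
  assumes "radial_cone K" "0 \<le> c"
  shows "radial_cone (\<lambda>x. c * K x)"
proof -
  have "c * K (r *\<^sub>R x) - c * K (q *\<^sub>R x) \<le> 2 * (q\<^sup>2 / r\<^sup>2 - 1) * (c * K ((r / sqrt 2) *\<^sub>R x))"
    if "0 < r" "r \<le> q" for r q x
    using mult_left_mono[of "K (r *\<^sub>R x) - K (q *\<^sub>R x)" "2 * (q\<^sup>2 / r\<^sup>2 - 1) * K ((r / sqrt 2) *\<^sub>R x)" c] assms that
    by (simp add: radial_cone_def algebra_simps)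
  then show ?thesis
    using assms by (auto simp: radial_cone_def intro!: mult_nonneg_nonneg mult_left_mono)
qed

lemma radial_cone_sum:
  assumes "\<And>i. i \<in> I \<Longrightarrow> radial_cone (K i)"
  shows "radial_cone (\<lambda>x. \<Sum>i\<in>I. K i x)"
proof -
  have "(\<Sum>i\<in>I. K i (r *\<^sub>R x)) - (\<Sum>i\<in>I. K i (q *\<^sub>R x)) \<le> 2 * (q\<^sup>2 / r\<^sup>2 - 1) * (\<Sum>i\<in>I. K i ((r / sqrt 2) *\<^sub>R x))"
    if "0 < r" "r \<le> q" for r q x
    unfolding sum_subtractf[symmetric] sum_distrib_left using assms that
    by (intro sum_mono) (auto simp: radial_cone_def)
  then show ?thesis
    using assms by (auto simp: radial_cone_def intro!: sum_nonneg sum_mono)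
qed

lemma radial_cone_lim:
  assumes "\<And>k::nat. radial_cone (K k)" and lim: "\<And>x. (\<lambda>k. K k x) \<longlonglongrightarrow> K' x"
  shows "radial_cone K'"
  unfolding radial_cone_def
proof (intro conjI allI impI)
  fix x y :: 'a assume "norm x \<le> norm y"
  then have *: "0 \<le> K k y \<and> K k y \<le> K k x" for k using assms(1) by (auto simp: radial_cone_def)
  show "0 \<le> K' y" using * by (intro LIMSEQ_le_const[OF lim]) auto
  show "K' y \<le> K' x" using * by (intro LIMSEQ_le[OF lim lim]) auto
next
  fix x :: 'a and r q :: real assume "0 < r \<and> r \<le> q"
  then have "K k (r *\<^sub>R x) - K k (q *\<^sub>R x) \<le> 2 * (q\<^sup>2 / r\<^sup>2 - 1) * K k ((r / sqrt 2) *\<^sub>R x)" for k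
    using assms(1) by (auto simp: radial_cone_def)
  then show "K' (r *\<^sub>R x) - K' (q *\<^sub>R x) \<le> 2 * (q\<^sup>2 / r\<^sup>2 - 1) * K' ((r / sqrt 2) *\<^sub>R x)"
    by (intro LIMSEQ_le[OF tendsto_diff[OF lim lim] tendsto_mult_left[OF lim]]) auto
qed

text \<open>Membership of the Fourier transform in the cone. The factor with \<open>\<delta>\<close> makes every bounded symbol
  integrable, so that pointwise limits of symbols pass to the transforms.\<close>

definition gauss_mix :: "('a::euclidean_space \<Rightarrow> real) \<Rightarrow> bool" where
  "gauss_mix f \<longleftrightarrow> f \<in> borel_measurable borel \<and> (\<exists>B. AE \<xi> in lborel. \<bar>f \<xi>\<bar> \<le> B) \<and>
     (\<forall>\<delta>>0. radial_cone (\<lambda>x. \<integral>\<xi>. cos (x \<bullet> \<xi>) * (f \<xi> * exp (- \<delta> * (norm \<xi>)\<^sup>2)) \<partial>lborel))"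

lemma integrable_cos_gauss:
  fixes f :: "'a::euclidean_space \<Rightarrow> real"
  assumes [measurable]: "f \<in> borel_measurable borel" and "AE \<xi> in lborel. \<bar>f \<xi>\<bar> \<le> B" "0 < \<delta>"
  shows "integrable lborel (\<lambda>\<xi>. cos (x \<bullet> \<xi>) * (f \<xi> * exp (- \<delta> * (norm \<xi>)\<^sup>2)))"
proof (rule Bochner_Integration.integrable_bound)
  show "integrable lborel (\<lambda>\<xi>::'a. B * (cos (0 \<bullet> \<xi>) * exp (- \<delta> * (norm \<xi>)\<^sup>2)))"
    by (intro integrable_mult_right integrable_gaussian_fourier assms)
  show "AE \<xi> in lborel. norm (cos (x \<bullet> \<xi>) * (f \<xi> * exp (- \<delta> * (norm \<xi>)\<^sup>2)))
      \<le> norm (B * (cos (0 \<bullet> \<xi>) * exp (- \<delta> * (norm \<xi>)\<^sup>2)))"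
    using assms(2)
  proof eventually_elim
    case (elim \<xi>)
    have "\<bar>cos (x \<bullet> \<xi>)\<bar> * (\<bar>f \<xi>\<bar> * exp (- \<delta> * (norm \<xi>)\<^sup>2)) \<le> 1 * (\<bar>B\<bar> * exp (- \<delta> * (norm \<xi>)\<^sup>2))"
      using elim by (intro mult_mono) auto
    then show ?case by (simp add: abs_mult)
  qed
qed measurable

lemma gauss_mix_sum:
  assumes "finite I" "\<And>i. i \<in> I \<Longrightarrow> gauss_mix (f i)" "\<And>i. i \<in> I \<Longrightarrow> 0 \<le> c i"
  shows "gauss_mix (\<lambda>\<xi>. \<Sum>i\<in>I. c i * f i \<xi>)"
  unfolding gauss_mix_def
proof (intro conjI allI impI)
  have [measurable]: "\<And>i. i \<in> I \<Longrightarrow> f i \<in> borel_measurable borel" using assms by (simp add: gauss_mix_def)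
  show "(\<lambda>\<xi>. \<Sum>i\<in>I. c i * f i \<xi>) \<in> borel_measurable borel" by measurable
  have "\<forall>i\<in>I. \<exists>B. AE \<xi> in lborel. \<bar>f i \<xi>\<bar> \<le> B" using assms by (auto simp: gauss_mix_def)
  then obtain B where B: "\<And>i. i \<in> I \<Longrightarrow> AE \<xi> in lborel. \<bar>f i \<xi>\<bar> \<le> B i" by metis
  have "AE \<xi> in lborel. \<forall>i\<in>I. \<bar>f i \<xi>\<bar> \<le> B i" using B assms(1) by (simp add: AE_finite_all)
  then have "AE \<xi> in lborel. \<bar>\<Sum>i\<in>I. c i * f i \<xi>\<bar> \<le> (\<Sum>i\<in>I. c i * B i)"
  proof eventually_elim
    case (elim \<xi>)
    have "\<bar>\<Sum>i\<in>I. c i * f i \<xi>\<bar> \<le> (\<Sum>i\<in>I. \<bar>c i * f i \<xi>\<bar>)" by (rule sum_abs)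
    also have "\<dots> \<le> (\<Sum>i\<in>I. c i * B i)"
      using elim assms(3) by (intro sum_mono) (auto simp: abs_mult intro!: mult_left_mono)
    finally show ?case .
  qed
  then show "\<exists>B. AE \<xi> in lborel. \<bar>\<Sum>i\<in>I. c i * f i \<xi>\<bar> \<le> B" by blast
  fix \<delta> :: real assume \<delta>: "0 < \<delta>"
  have "(\<integral>\<xi>. cos (x \<bullet> \<xi>) * ((\<Sum>i\<in>I. c i * f i \<xi>) * exp (- \<delta> * (norm \<xi>)\<^sup>2)) \<partial>lborel)
    = (\<Sum>i\<in>I. c i * (\<integral>\<xi>. cos (x \<bullet> \<xi>) * (f i \<xi> * exp (- \<delta> * (norm \<xi>)\<^sup>2)) \<partial>lborel))" for x
  proof -
    have "(\<integral>\<xi>. cos (x \<bullet> \<xi>) * ((\<Sum>i\<in>I. c i * f i \<xi>) * exp (- \<delta> * (norm \<xi>)\<^sup>2)) \<partial>lborel)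
      = (\<integral>\<xi>. (\<Sum>i\<in>I. c i * (cos (x \<bullet> \<xi>) * (f i \<xi> * exp (- \<delta> * (norm \<xi>)\<^sup>2)))) \<partial>lborel)"
      by (simp add: sum_distrib_left sum_distrib_right algebra_simps)
    also have "\<dots> = (\<Sum>i\<in>I. \<integral>\<xi>. c i * (cos (x \<bullet> \<xi>) * (f i \<xi> * exp (- \<delta> * (norm \<xi>)\<^sup>2))) \<partial>lborel)"
      using B \<delta> by (intro Bochner_Integration.integral_sum integrable_mult_right integrable_cos_gauss) auto
    finally show ?thesis by simp
  qed
  then show "radial_cone (\<lambda>x. \<integral>\<xi>. cos (x \<bullet> \<xi>) * ((\<Sum>i\<in>I. c i * f i \<xi>) * exp (- \<delta> * (norm \<xi>)\<^sup>2)) \<partial>lborel)"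
    using assms \<delta> by (simp add: radial_cone_sum radial_cone_cmult gauss_mix_def)
qed

text \<open>The value s = 0 is included because the constant symbol is needed for the constant terms
  of polynomials; the factor with \<delta> makes it a Gaussian.\<close>

lemma gauss_mix_exp:
  assumes "0 \<le> s"
  shows "gauss_mix (\<lambda>\<xi>::'a::euclidean_space. exp (- s * (norm \<xi>)\<^sup>2))"
  unfolding gauss_mix_def
proof (intro conjI allI impI)
  show "\<exists>B. AE \<xi>::'a in lborel. \<bar>exp (- s * (norm \<xi>)\<^sup>2)\<bar> \<le> B" using assms by (intro exI[of _ 1]) auto
  fix \<delta> :: real assume "0 < \<delta>"
  then have d: "0 < s + \<delta>" using assms by simp
  have e: "exp (- s * (norm \<xi>)\<^sup>2) * exp (- \<delta> * (norm \<xi>)\<^sup>2) = exp (- (s + \<delta>) * (norm \<xi>)\<^sup>2)" for \<xi> :: 'a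
    by (simp add: algebra_simps flip: exp_add)
  show "radial_cone (\<lambda>x::'a. \<integral>\<xi>. cos (x \<bullet> \<xi>) * (exp (- s * (norm \<xi>)\<^sup>2) * exp (- \<delta> * (norm \<xi>)\<^sup>2)) \<partial>lborel)"
    unfolding e integral_gaussian_fourier[OF d]
    using d by (intro radial_cone_cmult radial_cone_gaussian) auto
qed measurable

lemma gauss_mix_lim:
  fixes f :: "nat \<Rightarrow> 'a::euclidean_space \<Rightarrow> real"
  assumes f: "\<And>k. gauss_mix (f k)" and B: "\<And>k. AE \<xi> in lborel. \<bar>f k \<xi>\<bar> \<le> B"
    and [measurable]: "g \<in> borel_measurable borel"
    and lim: "AE \<xi> in lborel. (\<lambda>k. f k \<xi>) \<longlonglongrightarrow> g \<xi>"
  shows "gauss_mix g"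
  unfolding gauss_mix_def
proof (intro conjI allI impI)
  have [measurable]: "\<And>k. f k \<in> borel_measurable borel" using f by (simp add: gauss_mix_def)
  have "AE \<xi> in lborel. \<forall>k. \<bar>f k \<xi>\<bar> \<le> B" using B by (simp add: AE_all_countable)
  with lim have "AE \<xi> in lborel. \<bar>g \<xi>\<bar> \<le> B"
  proof eventually_elim
    case (elim \<xi>)
    then show ?case by (intro LIMSEQ_le_const2[OF tendsto_rabs]) auto
  qed
  then show "\<exists>B. AE \<xi> in lborel. \<bar>g \<xi>\<bar> \<le> B" by blast
  fix \<delta> :: real assume \<delta>: "0 < \<delta>"
  show "radial_cone (\<lambda>x. \<integral>\<xi>. cos (x \<bullet> \<xi>) * (g \<xi> * exp (- \<delta> * (norm \<xi>)\<^sup>2)) \<partial>lborel)"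
  proof (rule radial_cone_lim)
    show "radial_cone (\<lambda>x. \<integral>\<xi>. cos (x \<bullet> \<xi>) * (f k \<xi> * exp (- \<delta> * (norm \<xi>)\<^sup>2)) \<partial>lborel)" for k
      using f \<delta> by (simp add: gauss_mix_def)
    show "(\<lambda>k. \<integral>\<xi>. cos (x \<bullet> \<xi>) * (f k \<xi> * exp (- \<delta> * (norm \<xi>)\<^sup>2)) \<partial>lborel)
       \<longlonglongrightarrow> (\<integral>\<xi>. cos (x \<bullet> \<xi>) * (g \<xi> * exp (- \<delta> * (norm \<xi>)\<^sup>2)) \<partial>lborel)" for x
    proof (rule integral_dominated_convergence)
      show "integrable lborel (\<lambda>\<xi>::'a. \<bar>B\<bar> * (cos (0 \<bullet> \<xi>) * exp (- \<delta> * (norm \<xi>)\<^sup>2)))"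
        by (intro integrable_mult_right integrable_gaussian_fourier \<delta>)
      show "AE \<xi> in lborel. norm (cos (x \<bullet> \<xi>) * (f k \<xi> * exp (- \<delta> * (norm \<xi>)\<^sup>2)))
          \<le> \<bar>B\<bar> * (cos (0 \<bullet> \<xi>) * exp (- \<delta> * (norm \<xi>)\<^sup>2))" for k
        using B[of k]
      proof eventually_elim
        case (elim \<xi>)
        have "\<bar>cos (x \<bullet> \<xi>)\<bar> * (\<bar>f k \<xi>\<bar> * exp (- \<delta> * (norm \<xi>)\<^sup>2)) \<le> 1 * (\<bar>B\<bar> * exp (- \<delta> * (norm \<xi>)\<^sup>2))"
          using elim by (intro mult_mono) auto
        then show ?case by (simp add: abs_mult)
      qed
      show "AE \<xi> in lborel. (\<lambda>k. cos (x \<bullet> \<xi>) * (f k \<xi> * exp (- \<delta> * (norm \<xi>)\<^sup>2)))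
          \<longlonglongrightarrow> cos (x \<bullet> \<xi>) * (g \<xi> * exp (- \<delta> * (norm \<xi>)\<^sup>2))"
        using lim by eventually_elim (auto intro!: tendsto_intros)
    qed measurable
  qed
qed measurable

section \<open>Symbols built from power series in a Gaussian\<close>

lemma gauss_mix_poly:
  fixes q :: "real poly"
  assumes q: "\<And>i. 0 \<le> coeff q i" and k: "0 \<le> k"
  shows "gauss_mix (\<lambda>\<xi>::'a::euclidean_space. poly q (exp (- k * (norm \<xi>)\<^sup>2)))"
proof -
  have "poly q (exp (- k * (norm \<xi>)\<^sup>2)) = (\<Sum>i\<le>degree q. coeff q i * exp (- (real i * k) * (norm \<xi>)\<^sup>2))" for \<xi> :: 'a
    unfolding poly_altdef exp_of_nat_mult[symmetric] by (simp add: algebra_simps)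
  moreover have "gauss_mix (\<lambda>\<xi>::'a. \<Sum>i\<le>degree q. coeff q i * exp (- (real i * k) * (norm \<xi>)\<^sup>2))"
    using gauss_mix_exp[where s="real i * k" for i] k by (intro gauss_mix_sum) (auto intro: q)
  ultimately show ?thesis by simp
qed

lemma coeff_mult_nonneg:
  fixes p q :: "real poly"
  assumes "\<And>i. 0 \<le> coeff p i" "\<And>i. 0 \<le> coeff q i"
  shows "0 \<le> coeff (p * q) i"
  using assms by (auto simp: coeff_mult intro!: sum_nonneg)

lemma coeff_power_nonneg:
  fixes q :: "real poly"
  assumes "\<And>i. 0 \<le> coeff q i"
  shows "0 \<le> coeff (q ^ m) i"
proof (induction m arbitrary: i)
  case 0
  then show ?case by (simp add: coeff_1)
next
  case (Suc m)
  then show ?case using coeff_mult_nonneg[of q "q ^ m" i] assms by simp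
qed

text \<open>The Taylor polynomials of exp(c q) are polynomials with nonnegative coefficients, and on
  [0,1] they are bounded by the value of exp(c q) at 1. The normalisation by exp(-c) prepares for q
  tending to 1 - (1 - z)^\<alpha>, where the exponent tends to -c (1 - z)^\<alpha>.\<close>

lemma gauss_mix_exp_poly:
  fixes q :: "real poly"
  assumes q: "\<And>i. 0 \<le> coeff q i" and k: "0 \<le> k" and c: "0 \<le> c"
  shows "gauss_mix (\<lambda>\<xi>::'a::euclidean_space. exp (c * poly q (exp (- k * (norm \<xi>)\<^sup>2)) - c))"
proof -
  define z where "z \<xi> = exp (- k * (norm \<xi>)\<^sup>2)" for \<xi> :: 'a
  have z: "0 \<le> z \<xi>" "z \<xi> \<le> 1" for \<xi> using k by (auto simp: z_def)
  define P where "P M = (\<Sum>m<M. smult (exp (- c) * c ^ m / fact m) (q ^ m))" for M :: nat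
  have P: "poly (P M) y = exp (- c) * (\<Sum>m<M. (c * poly q y) ^ m /\<^sub>R fact m)" for M y
    by (simp add: P_def poly_sum sum_distrib_left power_mult_distrib field_simps)
  have q01: "0 \<le> poly q y" "poly q y \<le> poly q 1" if "0 \<le> y" "y \<le> 1" for y
    using q that by (auto simp: poly_altdef intro!: sum_nonneg sum_mono mult_nonneg_nonneg mult_left_le power_le_one)
  show ?thesis
    unfolding z_def[symmetric]
  proof (rule gauss_mix_lim)
    show "gauss_mix (\<lambda>\<xi>. poly (P M) (z \<xi>))" for M
      unfolding z_def
    proof (rule gauss_mix_poly)
      show "0 \<le> coeff (P M) i" for i
        unfolding P_def coeff_sum
        by (intro sum_nonneg) (simp add: coeff_power_nonneg q c)
    qed (rule k)
    have "\<bar>poly (P M) (z \<xi>)\<bar> \<le> exp (c * poly q 1)" for M \<xi>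
    proof -
      have nn: "0 \<le> c * poly q (z \<xi>)" using q01(1)[OF z] c by simp
      have "0 \<le> poly (P M) (z \<xi>)"
        unfolding P using nn by (intro mult_nonneg_nonneg sum_nonneg) auto
      moreover have "(\<Sum>m<M. (c * poly q (z \<xi>)) ^ m /\<^sub>R fact m) \<le> exp (c * poly q (z \<xi>))"
        unfolding exp_def using nn summable_exp_generic[of "c * poly q (z \<xi>)"]
        by (intro sum_le_suminf) auto
      moreover have "exp (c * poly q (z \<xi>)) \<le> exp (c * poly q 1)"
        using q01(2)[OF z] c by (simp add: mult_left_mono)
      moreover have "exp (- c) * (\<Sum>m<M. (c * poly q (z \<xi>)) ^ m /\<^sub>R fact m) \<le> 1 * (\<Sum>m<M. (c * poly q (z \<xi>)) ^ m /\<^sub>R fact m)"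
        using nn c by (intro mult_right_mono sum_nonneg) auto
      ultimately show ?thesis unfolding P by linarith
    qed
    then show "AE \<xi> in lborel. \<bar>poly (P M) (z \<xi>)\<bar> \<le> exp (c * poly q 1)" for M by simp
    show "(\<lambda>\<xi>. exp (c * poly q (z \<xi>) - c)) \<in> borel_measurable borel"
      unfolding z_def poly_altdef by measurable
    have "(\<lambda>M. poly (P M) (z \<xi>)) \<longlonglongrightarrow> exp (c * poly q (z \<xi>) - c)" for \<xi>
    proof -
      have "(\<lambda>M. \<Sum>m<M. (c * poly q (z \<xi>)) ^ m /\<^sub>R fact m) \<longlonglongrightarrow> exp (c * poly q (z \<xi>))"
        using exp_converges[of "c * poly q (z \<xi>)"] by (simp add: sums_def)
      from tendsto_mult_left[OF this, of "exp (- c)"] show ?thesis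
        unfolding P by (simp add: algebra_simps flip: exp_add)
    qed
    then show "AE \<xi> in lborel. (\<lambda>M. poly (P M) (z \<xi>)) \<longlonglongrightarrow> exp (c * poly q (z \<xi>) - c)" by simp
  qed
qed

text \<open>For j \<ge> 1 the coefficient is \<alpha> times the rising factorial of 1 - \<alpha> of
  length j - 1, divided by j!. It is nonnegative exactly because 1 - \<alpha> \<ge> 0.\<close>

lemma one_minus_powr_series:
  assumes "0 < \<alpha>" "\<alpha> \<le> 1"
  obtains a :: "nat \<Rightarrow> real" where "\<And>j. 0 \<le> a j"
    "\<And>z. 0 \<le> z \<Longrightarrow> z < 1 \<Longrightarrow> (\<lambda>j. a j * z ^ j) sums (1 - (1 - z) powr \<alpha>)"
proof
  \<comment> \<open>The value at j = 0 is 0 since the leading 1 cancels the constant term of the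
    binomial series.\<close>
  define a where "a j = (if j = 0 then 0 else - ((\<alpha> gchoose j) * (- 1) ^ j))" for j :: nat
  show "0 \<le> a j" for j
  proof (cases j)
    case (Suc m)
    have "(\<alpha> gchoose j) * (- 1) ^ j = pochhammer (- \<alpha>) j / fact j"
      by (simp add: gbinomial_pochhammer)
    also have "pochhammer (- \<alpha>) j = - \<alpha> * pochhammer (1 - \<alpha>) m"
      by (simp add: Suc pochhammer_rec algebra_simps)
    finally have e: "(\<alpha> gchoose j) * (- 1) ^ j = - (\<alpha> * pochhammer (1 - \<alpha>) m / fact j)" by simp
    have "0 \<le> pochhammer (1 - \<alpha>) m" using assms by (auto simp: pochhammer_prod intro!: prod_nonneg)
    moreover have "a j = - ((\<alpha> gchoose j) * (- 1) ^ j)" unfolding a_def by (simp only: Suc) simp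
    ultimately show ?thesis using assms unfolding e by simp
  qed (simp add: a_def)
  fix z :: real assume z: "0 \<le> z" "z < 1"
  have "(\<lambda>j. (\<alpha> gchoose j) * (- z) ^ j) sums (1 + - z) powr \<alpha>"
    using z by (intro gen_binomial_real) auto
  from sums_diff[OF sums_single[of 0 "\<lambda>_. 1::real"] this]
  have "(\<lambda>j. (if j = 0 then 1 else 0) - (\<alpha> gchoose j) * (- z) ^ j) sums (1 - (1 - z) powr \<alpha>)" by simp
  also have "(\<lambda>j. (if j = 0 then 1 else 0) - (\<alpha> gchoose j) * (- z) ^ j) = (\<lambda>j. a j * z ^ j)"
    by (auto simp: a_def power_minus[of z])
  finally show "(\<lambda>j. a j * z ^ j) sums (1 - (1 - z) powr \<alpha>)" .
qed

text \<open>The binomial series of \<open>1 - (1 - z)\<^sup>\<alpha>\<close> has nonnegative coefficients for \<open>0 < \<alpha> \<le> 1\<close>, so with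
  \<open>z = exp (-k|\<xi>|\<^sup>2)\<close> the exponential is a limit of polynomials in a Gaussian with nonnegative coefficients.\<close>

lemma gauss_mix_exp_powr_aux:
  assumes \<alpha>: "0 < \<alpha>" "\<alpha> \<le> 1" and k: "0 < k" and c: "0 \<le> c"
  shows "gauss_mix (\<lambda>\<xi>::'a::euclidean_space. exp (- c * (1 - exp (- k * (norm \<xi>)\<^sup>2)) powr \<alpha>))"
proof -
  obtain a :: "nat \<Rightarrow> real" where a: "\<And>j. 0 \<le> a j"
    and sums: "\<And>z. 0 \<le> z \<Longrightarrow> z < 1 \<Longrightarrow> (\<lambda>j. a j * z ^ j) sums (1 - (1 - z) powr \<alpha>)"
    using one_minus_powr_series[OF \<alpha>] by metis
  define z where "z \<xi> = exp (- k * (norm \<xi>)\<^sup>2)" for \<xi> :: 'a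
  have z: "0 \<le> z \<xi>" "z \<xi> < 1" if "\<xi> \<noteq> 0" for \<xi> using k that by (auto simp: z_def)
  define q where "q J = (\<Sum>j<J. monom (a j) j)" for J
  have q: "poly (q J) y = (\<Sum>j<J. a j * y ^ j)" for J y
    by (simp add: q_def poly_sum poly_monom)
  show ?thesis
    unfolding z_def[symmetric]
  proof (rule gauss_mix_lim)
    show "gauss_mix (\<lambda>\<xi>. exp (c * poly (q J) (z \<xi>) - c))" for J
      unfolding z_def using a k c
      by (intro gauss_mix_exp_poly) (auto simp: q_def coeff_sum intro!: sum_nonneg)
    show "AE \<xi> in lborel. \<bar>exp (c * poly (q J) (z \<xi>) - c)\<bar> \<le> 1" for J
      using AE_lborel_singleton[of 0]
    proof eventually_elim
      case (elim \<xi>)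
      note s = sums[OF z[OF elim]]
      have "poly (q J) (z \<xi>) \<le> (\<Sum>j. a j * z \<xi> ^ j)"
        unfolding q using s a z[OF elim] by (intro sum_le_suminf) (auto simp: sums_iff)
      also have "\<dots> = 1 - (1 - z \<xi>) powr \<alpha>" using s by (simp add: sums_iff)
      also have "\<dots> \<le> 1" by simp
      finally have "c * poly (q J) (z \<xi>) \<le> c" using mult_left_mono[of "poly (q J) (z \<xi>)" 1 c] c by simp
      then show ?case by simp
    qed
    show "(\<lambda>\<xi>. exp (- c * (1 - z \<xi>) powr \<alpha>)) \<in> borel_measurable borel"
      unfolding z_def by measurable
    show "AE \<xi> in lborel. (\<lambda>J. exp (c * poly (q J) (z \<xi>) - c)) \<longlonglongrightarrow> exp (- c * (1 - z \<xi>) powr \<alpha>)"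
      using AE_lborel_singleton[of 0]
    proof eventually_elim
      case (elim \<xi>)
      have "(\<lambda>J. poly (q J) (z \<xi>)) \<longlonglongrightarrow> 1 - (1 - z \<xi>) powr \<alpha>"
        using sums[OF z[OF elim]] by (simp add: q sums_def)
      then have "(\<lambda>J. exp (c * poly (q J) (z \<xi>) - c)) \<longlonglongrightarrow> exp (c * (1 - (1 - z \<xi>) powr \<alpha>) - c)"
        by (intro tendsto_intros)
      then show ?case by (simp add: algebra_simps)
    qed
  qed
qed

text \<open>With m = k + 1, the quantity m (1 - exp(-|\<xi>|^2/m)) tends to |\<xi>|^2. Raising it to
  the power \<alpha> = \<theta>/2 explains the factor m^\<alpha> in front, and \<theta> \<le> 2
  enters as \<alpha> \<le> 1.\<close>

lemma gauss_mix_exp_norm_powr: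
  assumes "0 < \<theta>" "\<theta> \<le> 2"
  shows "gauss_mix (\<lambda>\<xi>::'a::euclidean_space. exp (- (norm \<xi> powr \<theta>)))"
proof (rule gauss_mix_lim)
  define \<alpha> where "\<alpha> = \<theta> / 2"
  let ?f = "\<lambda>k (\<xi>::'a). exp (- (real (Suc k) powr \<alpha>) * (1 - exp (- (1 / real (Suc k)) * (norm \<xi>)\<^sup>2)) powr \<alpha>)"
  show "gauss_mix (?f k)" for k
    using assms by (intro gauss_mix_exp_powr_aux) (auto simp: \<alpha>_def)
  show "AE \<xi> in lborel. \<bar>?f k \<xi>\<bar> \<le> 1" for k by simp
  show "(\<lambda>\<xi>::'a. exp (- (norm \<xi> powr \<theta>))) \<in> borel_measurable borel" by measurable
  have conv: "(\<lambda>k. ?f k \<xi>) \<longlonglongrightarrow> exp (- (norm \<xi> powr \<theta>))" if "\<xi> \<noteq> 0" for \<xi> :: 'a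
  proof -
    define l where "l = (norm \<xi>)\<^sup>2"
    have l: "0 < l" using that by (simp add: l_def)
    have "((\<lambda>h. (1 - exp (- h * l)) / h) \<longlongrightarrow> l) (at_right 0)"
    proof -
      have "((\<lambda>h. 1 - exp (- h * l)) has_real_derivative l) (at 0)"
        by (auto intro!: derivative_eq_intros)
      then have "((\<lambda>h. (1 - exp (- h * l)) / h) \<longlongrightarrow> l) (at 0)"
        by (simp add: has_field_derivative_iff)
      then show ?thesis by (rule filterlim_mono) (auto simp: at_within_le_at)
    qed
    moreover have "filterlim (\<lambda>k. 1 / real (Suc k)) (at_right 0) sequentially"
      unfolding filterlim_at using LIMSEQ_Suc[OF lim_1_over_n] by auto
    ultimately have "(\<lambda>k. (1 - exp (- (1 / real (Suc k)) * l)) / (1 / real (Suc k))) \<longlonglongrightarrow> l"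
      by (rule filterlim_compose)
    then have "(\<lambda>k. (real (Suc k) * (1 - exp (- (1 / real (Suc k)) * l))) powr \<alpha>) \<longlonglongrightarrow> l powr \<alpha>"
      using l by (intro tendsto_powr) (auto simp: mult.commute)
    also have "(\<lambda>k. (real (Suc k) * (1 - exp (- (1 / real (Suc k)) * l))) powr \<alpha>)
        = (\<lambda>k. real (Suc k) powr \<alpha> * (1 - exp (- (1 / real (Suc k)) * l)) powr \<alpha>)"
      using l by (intro ext powr_mult)
    also have "l powr \<alpha> = norm \<xi> powr \<theta>"
    proof -
      have "norm \<xi> powr \<theta> = (norm \<xi> powr 2) powr (\<theta> / 2)" by (simp only: powr_powr) simp
      then show ?thesis using that by (simp add: l_def \<alpha>_def)
    qed
    finally have "(\<lambda>k. exp (- (real (Suc k) powr \<alpha> * (1 - exp (- (1 / real (Suc k)) * l)) powr \<alpha>))) \<longlonglongrightarrow> exp (- (norm \<xi> powr \<theta>))"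
      by (intro tendsto_intros)
    then show ?thesis by (simp add: l_def)
  qed
  show "AE \<xi> in lborel. (\<lambda>k. ?f k \<xi>) \<longlonglongrightarrow> exp (- (norm \<xi> powr \<theta>))"
    using AE_lborel_singleton[of 0]
  proof eventually_elim
    case (elim \<xi>)
    then show ?case by (rule conv)
  qed
qed

text \<open>The kernel at time 1 without its normalising factor (2 pi)^(-n); all other times follow
  from it by scaling.\<close>

definition frac_profile :: "real \<Rightarrow> 'a::euclidean_space \<Rightarrow> real" where
  "frac_profile \<theta> x = (\<integral>\<xi>. cos (x \<bullet> \<xi>) * exp (- (norm \<xi> powr \<theta>)) \<partial>lborel)"

lemma integrable_frac_profile_integrand:
  assumes "0 < \<theta>" "0 < t"
  shows "integrable lborel (\<lambda>\<xi>::'a::euclidean_space. cos (x \<bullet> \<xi>) * exp (- t * norm \<xi> powr \<theta>))"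
  by (rule Bochner_Integration.integrable_bound[OF integrable_exp_norm_powr[OF assms]])
     (auto simp: abs_mult intro!: mult_left_le_one_le)

text \<open>Membership in \<open>gauss_mix\<close> speaks of the symbol times
  exp(-\<delta>|\<xi>|^2). As the symbol itself is integrable, dominated convergence removes this
  factor along \<delta> = 1/(k+1).\<close>

lemma radial_cone_frac_profile:
  assumes "0 < \<theta>" "\<theta> \<le> 2"
  shows "radial_cone (frac_profile \<theta> :: 'a::euclidean_space \<Rightarrow> real)"
proof (rule radial_cone_lim)
  let ?K = "\<lambda>k (x::'a). \<integral>\<xi>. cos (x \<bullet> \<xi>) * (exp (- (norm \<xi> powr \<theta>)) * exp (- (1 / real (Suc k)) * (norm \<xi>)\<^sup>2)) \<partial>lborel"
  show "radial_cone (?K k)" for k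
  proof -
    have "0 < 1 / real (Suc k)" by simp
    then show ?thesis
      using gauss_mix_exp_norm_powr[OF assms, where 'a='a] unfolding gauss_mix_def by blast
  qed
  show "(\<lambda>k. ?K k x) \<longlonglongrightarrow> frac_profile \<theta> x" for x
    unfolding frac_profile_def
  proof (rule integral_dominated_convergence)
    show "integrable lborel (\<lambda>\<xi>::'a. exp (- (norm \<xi> powr \<theta>)))"
      using integrable_exp_norm_powr[of \<theta> 1] assms by simp
    show "AE \<xi> in lborel. (\<lambda>k. cos (x \<bullet> \<xi>) * (exp (- (norm \<xi> powr \<theta>)) * exp (- (1 / real (Suc k)) * (norm \<xi>)\<^sup>2)))
          \<longlonglongrightarrow> cos (x \<bullet> \<xi>) * exp (- (norm \<xi> powr \<theta>))"
    proof (rule AE_I2)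
      fix \<xi> :: 'a
      have "(\<lambda>k. exp (- (1 / real (Suc k)) * (norm \<xi>)\<^sup>2)) \<longlonglongrightarrow> exp (- 0 * (norm \<xi>)\<^sup>2)"
        by (intro tendsto_intros LIMSEQ_Suc[OF lim_1_over_n])
      then have "(\<lambda>k. cos (x \<bullet> \<xi>) * (exp (- (norm \<xi> powr \<theta>)) * exp (- (1 / real (Suc k)) * (norm \<xi>)\<^sup>2)))
          \<longlonglongrightarrow> cos (x \<bullet> \<xi>) * (exp (- (norm \<xi> powr \<theta>)) * exp (- 0 * (norm \<xi>)\<^sup>2))"
        by (rule tendsto_mult_left[OF tendsto_mult_left])
      then show "(\<lambda>k. cos (x \<bullet> \<xi>) * (exp (- (norm \<xi> powr \<theta>)) * exp (- (1 / real (Suc k)) * (norm \<xi>)\<^sup>2)))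
          \<longlonglongrightarrow> cos (x \<bullet> \<xi>) * exp (- (norm \<xi> powr \<theta>))" by simp
    qed
    show "AE \<xi> in lborel. norm (cos (x \<bullet> \<xi>) * (exp (- (norm \<xi> powr \<theta>)) * exp (- (1 / real (Suc k)) * (norm \<xi>)\<^sup>2)))
        \<le> exp (- (norm \<xi> powr \<theta>))" for k
    proof (rule AE_I2)
      fix \<xi> :: 'a
      have "\<bar>cos (x \<bullet> \<xi>)\<bar> * (exp (- (norm \<xi> powr \<theta>)) * exp (- (1 / real (Suc k)) * (norm \<xi>)\<^sup>2))
         \<le> 1 * (exp (- (norm \<xi> powr \<theta>)) * 1)"
        by (intro mult_mono) auto
      then show "norm (cos (x \<bullet> \<xi>) * (exp (- (norm \<xi> powr \<theta>)) * exp (- (1 / real (Suc k)) * (norm \<xi>)\<^sup>2)))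
        \<le> exp (- (norm \<xi> powr \<theta>))" by (simp add: abs_mult)
    qed
  qed measurable
qed

lemma borel_measurable_frac_profile [measurable]: "frac_profile \<theta> \<in> borel_measurable borel"
  unfolding frac_profile_def by measurable

text \<open>Integrability of the profile is not known at this point, so it is tested against a
  Gaussian. Fubini moves the Fourier transform onto the Gaussian, and the substitution \<xi> = 2
  sqrt(\<delta>) \<eta> cancels all powers of \<delta> in the prefactor, leaving an expression whose
  limit as \<delta> tends to 0 is visible.\<close>

lemma integral_frac_profile_gauss:
  assumes \<theta>: "0 < \<theta>" and \<delta>: "0 < \<delta>"
  shows "integrable lborel (\<lambda>x::'a::euclidean_space. frac_profile \<theta> x * exp (- \<delta> * (norm x)\<^sup>2))"
    and "(\<integral>x. frac_profile \<theta> (x::'a) * exp (- \<delta> * (norm x)\<^sup>2) \<partial>lborel)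
      = (2 * sqrt pi) ^ DIM('a) * (\<integral>\<eta>. exp (- (norm ((2 * sqrt \<delta>) *\<^sub>R (\<eta>::'a)) powr \<theta>)) * exp (- (norm \<eta>)\<^sup>2) \<partial>lborel)"
proof -
  let ?f = "\<lambda>(x::'a) (\<xi>::'a). cos (x \<bullet> \<xi>) * exp (- (norm \<xi> powr \<theta>)) * exp (- \<delta> * (norm x)\<^sup>2)"
  have E: "integrable lborel (\<lambda>\<xi>::'a. exp (- (norm \<xi> powr \<theta>)))"
    using integrable_exp_norm_powr[of \<theta> 1] \<theta> by simp
  have Ga: "integrable lborel (\<lambda>x::'a. exp (- \<delta> * (norm x)\<^sup>2))"
    using integrable_gaussian_fourier[OF \<delta>, of 0] by simp
  have int: "integrable (lborel \<Otimes>\<^sub>M lborel) (\<lambda>(x, \<xi>). ?f x \<xi>)"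
  proof (rule lborel_pair.Fubini_integrable)
    have i1: "integrable lborel (\<lambda>\<xi>. ?f x \<xi>)" for x
      using integrable_frac_profile_integrand[OF \<theta>, of 1 x] by (intro integrable_mult_left) simp
    then show "AE x in lborel. integrable lborel (\<lambda>\<xi>. case (x, \<xi>) of (x, \<xi>) \<Rightarrow> ?f x \<xi>)" by simp
    show "integrable lborel (\<lambda>x. \<integral>\<xi>. norm (case (x, \<xi>) of (x, \<xi>) \<Rightarrow> ?f x \<xi>) \<partial>lborel)"
    proof (rule Bochner_Integration.integrable_bound)
      show "integrable lborel (\<lambda>x::'a. (\<integral>\<xi>. exp (- (norm (\<xi>::'a) powr \<theta>)) \<partial>lborel) * exp (- \<delta> * (norm x)\<^sup>2))"
        by (intro integrable_mult_right Ga)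
      show "AE x in lborel. norm (\<integral>\<xi>. norm (case (x, \<xi>) of (x, \<xi>) \<Rightarrow> ?f x \<xi>) \<partial>lborel)
         \<le> norm ((\<integral>\<xi>. exp (- (norm (\<xi>::'a) powr \<theta>)) \<partial>lborel) * exp (- \<delta> * (norm x)\<^sup>2))"
      proof (rule AE_I2)
        fix x :: 'a
        have "(\<integral>\<xi>. norm (?f x \<xi>) \<partial>lborel) \<le> (\<integral>\<xi>. exp (- (norm (\<xi>::'a) powr \<theta>)) * exp (- \<delta> * (norm x)\<^sup>2) \<partial>lborel)"
          using i1 by (intro integral_mono integrable_norm integrable_mult_left E) (auto simp: abs_mult intro!: mult_left_le_one_le)
        moreover have "0 \<le> (\<integral>\<xi>. norm (?f x \<xi>) \<partial>lborel)" by simp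
        ultimately show "norm (\<integral>\<xi>. norm (case (x, \<xi>) of (x, \<xi>) \<Rightarrow> ?f x \<xi>) \<partial>lborel)
         \<le> norm ((\<integral>\<xi>. exp (- (norm (\<xi>::'a) powr \<theta>)) \<partial>lborel) * exp (- \<delta> * (norm x)\<^sup>2))"
          by simp
      qed
    qed measurable
  qed measurable
  have inner: "(\<integral>\<xi>. ?f x \<xi> \<partial>lborel) = frac_profile \<theta> x * exp (- \<delta> * (norm x)\<^sup>2)" for x
    by (simp add: frac_profile_def)
  have inner2: "(\<integral>x. ?f x \<xi> \<partial>lborel) = sqrt (pi / \<delta>) ^ DIM('a) * (exp (- (norm \<xi> powr \<theta>)) * exp (- (norm \<xi>)\<^sup>2 / (4 * \<delta>)))" for \<xi>
  proof -
    have "(\<integral>x. ?f x \<xi> \<partial>lborel) = (\<integral>x. exp (- (norm \<xi> powr \<theta>)) * (cos (\<xi> \<bullet> x) * exp (- \<delta> * (norm x)\<^sup>2)) \<partial>lborel)"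
      by (simp add: inner_commute mult_ac)
    also have "\<dots> = exp (- (norm \<xi> powr \<theta>)) * (sqrt (pi / \<delta>) ^ DIM('a) * exp (- (norm \<xi>)\<^sup>2 / (4 * \<delta>)))"
      by (simp only: integral_mult_right_zero integral_gaussian_fourier[OF \<delta>])
    finally show ?thesis by (simp add: mult_ac)
  qed
  show "integrable lborel (\<lambda>x::'a. frac_profile \<theta> x * exp (- \<delta> * (norm x)\<^sup>2))"
    using lborel_pair.integrable_fst[OF int] unfolding inner .
  have "(\<integral>x. frac_profile \<theta> (x::'a) * exp (- \<delta> * (norm x)\<^sup>2) \<partial>lborel) =
    (\<integral>\<xi>. sqrt (pi / \<delta>) ^ DIM('a) * (exp (- (norm (\<xi>::'a) powr \<theta>)) * exp (- (norm \<xi>)\<^sup>2 / (4 * \<delta>))) \<partial>lborel)"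
    using lborel_pair.Fubini_integral[OF int] unfolding inner inner2 by simp
  also have "\<dots> = (2 * sqrt \<delta>) ^ DIM('a) * (\<integral>\<eta>. sqrt (pi / \<delta>) ^ DIM('a) *
      (exp (- (norm ((2 * sqrt \<delta>) *\<^sub>R \<eta> :: 'a) powr \<theta>)) * exp (- (norm ((2 * sqrt \<delta>) *\<^sub>R \<eta>))\<^sup>2 / (4 * \<delta>))) \<partial>lborel)"
  proof -
    have "integrable lborel (\<lambda>\<xi>. sqrt (pi / \<delta>) ^ DIM('a) * (exp (- (norm (\<xi>::'a) powr \<theta>)) * exp (- (norm \<xi>)\<^sup>2 / (4 * \<delta>))))"
      using lborel_pair.integrable_snd[OF int] unfolding inner2 .
    from integral_lborel_affine[OF this, of "2 * sqrt \<delta>" 0] \<delta> show ?thesis by simp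
  qed
  also have "\<dots> = (2 * sqrt \<delta>) ^ DIM('a) * sqrt (pi / \<delta>) ^ DIM('a) * (\<integral>\<eta>. exp (- (norm ((2 * sqrt \<delta>) *\<^sub>R (\<eta>::'a)) powr \<theta>)) * exp (- (norm \<eta>)\<^sup>2) \<partial>lborel)"
    using \<delta> by (simp add: power_mult_distrib)
  also have "(2 * sqrt \<delta>) ^ DIM('a) * sqrt (pi / \<delta>) ^ DIM('a) = (2 * sqrt pi) ^ DIM('a)"
  proof -
    have "2 * sqrt \<delta> * sqrt (pi / \<delta>) = 2 * sqrt pi" using \<delta> by (simp add: real_sqrt_divide)
    then show ?thesis by (simp only: power_mult_distrib[symmetric])
  qed
  finally show "(\<integral>x. frac_profile \<theta> (x::'a) * exp (- \<delta> * (norm x)\<^sup>2) \<partial>lborel)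
      = (2 * sqrt pi) ^ DIM('a) * (\<integral>\<eta>. exp (- (norm ((2 * sqrt \<delta>) *\<^sub>R (\<eta>::'a)) powr \<theta>)) * exp (- (norm \<eta>)\<^sup>2) \<partial>lborel)" .
qed

text \<open>The profile is nonnegative, so the Gaussian-weighted integrals increase as \<delta>
  decreases. Monotone convergence gives integrability and the value together, with neither a decay
  estimate nor Fourier inversion.\<close>

lemma integral_frac_profile:
  assumes \<theta>: "0 < \<theta>" "\<theta> \<le> 2"
  shows integrable_frac_profile: "integrable lborel (frac_profile \<theta> :: 'a::euclidean_space \<Rightarrow> real)"
    and "(\<integral>x. frac_profile \<theta> (x::'a) \<partial>lborel) = (2 * pi) ^ DIM('a)"
proof -
  let ?d = "\<lambda>k. 1 / real (Suc k)"
  let ?f = "\<lambda>k (x::'a). frac_profile \<theta> x * exp (- ?d k * (norm x)\<^sup>2)"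
  have nn: "0 \<le> frac_profile \<theta> x" for x :: 'a
    using radial_cone_frac_profile[OF \<theta>, where 'a='a] by (auto simp: radial_cone_def)
  have int: "integrable lborel (?f k)" for k
    by (rule integral_frac_profile_gauss(1)[OF \<theta>(1)]) simp
  have mono: "mono (\<lambda>k. ?f k x)" for x
  proof (rule monoI)
    fix m k :: nat assume "m \<le> k"
    then show "?f m x \<le> ?f k x"
      using nn by (intro mult_left_mono) (auto intro!: divide_left_mono mult_right_mono simp: frac_le)
  qed
  have d0: "?d \<longlonglongrightarrow> 0" by (rule LIMSEQ_Suc[OF lim_1_over_n])
  have lim: "(\<lambda>k. ?f k x) \<longlonglongrightarrow> frac_profile \<theta> x" for x
  proof -
    have "(\<lambda>k. ?f k x) \<longlonglongrightarrow> frac_profile \<theta> x * exp (- 0 * (norm x)\<^sup>2)"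
      by (intro tendsto_intros d0)
    then show ?thesis by simp
  qed
  have lim2: "(\<lambda>k. integral\<^sup>L lborel (?f k)) \<longlonglongrightarrow> (2 * pi) ^ DIM('a)"
  proof -
    have "(\<lambda>k. \<integral>\<eta>. exp (- (norm ((2 * sqrt (?d k)) *\<^sub>R (\<eta>::'a)) powr \<theta>)) * exp (- (norm \<eta>)\<^sup>2) \<partial>lborel)
       \<longlonglongrightarrow> (\<integral>\<eta>. exp (- 1 * (norm (\<eta>::'a))\<^sup>2) \<partial>lborel)"
    proof (rule integral_dominated_convergence)
      show "integrable lborel (\<lambda>\<eta>::'a. exp (- 1 * (norm \<eta>)\<^sup>2))"
        using integrable_gaussian_fourier[of 1 "0::'a"] by simp
      show "AE \<eta>::'a in lborel. (\<lambda>k. exp (- (norm ((2 * sqrt (?d k)) *\<^sub>R \<eta>) powr \<theta>)) * exp (- (norm \<eta>)\<^sup>2))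
         \<longlonglongrightarrow> exp (- 1 * (norm \<eta>)\<^sup>2)"
      proof (rule AE_I2)
        fix \<eta> :: 'a
        have "(\<lambda>k. norm ((2 * sqrt (?d k)) *\<^sub>R \<eta>) powr \<theta>) \<longlonglongrightarrow> norm ((2 * sqrt 0) *\<^sub>R \<eta>) powr \<theta>"
          using \<theta> by (intro tendsto_powr' tendsto_intros d0) (auto intro!: always_eventually)
        then have "(\<lambda>k. exp (- (norm ((2 * sqrt (?d k)) *\<^sub>R \<eta>) powr \<theta>)) * exp (- (norm \<eta>)\<^sup>2))
           \<longlonglongrightarrow> exp (- (norm ((2 * sqrt 0) *\<^sub>R \<eta>) powr \<theta>)) * exp (- (norm \<eta>)\<^sup>2)"
          by (intro tendsto_mult_right tendsto_exp tendsto_minus)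
        then show "(\<lambda>k. exp (- (norm ((2 * sqrt (?d k)) *\<^sub>R \<eta>) powr \<theta>)) * exp (- (norm \<eta>)\<^sup>2))
         \<longlonglongrightarrow> exp (- 1 * (norm \<eta>)\<^sup>2)" by simp
      qed
    qed (auto simp: abs_mult)
    also have "(\<integral>\<eta>. exp (- 1 * (norm (\<eta>::'a))\<^sup>2) \<partial>lborel) = sqrt pi ^ DIM('a)"
      using integral_gaussian_fourier[of 1 "0::'a"] by simp
    finally have "(\<lambda>k. (2 * sqrt pi) ^ DIM('a) * (\<integral>\<eta>. exp (- (norm ((2 * sqrt (?d k)) *\<^sub>R (\<eta>::'a)) powr \<theta>)) * exp (- (norm \<eta>)\<^sup>2) \<partial>lborel))
       \<longlonglongrightarrow> (2 * sqrt pi) ^ DIM('a) * sqrt pi ^ DIM('a)"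
      by (rule tendsto_mult_left)
    moreover have "(2 * sqrt pi) ^ DIM('a) * sqrt pi ^ DIM('a) = (2 * pi) ^ DIM('a)"
    proof -
      have "2 * sqrt pi * sqrt pi = 2 * pi" by simp
      then show ?thesis by (simp only: power_mult_distrib[symmetric])
    qed
    moreover have "integral\<^sup>L lborel (?f k) = (2 * sqrt pi) ^ DIM('a) *
       (\<integral>\<eta>. exp (- (norm ((2 * sqrt (?d k)) *\<^sub>R (\<eta>::'a)) powr \<theta>)) * exp (- (norm \<eta>)\<^sup>2) \<partial>lborel)" for k
      by (rule integral_frac_profile_gauss(2)[OF \<theta>(1)]) simp
    ultimately show ?thesis by (simp only:)
  qed
  show "integrable lborel (frac_profile \<theta> :: 'a \<Rightarrow> real)"
    by (rule integrable_monotone_convergence[OF int AE_I2[OF mono] AE_I2[OF lim] lim2]) simp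
  show "(\<integral>x. frac_profile \<theta> (x::'a) \<partial>lborel) = (2 * pi) ^ DIM('a)"
    by (rule integral_monotone_convergence[OF int AE_I2[OF mono] AE_I2[OF lim] lim2]) simp
qed

section \<open>The fractional heat kernel\<close>

lemma frac_heat_kernel_lborel:
  "frac_heat_kernel \<theta> x t =
     (2 * pi) powr (- real DIM('a)) * (\<integral>\<xi>. cos (x \<bullet> \<xi>) * exp (- t * norm \<xi> powr \<theta>) \<partial>lborel)"
  for x :: "'a::euclidean_space"
  unfolding frac_heat_kernel_def by (subst integral_completion) auto

lemma borel_measurable_frac_heat_kernel [measurable (raw)]:
  fixes f :: "'b \<Rightarrow> 'a::euclidean_space"
  assumes [measurable]: "f \<in> borel_measurable M" "g \<in> borel_measurable M"
  shows "(\<lambda>x. frac_heat_kernel \<theta> (f x) (g x)) \<in> borel_measurable M"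
  unfolding frac_heat_kernel_lborel by measurable

lemma sets_borel_ball [measurable]: "ball c r \<in> sets borel"
  by (rule borel_open) simp

lemma borel_measurable_indicator_ball [measurable (raw)]:
  fixes f g :: "'b \<Rightarrow> 'a::euclidean_space"
  assumes [measurable]: "f \<in> borel_measurable M" "g \<in> borel_measurable M"
  shows "(\<lambda>x. indicator (ball (f x) r) (g x) :: ennreal) \<in> borel_measurable M"
  unfolding indicator_def mem_ball by measurable

text \<open>The parameter \<open>ty\<close> ties the dimension in \<open>N\<close> to a fixed space.
  In terms of \<open>N\<close> the critical power is 1 + 1/N, and the kernel scales like
  t^(-N).\<close>

locale critical_exponent =
  fixes \<theta> N :: real and ty :: "'a::euclidean_space itself"
  assumes theta: "0 < \<theta>" "\<theta> \<le> 2" and N_def: "N = real DIM('a) / \<theta>"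
begin

abbreviation G :: "'a \<Rightarrow> real \<Rightarrow> real" where "G \<equiv> frac_heat_kernel \<theta>"

lemma N_pos: "0 < N"
  using theta by (simp add: N_def)

lemma powr_inverse_theta_power: "0 < t \<Longrightarrow> (t powr (1 / \<theta>)) ^ DIM('a) = t powr N"
  by (simp add: N_def powr_powr flip: powr_realpow)

lemma G_scale:
  assumes t: "0 < t"
  shows "G x t = t powr (- N) * (frac_profile \<theta> ((1 / t powr (1 / \<theta>)) *\<^sub>R x) / (2 * pi) ^ DIM('a))"
proof -
  define \<tau> where "\<tau> = t powr (1 / \<theta>)"
  have \<tau>: "0 < \<tau>" "\<tau> powr \<theta> = t" using t theta by (auto simp: \<tau>_def powr_powr)
  have int: "integrable lborel (\<lambda>\<xi>::'a. cos (x \<bullet> \<xi>) * exp (- t * norm \<xi> powr \<theta>))"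
    by (rule integrable_frac_profile_integrand) (use theta t in auto)
  have "(\<integral>\<xi>. cos (x \<bullet> \<xi>) * exp (- t * norm \<xi> powr \<theta>) \<partial>lborel)
      = (1 / \<tau>) ^ DIM('a) * (\<integral>\<xi>. cos (x \<bullet> ((1 / \<tau>) *\<^sub>R \<xi>)) * exp (- t * norm ((1 / \<tau>) *\<^sub>R \<xi>) powr \<theta>) \<partial>lborel)"
    using integral_lborel_affine[OF int, of "1 / \<tau>" 0] \<tau> by simp
  also have "(\<lambda>\<xi>::'a. cos (x \<bullet> ((1 / \<tau>) *\<^sub>R \<xi>)) * exp (- t * norm ((1 / \<tau>) *\<^sub>R \<xi>) powr \<theta>)) =
     (\<lambda>\<xi>. cos (((1 / \<tau>) *\<^sub>R x) \<bullet> \<xi>) * exp (- (norm \<xi> powr \<theta>)))"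
  proof
    fix \<xi> :: 'a
    have "t * norm ((1 / \<tau>) *\<^sub>R \<xi>) powr \<theta> = norm \<xi> powr \<theta>"
      using \<tau> t by (simp add: powr_divide)
    then show "cos (x \<bullet> ((1 / \<tau>) *\<^sub>R \<xi>)) * exp (- t * norm ((1 / \<tau>) *\<^sub>R \<xi>) powr \<theta>)
       = cos (((1 / \<tau>) *\<^sub>R x) \<bullet> \<xi>) * exp (- (norm \<xi> powr \<theta>))" by simp
  qed
  finally have "(\<integral>\<xi>. cos (x \<bullet> \<xi>) * exp (- t * norm \<xi> powr \<theta>) \<partial>lborel)
      = (1 / \<tau>) ^ DIM('a) * frac_profile \<theta> ((1 / \<tau>) *\<^sub>R x)" by (simp add: frac_profile_def)
  moreover have "(1 / \<tau>) ^ DIM('a) = t powr (- N)"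
    using powr_inverse_theta_power[OF t] by (simp add: power_divide powr_minus_divide \<tau>_def)
  moreover have "(2 * pi) powr (- real DIM('a)) = 1 / (2 * pi) ^ DIM('a)"
    by (simp add: powr_minus_divide powr_realpow)
  ultimately show ?thesis by (simp add: frac_heat_kernel_lborel \<tau>_def)
qed

lemma profile_cone: "radial_cone (frac_profile \<theta> :: 'a \<Rightarrow> real)"
  by (rule radial_cone_frac_profile[OF theta])

lemma profile_mono: "norm x \<le> norm y \<Longrightarrow> frac_profile \<theta> y \<le> frac_profile \<theta> x" for x y :: 'a
  using profile_cone unfolding radial_cone_def by blast

lemma profile_nonneg: "0 \<le> frac_profile \<theta> x" for x :: 'a
  using profile_cone unfolding radial_cone_def by blast

lemma G_mono:
  assumes "0 < t" "norm x \<le> norm y"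
  shows "G y t \<le> G x t"
  unfolding G_scale[OF assms(1)] using assms
  by (intro mult_left_mono divide_right_mono profile_mono) (auto intro!: mult_left_mono divide_right_mono)

lemma G_nonneg: "0 < t \<Longrightarrow> 0 \<le> G x t"
  using profile_nonneg by (simp add: G_scale)

lemma nn_integral_G:
  assumes t: "0 < t"
  shows "(\<integral>\<^sup>+x. ennreal (G x t) \<partial>lborel) = 1"
proof -
  define \<tau> where "\<tau> = t powr (1 / \<theta>)"
  have \<tau>: "0 < \<tau>" using t by (simp add: \<tau>_def)
  have nn: "0 \<le> frac_profile \<theta> x" for x :: 'a by (rule profile_nonneg)
  have prof: "(\<integral>\<^sup>+x. ennreal (frac_profile \<theta> (x::'a)) \<partial>lborel) = ennreal ((2 * pi) ^ DIM('a))"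
    unfolding integral_frac_profile(2)[OF theta, where 'a='a, symmetric]
    by (rule nn_integral_eq_integral[OF integrable_frac_profile[OF theta]]) (simp add: nn)
  have "(\<integral>\<^sup>+x. ennreal (G x t) \<partial>lborel) = ennreal (\<tau> ^ DIM('a)) * (\<integral>\<^sup>+x. ennreal (G (\<tau> *\<^sub>R x) t) \<partial>lborel)"
    using \<tau> by (subst nn_integral_lborel_affine[of _ \<tau> 0]) auto
  also have "(\<lambda>x. ennreal (G (\<tau> *\<^sub>R x) t)) = (\<lambda>x. ennreal (t powr (- N) / (2 * pi) ^ DIM('a)) * ennreal (frac_profile \<theta> x))"
    using \<tau> nn by (auto simp: G_scale[OF t] \<tau>_def[symmetric] ennreal_mult[symmetric])
  also have "(\<integral>\<^sup>+x. ennreal (t powr (- N) / (2 * pi) ^ DIM('a)) * ennreal (frac_profile \<theta> (x::'a)) \<partial>lborel)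
     = ennreal (t powr (- N) / (2 * pi) ^ DIM('a)) * ennreal ((2 * pi) ^ DIM('a))"
    unfolding prof[symmetric] by (rule nn_integral_cmult) measurable
  also have "ennreal (\<tau> ^ DIM('a)) * (ennreal (t powr (- N) / (2 * pi) ^ DIM('a)) * ennreal ((2 * pi) ^ DIM('a))) = 1"
    using t \<tau> by (simp add: \<tau>_def powr_inverse_theta_power ennreal_mult[symmetric] powr_minus)
  finally show ?thesis .
qed

lemma integrable_G: "0 < t \<Longrightarrow> integrable lborel (\<lambda>x. G x t)"
  using nn_integral_G[of t] by (intro integrableI_nonneg) (auto simp: G_nonneg)

lemma integral_G: "0 < t \<Longrightarrow> (\<integral>x. G x t \<partial>lborel) = 1"
  by (subst integral_eq_nn_integral) (auto simp: G_nonneg nn_integral_G)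

lemma G_le: "\<exists>C>0. \<forall>x t. 0 < t \<longrightarrow> G x t \<le> C * t powr (- N)"
proof -
  define C where "C = frac_profile \<theta> (0::'a) / (2 * pi) ^ DIM('a)"
  have C: "0 \<le> C" using profile_nonneg by (simp add: C_def)
  \<comment> \<open>The summand 1 gives a positive constant without a separate argument that the
    profile is positive at 0.\<close>
  have "G x t \<le> (C + 1) * t powr (- N)" if t: "0 < t" for x t
  proof -
    have "G x t \<le> G 0 t" using G_mono[OF t, of 0 x] by simp
    also have "\<dots> = t powr (- N) * C" using G_scale[OF t, of 0] by (simp add: C_def)
    also have "\<dots> \<le> (C + 1) * t powr (- N)" by (simp add: algebra_simps)
    finally show ?thesis .
  qed
  then show ?thesis using C by (intro exI[of _ "C + 1"]) auto
qed

text \<open>Up to the factor (2 pi)^(-n), t^N G(x,t) is the profile at t^(-1/\<theta>) x. The two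
  conditions of \<open>radial_cone\<close> with r = s^(-1/\<theta>) and q = t^(-1/\<theta>) thus
  become statements about two times, and the radius r / sqrt 2 corresponds to the time
  2^(\<theta>/2) s.\<close>

lemma G_modulus:
  assumes "0 < t" "t \<le> s"
  shows "t powr N * G x t \<le> s powr N * G x s"
    and "s powr N * G x s - t powr N * G x t
      \<le> 2 * ((s / t) powr (2 / \<theta>) - 1) * ((2 powr (\<theta> / 2) * s) powr N * G x (2 powr (\<theta> / 2) * s))"
proof -
  define Pi where "Pi = (2 * pi) ^ DIM('a)"
  have Pi: "0 < Pi" by (simp add: Pi_def)
  define r q where "r = 1 / s powr (1 / \<theta>)" and "q = 1 / t powr (1 / \<theta>)"
  have s: "0 < s" using assms by simp
  have rq: "0 < r" "r \<le> q" using assms theta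
    by (auto simp: r_def q_def intro!: divide_left_mono powr_mono2)
  have sc: "v powr N * G x v = frac_profile \<theta> ((1 / v powr (1 / \<theta>)) *\<^sub>R x) / Pi" if "0 < v" for v
    using that by (simp add: G_scale Pi_def powr_minus)
  have ratio: "q\<^sup>2 / r\<^sup>2 = (s / t) powr (2 / \<theta>)"
  proof -
    have "q / r = (s / t) powr (1 / \<theta>)" using assms s by (simp add: q_def r_def powr_divide)
    then have "q\<^sup>2 / r\<^sup>2 = ((s / t) powr (1 / \<theta>))\<^sup>2" by (simp flip: power_divide)
    also have "\<dots> = (s / t) powr (2 / \<theta>)" using assms s by (simp add: power2_eq_square flip: powr_add)
    finally show ?thesis .
  qed
  have r2: "1 / (2 powr (\<theta> / 2) * s) powr (1 / \<theta>) = r / sqrt 2"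
    using theta s by (simp add: r_def powr_mult powr_powr powr_half_sqrt)
  have le: "norm (r *\<^sub>R x) \<le> norm (q *\<^sub>R x)" using rq by (auto intro!: mult_right_mono)
  show "t powr N * G x t \<le> s powr N * G x s"
    using profile_mono[OF le] Pi assms s
    by (simp add: sc r_def[symmetric] q_def[symmetric] divide_right_mono)
  have "frac_profile \<theta> (r *\<^sub>R x) - frac_profile \<theta> (q *\<^sub>R x) \<le> 2 * (q\<^sup>2 / r\<^sup>2 - 1) * frac_profile \<theta> ((r / sqrt 2) *\<^sub>R x)"
    using profile_cone rq unfolding radial_cone_def by blast
  from divide_right_mono[OF this, of Pi] Pi
  show "s powr N * G x s - t powr N * G x t
      \<le> 2 * ((s / t) powr (2 / \<theta>) - 1) * ((2 powr (\<theta> / 2) * s) powr N * G x (2 powr (\<theta> / 2) * s))"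
    using assms s
    by (simp add: sc ratio r_def[symmetric] q_def[symmetric] r2 diff_divide_distrib)
qed

section \<open>Convolution with the kernel: mass and sup bounds\<close>

definition conv :: "('a \<Rightarrow> real) \<Rightarrow> real \<Rightarrow> 'a \<Rightarrow> ennreal" where
  "conv f t x = (\<integral>\<^sup>+y. ennreal (G (x - y) t * \<bar>f y\<bar>) \<partial>lborel)"

lemma borel_measurable_conv [measurable]:
  assumes [measurable]: "f \<in> borel_measurable borel"
  shows "conv f t \<in> borel_measurable borel"
  unfolding conv_def by measurable

lemma conv_flip:
  assumes [measurable]: "f \<in> borel_measurable borel"
  shows "conv f t x = (\<integral>\<^sup>+w. ennreal (G w t * \<bar>f (x - w)\<bar>) \<partial>lborel)"
  unfolding conv_def by (subst nn_integral_lborel_reflect[of _ x, symmetric]) auto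

lemma conv_le_sup:
  assumes [measurable]: "f \<in> borel_measurable borel" and t: "0 < t" and B: "\<And>y. \<bar>f y\<bar> \<le> B"
  shows "conv f t x \<le> ennreal B"
proof -
  have B0: "0 \<le> B" using B[of 0] by linarith
  have "conv f t x \<le> (\<integral>\<^sup>+w. ennreal (G w t) * ennreal B \<partial>lborel)"
    unfolding conv_flip[OF assms(1)] using B G_nonneg[OF t] B0
    by (intro nn_integral_mono) (auto simp: ennreal_mult[symmetric] intro!: ennreal_leI mult_left_mono)
  also have "\<dots> = ennreal B" by (subst nn_integral_multc) (auto simp: nn_integral_G[OF t])
  finally show ?thesis .
qed

text \<open>By Tonelli the left side is an average of integrals over translates of f, weighted by
  the probability density \<open>G w t\<close>. A bound uniform in the translation therefore
  survives with the same constant.\<close>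

lemma conv_le_transl:
  assumes [measurable]: "f \<in> borel_measurable borel" "S \<in> sets borel" and t: "0 < t"
    and M: "\<And>w. (\<integral>\<^sup>+x\<in>S. ennreal \<bar>f (x - w)\<bar> \<partial>lborel) \<le> M"
  shows "(\<integral>\<^sup>+x\<in>S. conv f t x \<partial>lborel) \<le> M"
proof -
  have "(\<integral>\<^sup>+x\<in>S. conv f t x \<partial>lborel) = (\<integral>\<^sup>+x. \<integral>\<^sup>+w. ennreal (G w t * \<bar>f (x - w)\<bar>) * indicator S x \<partial>lborel \<partial>lborel)"
    unfolding conv_flip[OF assms(1)] by (subst nn_integral_multc) auto
  also have "\<dots> = (\<integral>\<^sup>+w. \<integral>\<^sup>+x. ennreal (G w t * \<bar>f (x - w)\<bar>) * indicator S x \<partial>lborel \<partial>lborel)"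
    by (rule lborel_pair.Fubini') measurable
  also have "\<dots> = (\<integral>\<^sup>+w. ennreal (G w t) * (\<integral>\<^sup>+x\<in>S. ennreal \<bar>f (x - w)\<bar> \<partial>lborel) \<partial>lborel)"
    using G_nonneg[OF t] by (simp add: ennreal_mult mult.assoc nn_integral_cmult)
  also have "\<dots> \<le> (\<integral>\<^sup>+w. ennreal (G w t) * M \<partial>lborel)"
    by (intro nn_integral_mono mult_left_mono M) auto
  also have "\<dots> = M" by (subst nn_integral_multc) (auto simp: nn_integral_G[OF t])
  finally show ?thesis .
qed

text \<open>Away from the origin, radial monotonicity bounds \<open>G w t\<close> by its average over the ball around \<open>w / 2\<close>;
  integrating this against \<open>f\<close> leaves only the total mass of the kernel.\<close>

lemma conv_le_local:
  "\<exists>C>0. \<forall>f t \<rho> M x. f \<in> borel_measurable borel \<and> 0 < t \<and> 0 < \<rho> \<and>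
     (\<forall>z. (\<integral>\<^sup>+y\<in>ball z \<rho>. ennreal \<bar>f y\<bar> \<partial>lborel) \<le> M) \<longrightarrow>
     conv f t x \<le> ennreal (C / (min (t powr (1 / \<theta>)) \<rho>) ^ DIM('a)) * M"
proof -
  obtain C0 where C0: "0 < C0" and G_le: "\<And>x t. 0 < t \<Longrightarrow> G x t \<le> C0 * t powr (- N)"
    using G_le by blast
  define v where "v = unit_ball_vol (DIM('a))"
  have v: "0 < v" by (simp add: v_def)
  \<comment> \<open>\<open>C0\<close> serves the part near the origin. The second summand is
    \<sigma>^n / V, where V is the volume of a ball of radius \<sigma>/2.\<close>
  define C where "C = C0 + 2 ^ DIM('a) / v"
  have "0 < C" using C0 v by (simp add: C_def add_pos_pos)
  moreover have "conv f t x \<le> ennreal (C / (min (t powr (1 / \<theta>)) \<rho>) ^ DIM('a)) * M"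
    if f[measurable]: "f \<in> borel_measurable borel" and t: "0 < t" and \<rho>: "0 < \<rho>"
      and M: "\<And>z. (\<integral>\<^sup>+y\<in>ball z \<rho>. ennreal \<bar>f y\<bar> \<partial>lborel) \<le> M" for f t \<rho> M x
  proof -
    \<comment> \<open>The minimum makes one radius serve two purposes: \<sigma> \<le> \<rho> lets
      the mass hypothesis apply to balls of radius \<sigma>, and \<sigma> \<le> t^(1/\<theta>) gives
      t^(-N) \<le> \<sigma>^(-n).\<close>
    define \<sigma> where "\<sigma> = min (t powr (1 / \<theta>)) \<rho>"
    have \<sigma>: "0 < \<sigma>" "\<sigma> \<le> \<rho>" "\<sigma> \<le> t powr (1 / \<theta>)" using t \<rho> by (auto simp: \<sigma>_def)
    define V where "V = v * (\<sigma> / 2) ^ DIM('a)"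
    have V: "0 < V" using v \<sigma> by (simp add: V_def)
    have vol: "emeasure lborel (ball c (\<sigma> / 2)) = ennreal V" for c :: 'a
      using \<sigma> by (simp add: emeasure_ball V_def v_def)
    have M': "(\<integral>\<^sup>+w. indicator (ball c \<sigma>) w * ennreal \<bar>f (x - w)\<bar> \<partial>lborel) \<le> M" for c
    proof -
      have "(\<integral>\<^sup>+w. indicator (ball c \<sigma>) w * ennreal \<bar>f (x - w)\<bar> \<partial>lborel)
         = (\<integral>\<^sup>+w. indicator (ball c \<sigma>) (x - w) * ennreal \<bar>f (x - (x - w))\<bar> \<partial>lborel)"
        by (subst nn_integral_lborel_reflect[of _ x, symmetric]) auto
      also have "\<dots> \<le> (\<integral>\<^sup>+y\<in>ball (x - c) \<rho>. ennreal \<bar>f y\<bar> \<partial>lborel)"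
        using \<sigma> by (intro nn_integral_mono) (auto simp: indicator_def dist_norm norm_minus_commute algebra_simps)
      also have "\<dots> \<le> M" by (rule M)
      finally show ?thesis .
    qed
    have avg: "ennreal (G w t) \<le> indicator (ball 0 \<sigma>) w * ennreal (C0 * t powr (- N)) +
        ennreal (1 / V) * (\<integral>\<^sup>+u. ennreal (G u t) * indicator (ball (2 *\<^sub>R u) \<sigma>) w \<partial>lborel)" for w :: 'a
    proof (cases "norm w < \<sigma>")
      case True
      then show ?thesis using G_le[OF t, of w] by (auto simp: indicator_def intro!: add_increasing2 ennreal_leI)
    next
      case False
      \<comment> \<open>Since |w| \<ge> \<sigma>, every u within \<sigma>/2 of w/2 satisfies |u|
        \<le> |w|, so \<open>G w t\<close> \<le> \<open>G u t\<close>. The same closeness, read as a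
        condition on w, says that w lies in the ball of radius \<sigma> around 2u.\<close>
      have "ennreal (G w t) * ennreal V = (\<integral>\<^sup>+u. ennreal (G w t) * indicator (ball ((1/2) *\<^sub>R w) (\<sigma> / 2)) u \<partial>lborel)"
        by (subst nn_integral_cmult) (auto simp: vol)
      also have "\<dots> \<le> (\<integral>\<^sup>+u. ennreal (G u t) * indicator (ball (2 *\<^sub>R u) \<sigma>) w \<partial>lborel)"
      proof (rule nn_integral_mono)
        fix u :: 'a
        show "ennreal (G w t) * indicator (ball ((1/2) *\<^sub>R w) (\<sigma> / 2)) u \<le> ennreal (G u t) * indicator (ball (2 *\<^sub>R u) \<sigma>) w"
        proof (cases "u \<in> ball ((1/2) *\<^sub>R w) (\<sigma> / 2)")
          case True
          then have d: "norm ((1/2) *\<^sub>R w - u) < \<sigma> / 2" by (simp add: dist_norm)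
          have "norm u \<le> norm ((1/2) *\<^sub>R w) + norm ((1/2) *\<^sub>R w - u)"
            by (metis norm_minus_commute norm_triangle_sub)
          also have "\<dots> \<le> norm w" using d False by simp
          finally have 1: "G w t \<le> G u t" by (rule G_mono[OF t])
          have "norm (2 *\<^sub>R ((1/2) *\<^sub>R w - u)) < \<sigma>" using d by simp
          then have "w \<in> ball (2 *\<^sub>R u) \<sigma>" by (simp add: dist_norm norm_minus_commute scaleR_diff_right)
          with 1 True show ?thesis by (simp add: ennreal_leI)
        qed simp
      qed
      finally have "ennreal (1 / V) * (ennreal (G w t) * ennreal V) \<le>
         ennreal (1 / V) * (\<integral>\<^sup>+u. ennreal (G u t) * indicator (ball (2 *\<^sub>R u) \<sigma>) w \<partial>lborel)"
        by (intro mult_left_mono) auto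
      moreover have "ennreal (1 / V) * (ennreal (G w t) * ennreal V) = ennreal (G w t)"
        using V G_nonneg[OF t] by (simp add: ennreal_mult[symmetric])
      ultimately show ?thesis by (auto intro: add_increasing)
    qed
    have "conv f t x = (\<integral>\<^sup>+w. ennreal (G w t) * ennreal \<bar>f (x - w)\<bar> \<partial>lborel)"
      unfolding conv_flip[OF f] using G_nonneg[OF t] by (simp add: ennreal_mult)
    also have "\<dots> \<le> (\<integral>\<^sup>+w. (indicator (ball 0 \<sigma>) w * ennreal (C0 * t powr (- N)) +
        ennreal (1 / V) * (\<integral>\<^sup>+u. ennreal (G u t) * indicator (ball (2 *\<^sub>R u) \<sigma>) w \<partial>lborel)) * ennreal \<bar>f (x - w)\<bar> \<partial>lborel)"
      by (intro nn_integral_mono mult_right_mono avg) auto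
    also have "\<dots> = (\<integral>\<^sup>+w. ennreal (C0 * t powr (- N)) * (indicator (ball 0 \<sigma>) w * ennreal \<bar>f (x - w)\<bar>) +
        ennreal (1 / V) * (\<integral>\<^sup>+u. ennreal (G u t) * (indicator (ball (2 *\<^sub>R u) \<sigma>) w * ennreal \<bar>f (x - w)\<bar>) \<partial>lborel) \<partial>lborel)"
    proof (intro nn_integral_cong)
      fix w :: 'a
      have "(\<integral>\<^sup>+u. ennreal (G u t) * (indicator (ball (2 *\<^sub>R u) \<sigma>) w * ennreal \<bar>f (x - w)\<bar>) \<partial>lborel)
         = (\<integral>\<^sup>+u. ennreal (G u t) * indicator (ball (2 *\<^sub>R u) \<sigma>) w \<partial>lborel) * ennreal \<bar>f (x - w)\<bar>"
        by (subst nn_integral_multc[symmetric]) (auto simp: mult.assoc)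
      then show "(indicator (ball 0 \<sigma>) w * ennreal (C0 * t powr (- N)) +
        ennreal (1 / V) * (\<integral>\<^sup>+u. ennreal (G u t) * indicator (ball (2 *\<^sub>R u) \<sigma>) w \<partial>lborel)) * ennreal \<bar>f (x - w)\<bar>
        = ennreal (C0 * t powr (- N)) * (indicator (ball 0 \<sigma>) w * ennreal \<bar>f (x - w)\<bar>) +
        ennreal (1 / V) * (\<integral>\<^sup>+u. ennreal (G u t) * (indicator (ball (2 *\<^sub>R u) \<sigma>) w * ennreal \<bar>f (x - w)\<bar>) \<partial>lborel)"
        by (simp only: distrib_right) (simp only: mult_ac)
    qed
    also have "\<dots> = ennreal (C0 * t powr (- N)) * (\<integral>\<^sup>+w. indicator (ball 0 \<sigma>) w * ennreal \<bar>f (x - w)\<bar> \<partial>lborel) +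
        ennreal (1 / V) * (\<integral>\<^sup>+w. \<integral>\<^sup>+u. ennreal (G u t) * (indicator (ball (2 *\<^sub>R u) \<sigma>) w * ennreal \<bar>f (x - w)\<bar>) \<partial>lborel \<partial>lborel)"
      by (subst nn_integral_add) (auto simp: nn_integral_cmult)
    also have "\<dots> \<le> ennreal (C0 / \<sigma> ^ DIM('a)) * M + ennreal (1 / V) * M"
    proof (intro add_mono mult_left_mono)
    have "(\<integral>\<^sup>+w. \<integral>\<^sup>+u. ennreal (G u t) * (indicator (ball (2 *\<^sub>R u) \<sigma>) w * ennreal \<bar>f (x - w)\<bar>) \<partial>lborel \<partial>lborel)
       = (\<integral>\<^sup>+u. ennreal (G u t) * (\<integral>\<^sup>+w. indicator (ball (2 *\<^sub>R u) \<sigma>) w * ennreal \<bar>f (x - w)\<bar> \<partial>lborel) \<partial>lborel)"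
      by (subst lborel_pair.Fubini') (auto simp: nn_integral_cmult)
    also have "\<dots> \<le> (\<integral>\<^sup>+u. ennreal (G u t) * M \<partial>lborel)"
      by (intro nn_integral_mono mult_left_mono M') auto
    also have "\<dots> = M" by (subst nn_integral_multc) (auto simp: nn_integral_G[OF t])
    finally show "(\<integral>\<^sup>+w. \<integral>\<^sup>+u. ennreal (G u t) * (indicator (ball (2 *\<^sub>R u) \<sigma>) w * ennreal \<bar>f (x - w)\<bar>) \<partial>lborel \<partial>lborel) \<le> M" .
    show "ennreal (C0 * t powr (- N)) * (\<integral>\<^sup>+w. indicator (ball 0 \<sigma>) w * ennreal \<bar>f (x - w)\<bar> \<partial>lborel)
        \<le> ennreal (C0 / \<sigma> ^ DIM('a)) * M"
    proof (intro mult_mono M' ennreal_leI)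
      have "\<sigma> ^ DIM('a) \<le> (t powr (1 / \<theta>)) ^ DIM('a)" using \<sigma> by (intro power_mono) auto
      then show "C0 * t powr (- N) \<le> C0 / \<sigma> ^ DIM('a)"
        using C0 \<sigma> t by (simp add: powr_inverse_theta_power powr_minus_divide frac_le)
    qed auto
    qed simp
    also have "ennreal (C0 / \<sigma> ^ DIM('a)) * M + ennreal (1 / V) * M = ennreal (C / \<sigma> ^ DIM('a)) * M"
    proof -
      have "C / \<sigma> ^ DIM('a) = C0 / \<sigma> ^ DIM('a) + 1 / V"
        using v \<sigma> by (simp add: C_def V_def field_simps power_divide)
      then show ?thesis using V C0 \<sigma> by (simp add: distrib_right[symmetric] ennreal_plus)
    qed
    finally show ?thesis by (simp add: \<sigma>_def)
  qed
  ultimately show ?thesis by blast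
qed

end

section \<open>The logarithmic weight\<close>

definition Lg :: "real \<Rightarrow> real" where
  "Lg s = ln (exp 1 + 1 / s)"

lemma borel_measurable_Lg [measurable]: "Lg \<in> borel_measurable borel"
  unfolding Lg_def by measurable

lemma Lg_ge_1: "0 < s \<Longrightarrow> 1 \<le> Lg s"
  unfolding Lg_def by (subst ln_ge_iff) (auto intro: add_pos_pos)

lemma Lg_pos: "0 < s \<Longrightarrow> 0 < Lg s"
  using Lg_ge_1[of s] by simp

lemma Lg_antimono: "0 < s \<Longrightarrow> s \<le> t \<Longrightarrow> Lg t \<le> Lg s"
  unfolding Lg_def by (subst ln_le_cancel_iff) (auto intro!: add_pos_pos divide_left_mono)

lemma Lg_powr_le_1:
  assumes "0 < s" "0 \<le> a"
  shows "Lg s powr (- a) \<le> 1"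
  using powr_mono[of "- a" 0 "Lg s"] Lg_ge_1[OF assms(1)] assms(2) by simp

lemma Lg_powr_antimono: "0 < s \<Longrightarrow> s \<le> t \<Longrightarrow> 0 \<le> a \<Longrightarrow> Lg s powr (- a) \<le> Lg t powr (- a)"
  using Lg_antimono[of s t] Lg_pos[of t] by (intro powr_mono2') auto

text \<open>Up to a constant the logarithm does not see powers or constant factors. With w = 1/(c
  s^\<kappa>) and k = 1/\<kappa> one has 1/s = (c w)^k, so it suffices to compare ln(e + y^k) with
  ln(e + y) and ln(e + c w) with ln(e + w).\<close>

lemma Lg_comp_const:
  assumes "0 < \<kappa>" "0 < c"
  shows "\<exists>C>0. \<forall>s>0. Lg s \<le> C * Lg (c * s powr \<kappa>)"
proof -
  define k where "k = 1 / \<kappa>"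
  have k: "0 < k" using assms by (simp add: k_def)
  have l: "1 \<le> ln (exp 1 + y)" if "0 \<le> y" for y :: real
    using that by (subst ln_ge_iff) (auto intro: add_pos_nonneg)
  have 1: "ln (exp 1 + y powr k) \<le> (2 + k) * ln (exp 1 + y)" if "0 \<le> y" for y
  proof -
    have p: "1 \<le> (exp 1 + y) powr k"
      using that k exp_ge_add_one_self[of 1] by (intro ge_one_powr_ge_zero) linarith+
    have "exp 1 + y powr k \<le> exp 1 * (exp 1 + y) powr k + (exp 1 + y) powr k"
      using p k that by (intro add_mono powr_mono2) auto
    also have "\<dots> = (exp 1 + 1) * (exp 1 + y) powr k" by (simp add: algebra_simps)
    finally have "ln (exp 1 + y powr k) \<le> ln ((exp 1 + 1) * (exp 1 + y) powr k)"
      by (subst ln_le_cancel_iff) (use p in \<open>auto intro!: add_pos_nonneg mult_pos_pos\<close>)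
    also have "\<dots> = ln (exp 1 + 1) + k * ln (exp 1 + y)"
      using that by (subst ln_mult) (auto simp: ln_powr add_pos_nonneg less_imp_neq[THEN not_sym])
    also have "ln (exp 1 + 1) \<le> (2::real)"
    proof -
      have "ln (exp 1 + 1) \<le> ln (exp 1 * exp (1::real))"
      proof (subst ln_le_cancel_iff)
        have "2 * 2 \<le> exp 1 * exp (1::real)"
          using exp_ge_add_one_self[of 1] by (intro mult_mono) auto
        moreover have "exp 1 * 2 \<le> exp 1 * exp (1::real)"
          using exp_ge_add_one_self[of 1] by (intro mult_left_mono) auto
        ultimately show "exp 1 + 1 \<le> exp 1 * exp (1::real)" by linarith
      qed (auto intro: add_pos_pos)
      also have "\<dots> = 2" by (simp add: ln_mult)
      finally show ?thesis .
    qed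
    also have "2 + k * ln (exp 1 + y) \<le> (2 + k) * ln (exp 1 + y)"
      using l[OF that] by (simp add: distrib_right)
    finally show ?thesis by simp
  qed
  have 2: "ln (exp 1 + c * w) \<le> (ln (exp 1 + c) + 1) * ln (exp 1 + w)" if "0 \<le> w" for w
  proof -
    have "exp 1 + c * w \<le> (exp 1 + c) * (exp 1 + w)"
    proof -
      have "exp 1 * 1 \<le> exp 1 * exp (1::real)" by (intro mult_left_mono) auto
      moreover have "0 \<le> exp 1 * w" "0 \<le> c * exp 1" using that assms by auto
      ultimately show ?thesis unfolding distrib_left distrib_right by linarith
    qed
    then have "ln (exp 1 + c * w) \<le> ln ((exp 1 + c) * (exp 1 + w))"
      using that assms by (subst ln_le_cancel_iff) (auto intro!: add_pos_nonneg mult_pos_pos)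
    also have "\<dots> = ln (exp 1 + c) + ln (exp 1 + w)"
      using that assms by (intro ln_mult_pos) (auto intro!: add_pos_nonneg)
    also have "\<dots> \<le> (ln (exp 1 + c) + 1) * ln (exp 1 + w)"
      using l[OF that] l[of c] assms mult_left_mono[of 1 "ln (exp 1 + w)" "ln (exp 1 + c)"] by (simp add: distrib_right)
    finally show ?thesis .
  qed
  have "Lg s \<le> ((2 + k) * (ln (exp 1 + c) + 1)) * Lg (c * s powr \<kappa>)" if s: "0 < s" for s
  proof -
    define w where "w = 1 / (c * s powr \<kappa>)"
    have w: "0 < w" using s assms by (simp add: w_def)
    have "c * w = s powr (- \<kappa>)" using assms s by (simp add: w_def powr_minus_divide)
    then have "(c * w) powr k = s powr (- \<kappa> * k)" by (simp only: powr_powr)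
    also have "- \<kappa> * k = - 1" using assms by (simp add: k_def)
    finally have "(c * w) powr k = 1 / s" using s by (simp add: powr_minus_divide)
    then have "Lg s = ln (exp 1 + (c * w) powr k)" by (simp add: Lg_def)
    also have "\<dots> \<le> (2 + k) * ln (exp 1 + c * w)" using 1[of "c * w"] assms w by simp
    also have "\<dots> \<le> (2 + k) * ((ln (exp 1 + c) + 1) * ln (exp 1 + w))"
      using 2[of w] w k by (intro mult_left_mono) auto
    also have "ln (exp 1 + w) = Lg (c * s powr \<kappa>)" by (simp add: w_def Lg_def)
    finally show ?thesis by (simp add: mult.assoc)
  qed
  moreover have "0 < (2 + k) * (ln (exp 1 + c) + 1)" using k l[of c] assms by (intro mult_pos_pos) auto
  ultimately show ?thesis by blast
qed

text \<open>Apply ln y \<le> y - 1 to y = (e + 1/s)^\<delta> and divide by \<delta>; on s \<le> S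
  the sum e + 1/s is at most (e S + 1)/s.\<close>

lemma Lg_le_powr:
  assumes "0 < \<delta>" "0 < S"
  shows "\<exists>C>0. \<forall>s. 0 < s \<and> s \<le> S \<longrightarrow> Lg s \<le> C * s powr (- \<delta>)"
proof -
  have "Lg s \<le> ((exp 1 * S + 1) powr \<delta> / \<delta>) * s powr (- \<delta>)" if s: "0 < s" "s \<le> S" for s
  proof -
    have "Lg s = ln ((exp 1 + 1 / s) powr \<delta>) / \<delta>"
      using assms s by (simp add: Lg_def ln_powr add_pos_pos less_imp_neq[THEN not_sym])
    also have "\<dots> \<le> (exp 1 + 1 / s) powr \<delta> / \<delta>"
      using assms ln_le_minus_one[of "(exp 1 + 1 / s) powr \<delta>"] s
      by (intro divide_right_mono) (auto simp: add_pos_pos less_imp_neq[THEN not_sym])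
    also have "\<dots> \<le> ((exp 1 * S + 1) * (1 / s)) powr \<delta> / \<delta>"
      using assms s by (intro divide_right_mono powr_mono2) (auto simp: field_simps)
    also have "\<dots> = ((exp 1 * S + 1) powr \<delta> / \<delta>) * s powr (- \<delta>)"
      using assms s by (subst powr_mult) (auto simp: powr_minus_divide powr_divide)
    finally show ?thesis .
  qed
  moreover have "0 < (exp 1 * S + 1) powr \<delta> / \<delta>" using assms by (simp add: add_pos_pos less_imp_neq[THEN not_sym])
  ultimately show ?thesis by blast
qed

text \<open>A power of the logarithm inside the argument is absorbed by half of the power of s. This
  lets the thresholds of later splittings contain logarithms and still have a weight comparable to
  that of s.\<close>

lemma Lg_comp:
  assumes "0 < \<kappa>" "0 \<le> m" "0 < S"
  shows "\<exists>C>0. \<forall>s. 0 < s \<and> s \<le> S \<longrightarrow> Lg s \<le> C * Lg (s powr \<kappa> * Lg s powr m)"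
proof -
  \<comment> \<open>Chosen so that (s^(-\<delta>))^(m+1) = s^(-\<kappa>/2). Working with m + 1 in
    place of m avoids dividing by 0 when m = 0.\<close>
  define \<delta> where "\<delta> = \<kappa> / (2 * (m + 1))"
  have \<delta>: "0 < \<delta>" using assms by (simp add: \<delta>_def)
  obtain C1 where C1: "0 < C1" "\<And>s. 0 < s \<Longrightarrow> s \<le> S \<Longrightarrow> Lg s \<le> C1 * s powr (- \<delta>)"
    using Lg_le_powr[OF \<delta> assms(3)] by blast
  obtain C2 where C2: "0 < C2" "\<And>s. 0 < s \<Longrightarrow> Lg s \<le> C2 * Lg (C1 powr (m + 1) * s powr (\<kappa> / 2))"
    using Lg_comp_const[of "\<kappa> / 2" "C1 powr (m + 1)"] assms C1 by auto
  have "Lg s \<le> C2 * Lg (s powr \<kappa> * Lg s powr m)" if s: "0 < s" "s \<le> S" for s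
  proof -
    have "Lg s powr m \<le> Lg s powr (m + 1)" using Lg_ge_1[OF s(1)] by (intro powr_mono) auto
    also have "\<dots> \<le> (C1 * s powr (- \<delta>)) powr (m + 1)"
      using C1(2)[OF s] Lg_pos[OF s(1)] assms by (intro powr_mono2) auto
    also have "\<dots> = C1 powr (m + 1) * s powr (- (\<kappa> / 2))"
    proof -
      have "- \<delta> * (m + 1) = - (\<kappa> / 2)" using assms by (simp add: \<delta>_def divide_simps)
      then show ?thesis by (simp only: powr_mult powr_powr)
    qed
    finally have "s powr \<kappa> * Lg s powr m \<le> s powr \<kappa> * (C1 powr (m + 1) * s powr (- (\<kappa> / 2)))"
      by (intro mult_left_mono) auto
    also have "\<dots> = C1 powr (m + 1) * s powr (\<kappa> / 2)"
      by (simp add: mult.left_commute flip: powr_add)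
    finally have "Lg (C1 powr (m + 1) * s powr (\<kappa> / 2)) \<le> Lg (s powr \<kappa> * Lg s powr m)"
      using s Lg_pos[OF s(1)] by (intro Lg_antimono mult_pos_pos) auto
    then have "C2 * Lg (C1 powr (m + 1) * s powr (\<kappa> / 2)) \<le> C2 * Lg (s powr \<kappa> * Lg s powr m)"
      using C2(1) by (intro mult_left_mono) auto
    then show ?thesis using C2(2)[OF s(1)] by linarith
  qed
  then show ?thesis using C2(1) by blast
qed

lemma Lg_at_top: "filterlim Lg at_top (at_right 0)"
proof -
  have "filterlim (\<lambda>s::real. exp 1 + inverse s) at_top (at_right 0)"
    by (intro filterlim_tendsto_add_at_top[OF tendsto_const] filterlim_inverse_at_top_right)
  then show ?thesis unfolding Lg_def inverse_eq_divide
    by (rule filterlim_compose[OF ln_at_top])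
qed

lemma Lg_powr_tendsto_0: "0 < a \<Longrightarrow> ((\<lambda>s. Lg s powr (- a)) \<longlongrightarrow> 0) (at_right 0)"
  by (intro tendsto_neg_powr Lg_at_top) auto

lemma DERIV_Lg_powr:
  assumes s: "0 < s"
  shows "((\<lambda>s. Lg s powr (- N)) has_real_derivative N * Lg s powr (- N - 1) / (s * (exp 1 * s + 1))) (at s)"
proof -
  have p: "0 < exp 1 + 1 / s" using s by (auto intro: add_pos_pos)
  have "(Lg has_real_derivative (- 1 / s\<^sup>2) / (exp 1 + 1 / s)) (at s)"
    unfolding Lg_def using s p by (auto intro!: derivative_eq_intros simp: power2_eq_square)
  from DERIV_fun_powr[OF this Lg_pos[OF s], of "- N"]
  have "((\<lambda>s. Lg s powr (- N)) has_real_derivative - N * Lg s powr (- N - 1) * ((- 1 / s\<^sup>2) / (exp 1 + 1 / s))) (at s)"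
    by simp
  also have "- N * Lg s powr (- N - 1) * ((- 1 / s\<^sup>2) / (exp 1 + 1 / s)) = N * Lg s powr (- N - 1) / (s * (exp 1 * s + 1))"
  proof -
    have "(- 1 / s\<^sup>2) / (exp 1 + 1 / s) = - (1 / (s * (exp 1 * s + 1)))"
      using s p by (simp add: field_simps power2_eq_square)
    then show ?thesis by simp
  qed
  finally show ?thesis .
qed

text \<open>Up to the factor (e s + 1)/N, which is bounded on s \<le> S, the integrand is the
  derivative of L(s)^(-N), and L(s)^(-N) tends to 0 at s = 0.\<close>

lemma nn_integral_Lg:
  assumes N: "0 < N" and t: "0 < t" "t \<le> S"
  shows "(\<integral>\<^sup>+s\<in>{0<..<t}. ennreal (s powr (- 1) * Lg s powr (- N - 1)) \<partial>lborel)
     \<le> ennreal ((exp 1 * S + 1) / N * Lg t powr (- N))"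
proof -
  \<comment> \<open>\<open>Lg 0\<close> evaluates to 1 because 1 / 0 = 0, so the value at 0 has to
    be reset to the limit 0 for continuity on the closed interval.\<close>
  define W where "W s = (if s \<le> 0 then 0 else Lg s powr (- N))" for s
  define w where "w s = N * Lg s powr (- N - 1) / (s * (exp 1 * s + 1))" for s
  have der: "(W has_real_derivative w s) (at s)" if "0 < s" for s
  proof -
    have "(W has_real_derivative w s) (at s) \<longleftrightarrow> ((\<lambda>s. Lg s powr (- N)) has_real_derivative w s) (at s)"
      by (rule DERIV_cong_ev) (use that in \<open>auto simp: W_def eventually_nhds intro!: exI[of _ "{0<..}"]\<close>)
    then show ?thesis using DERIV_Lg_powr[OF that] by (simp add: w_def)
  qed
  have cont: "continuous_on {0..t} W"
    unfolding continuous_on_eq_continuous_within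
  proof
    fix s assume s: "s \<in> {0..t}"
    show "continuous (at s within {0..t}) W"
    proof (cases "s = 0")
      case True
      have "(W \<longlongrightarrow> 0) (at_right 0)"
        using Lg_powr_tendsto_0[OF N]
        by (rule Lim_transform_eventually) (auto simp: W_def eventually_at_right_less eventually_at_filter)
      then have "(W \<longlongrightarrow> W 0) (at 0 within {0..t})"
        using t by (simp add: W_def at_within_Icc_at_right)
      then show ?thesis by (simp add: True continuous_within)
    next
      case False
      then show ?thesis using der[of s] s by (auto intro: DERIV_isCont continuous_at_imp_continuous_within)
    qed
  qed
  have "(w has_integral (W t - W 0)) {0..t}"
    using t der cont by (intro fundamental_theorem_of_calculus_interior)
      (auto simp: has_real_derivative_iff_has_vector_derivative)
  then have "(\<integral>\<^sup>+s. ennreal (indicator {0..t} s * w s) \<partial>lborel) = ennreal (W t - W 0)"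
    by (intro nn_integral_has_integral_lebesgue) (use N in \<open>simp add: w_def\<close>)
  also have "W t - W 0 = Lg t powr (- N)" using t by (simp add: W_def)
  finally have I: "(\<integral>\<^sup>+s. ennreal (indicator {0..t} s * w s) \<partial>lborel) = ennreal (Lg t powr (- N))" .
  have "(\<integral>\<^sup>+s\<in>{0<..<t}. ennreal (s powr (- 1) * Lg s powr (- N - 1)) \<partial>lborel)
     \<le> (\<integral>\<^sup>+s. ennreal ((exp 1 * S + 1) / N) * ennreal (indicator {0..t} s * w s) \<partial>lborel)"
  proof (rule nn_integral_mono)
    fix s :: real
    show "ennreal (s powr (- 1) * Lg s powr (- N - 1)) * indicator {0<..<t} s
       \<le> ennreal ((exp 1 * S + 1) / N) * ennreal (indicator {0..t} s * w s)"
    proof (cases "s \<in> {0<..<t}")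
      case True
      have "s powr (- 1) * Lg s powr (- N - 1) = (exp 1 * s + 1) / N * w s"
        using True N by (simp add: w_def powr_minus_divide add_pos_pos less_imp_neq[THEN not_sym])
      also have "\<dots> \<le> (exp 1 * S + 1) / N * w s"
        using True N t by (intro mult_right_mono divide_right_mono) (auto simp: w_def)
      finally show ?thesis using True N t by (simp add: ennreal_mult[symmetric] w_def ennreal_leI)
    qed simp
  qed
  also have "\<dots> = ennreal ((exp 1 * S + 1) / N) * ennreal (Lg t powr (- N))"
    unfolding I[symmetric] w_def by (rule nn_integral_cmult) measurable
  also have "\<dots> = ennreal ((exp 1 * S + 1) / N * Lg t powr (- N))"
    using N t by (simp add: ennreal_mult[symmetric])
  finally show ?thesis .
qed

lemma nn_integral_powr_tail:
  assumes N: "0 < N" and a: "0 < a"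
  shows "(\<integral>\<^sup>+s\<in>{a..}. ennreal (s powr (- N - 1)) \<partial>lborel) = ennreal (a powr (- N) / N)"
proof -
  have "(\<integral>\<^sup>+s\<in>{a..}. ennreal (s powr (- N - 1)) \<partial>lborel) = ennreal (0 - (- (a powr (- N)) / N))"
  proof (rule nn_integral_FTC_atLeast)
    show "((\<lambda>s. - (s powr (- N)) / N) has_real_derivative s powr (- N - 1)) (at s)" if "a \<le> s" for s
      using that a N by (auto intro!: derivative_eq_intros)
    have "((\<lambda>s. s powr (- N)) \<longlongrightarrow> 0) at_top"
      using N by (intro tendsto_neg_powr filterlim_ident) auto
    from tendsto_divide[OF tendsto_minus[OF this] tendsto_const[of N]]
    show "((\<lambda>s. - (s powr (- N)) / N) \<longlongrightarrow> 0) at_top" using N by simp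
  qed auto
  then show ?thesis by simp
qed

section \<open>Estimates for the Duhamel term\<close>

context critical_exponent
begin

text \<open>For K \<ge> 0 this says that the triple norm with exponent N and radius \<rho> is at
  most K. The weight is moved to the right-hand side, and the test sets are Borel.\<close>

definition log_bounded :: "real \<Rightarrow> real \<Rightarrow> ('a \<Rightarrow> real) \<Rightarrow> bool" where
  "log_bounded \<rho> K f \<longleftrightarrow> (\<forall>z E s. E \<in> sets borel \<and> 0 < s \<and> emeasure lborel E = ennreal s \<longrightarrow>
     (\<integral>\<^sup>+x\<in>E \<inter> ball z \<rho>. ennreal \<bar>f x\<bar> \<partial>lborel) \<le> ennreal (K * Lg s powr (- N)))"

lemma log_bounded_mono: "log_bounded \<rho> K f \<Longrightarrow> K \<le> K' \<Longrightarrow> log_bounded \<rho> K' f"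
  unfolding log_bounded_def by (meson ennreal_leI mult_right_mono order_trans powr_ge_zero)

text \<open>The definition tests sets of measure exactly s > 0. Since L(s)^(-N) increases with s, a
  smaller set obeys the bound as well; a null set, for which no such s exists, is treated
  apart.\<close>

lemma log_bounded_le:
  assumes f: "log_bounded \<rho> K f" and [measurable]: "E \<in> sets borel"
    and E: "emeasure lborel E \<le> ennreal s" and s: "0 < s" and K: "0 \<le> K"
  shows "(\<integral>\<^sup>+x\<in>E \<inter> ball z \<rho>. ennreal \<bar>f x\<bar> \<partial>lborel) \<le> ennreal (K * Lg s powr (- N))"
proof (cases "emeasure lborel E = 0")
  case True
  then have "E \<inter> ball z \<rho> \<in> null_sets lborel"
    by (intro null_set_Int2) (auto simp: null_sets_def)
  then have "(\<integral>\<^sup>+x\<in>E \<inter> ball z \<rho>. ennreal \<bar>f x\<bar> \<partial>lborel) = 0"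
    by (rule nn_integral_null_set)
  then show ?thesis by simp
next
  case False
  obtain s' where s': "emeasure lborel E = ennreal s'" "0 \<le> s'"
    using E by (cases "emeasure lborel E") (auto simp: top_unique)
  then have "0 < s'" "s' \<le> s" using False E s by (auto simp: ennreal_le_iff less_le)
  then have "(\<integral>\<^sup>+x\<in>E \<inter> ball z \<rho>. ennreal \<bar>f x\<bar> \<partial>lborel) \<le> ennreal (K * Lg s' powr (- N))"
    using f s' by (auto simp: log_bounded_def)
  also have "\<dots> \<le> ennreal (K * Lg s powr (- N))"
    using \<open>0 < s'\<close> \<open>s' \<le> s\<close> K N_pos by (intro ennreal_leI mult_left_mono Lg_powr_antimono) auto
  finally show ?thesis .
qed

lemma log_bounded_small_ball:
  assumes f: "log_bounded \<rho> K f" and r: "0 < r" "r \<le> \<rho>" and K: "0 \<le> K"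
  shows "(\<integral>\<^sup>+x\<in>ball z r. ennreal \<bar>f x\<bar> \<partial>lborel) \<le> ennreal (K * Lg (unit_ball_vol (DIM('a)) * r ^ DIM('a)) powr (- N))"
proof -
  have "ball z r = ball z r \<inter> ball z \<rho>" using r by auto
  moreover have "(\<integral>\<^sup>+x\<in>ball z r \<inter> ball z \<rho>. ennreal \<bar>f x\<bar> \<partial>lborel) \<le> ennreal (K * Lg (unit_ball_vol (DIM('a)) * r ^ DIM('a)) powr (- N))"
    using r by (intro log_bounded_le[OF f]) (auto simp: emeasure_ball K)
  ultimately show ?thesis by simp
qed

lemma log_bounded_ball:
  assumes f: "log_bounded \<rho> K f" and r: "0 < \<rho>" and K: "0 \<le> K"
  shows "(\<integral>\<^sup>+x\<in>ball z \<rho>. ennreal \<bar>f x\<bar> \<partial>lborel) \<le> ennreal K"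
proof -
  have "(\<integral>\<^sup>+x\<in>ball z \<rho>. ennreal \<bar>f x\<bar> \<partial>lborel) \<le> ennreal (K * Lg (unit_ball_vol (DIM('a)) * \<rho> ^ DIM('a)) powr (- N))"
    by (rule log_bounded_small_ball[OF f]) (use r K in auto)
  also have "\<dots> \<le> ennreal (K * 1)"
    using K N_pos r by (intro ennreal_leI mult_left_mono Lg_powr_le_1) auto
  finally show ?thesis by simp
qed

lemma log_bounded_add:
  assumes "log_bounded \<rho> K f" "log_bounded \<rho> K' g" and K: "0 \<le> K" "0 \<le> K'"
    and [measurable]: "f \<in> borel_measurable borel" "g \<in> borel_measurable borel"
    and h: "\<And>x. \<bar>h x\<bar> \<le> \<bar>f x\<bar> + \<bar>g x\<bar>"
  shows "log_bounded \<rho> (K + K') h"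
  unfolding log_bounded_def
proof (intro allI impI)
  fix z :: 'a and E :: "'a set" and s assume E: "E \<in> sets borel \<and> 0 < s \<and> emeasure lborel E = ennreal s"
  then have [measurable]: "E \<in> sets borel" by simp
  have "(\<integral>\<^sup>+x\<in>E \<inter> ball z \<rho>. ennreal \<bar>h x\<bar> \<partial>lborel) \<le>
      (\<integral>\<^sup>+x. ennreal \<bar>f x\<bar> * indicator (E \<inter> ball z \<rho>) x + ennreal \<bar>g x\<bar> * indicator (E \<inter> ball z \<rho>) x \<partial>lborel)"
    using h by (intro nn_integral_mono) (auto simp: distrib_right[symmetric] ennreal_plus[symmetric] intro!: mult_right_mono ennreal_leI simp del: ennreal_plus)
  also have "\<dots> = (\<integral>\<^sup>+x\<in>E \<inter> ball z \<rho>. ennreal \<bar>f x\<bar> \<partial>lborel) + (\<integral>\<^sup>+x\<in>E \<inter> ball z \<rho>. ennreal \<bar>g x\<bar> \<partial>lborel)"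
    by (rule nn_integral_add) measurable
  also have "\<dots> \<le> ennreal (K * Lg s powr (- N)) + ennreal (K' * Lg s powr (- N))"
    using assms(1,2) E by (intro add_mono) (auto simp: log_bounded_def)
  also have "\<dots> = ennreal ((K + K') * Lg s powr (- N))"
    using K by (simp add: distrib_right)
  finally show "(\<integral>\<^sup>+x\<in>E \<inter> ball z \<rho>. ennreal \<bar>h x\<bar> \<partial>lborel) \<le> ennreal ((K + K') * Lg s powr (- N))" .
qed

text \<open>Fatou's lemma. This closedness under pointwise limits keeps the limit of the Picard
  iterates in the class.\<close>

lemma log_bounded_lim:
  assumes f: "\<And>k. log_bounded \<rho> K (f k)" and [measurable]: "\<And>k. f k \<in> borel_measurable borel"
    and lim: "\<And>x. (\<lambda>k. f k x) \<longlonglongrightarrow> g x"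
  shows "log_bounded \<rho> K g"
  unfolding log_bounded_def
proof (intro allI impI)
  fix z :: 'a and E :: "'a set" and s assume E: "E \<in> sets borel \<and> 0 < s \<and> emeasure lborel E = ennreal s"
  then have [measurable]: "E \<in> sets borel" by simp
  have g: "ennreal \<bar>g x\<bar> = liminf (\<lambda>k. ennreal \<bar>f k x\<bar>)" for x
    using tendsto_ennrealI[OF tendsto_rabs[OF lim[of x]]]
    by (intro lim_imp_Liminf[symmetric]) auto
  have "(\<integral>\<^sup>+x\<in>E \<inter> ball z \<rho>. ennreal \<bar>g x\<bar> \<partial>lborel) = (\<integral>\<^sup>+x. liminf (\<lambda>k. ennreal \<bar>f k x\<bar> * indicator (E \<inter> ball z \<rho>) x) \<partial>lborel)"
    unfolding g by (intro nn_integral_cong) (auto simp: indicator_def Liminf_const)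
  also have "\<dots> \<le> liminf (\<lambda>k. \<integral>\<^sup>+x\<in>E \<inter> ball z \<rho>. ennreal \<bar>f k x\<bar> \<partial>lborel)"
    by (rule nn_integral_liminf) measurable
  also have "\<dots> \<le> liminf (\<lambda>k::nat. ennreal (K * Lg s powr (- N)))"
    using f E by (intro Liminf_mono always_eventually) (auto simp: log_bounded_def)
  also have "\<dots> = ennreal (K * Lg s powr (- N))" by (rule Liminf_const) simp
  finally show "(\<integral>\<^sup>+x\<in>E \<inter> ball z \<rho>. ennreal \<bar>g x\<bar> \<partial>lborel) \<le> ennreal (K * Lg s powr (- N))" .
qed

text \<open>A translation moves the set and the centre of the ball but keeps the measure of the set,
  so a bound over all centres and all sets of that measure absorbs it.\<close>

lemma transl_ball_le:
  fixes f :: "'a \<Rightarrow> real"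
  assumes [measurable]: "f \<in> borel_measurable borel" "E \<in> sets borel"
    and M: "\<And>z E'. E' \<in> sets borel \<Longrightarrow> emeasure lborel E' = emeasure lborel E \<Longrightarrow>
       (\<integral>\<^sup>+x\<in>E' \<inter> ball z \<rho>. ennreal \<bar>f x\<bar> \<partial>lborel) \<le> M"
  shows "(\<integral>\<^sup>+x\<in>E \<inter> ball z \<rho>. ennreal \<bar>f (x - w)\<bar> \<partial>lborel) \<le> M"
proof -
  define E' where "E' = (\<lambda>x. w + x) -` E"
  have E'[measurable]: "E' \<in> sets borel"
    unfolding E'_def by (rule measurable_sets_borel[of _ borel]) auto
  have e: "emeasure lborel E' = emeasure lborel E"
  proof -
    have "emeasure lborel E = emeasure (distr lborel borel ((+) w)) E" by (simp add: lborel_distr_plus)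
    also have "\<dots> = emeasure lborel E'" by (subst emeasure_distr) (auto simp: E'_def)
    finally show ?thesis by simp
  qed
  have "(\<integral>\<^sup>+x\<in>E \<inter> ball z \<rho>. ennreal \<bar>f (x - w)\<bar> \<partial>lborel) =
     (\<integral>\<^sup>+x. ennreal \<bar>f (w + x - w)\<bar> * indicator (E \<inter> ball z \<rho>) (w + x) \<partial>lborel)"
    by (subst nn_integral_lborel_shift[of _ w, symmetric]) auto
  also have "\<dots> = (\<integral>\<^sup>+x\<in>E' \<inter> ball (z - w) \<rho>. ennreal \<bar>f x\<bar> \<partial>lborel)"
    by (intro nn_integral_cong) (auto simp: indicator_def E'_def dist_norm algebra_simps)
  also have "\<dots> \<le> M" using M[OF E' e] .
  finally show ?thesis .
qed

text \<open>Split at the level \<open>K s\<^bsup>-N\<^esup> L(s)\<^bsup>-N-N*N\<^esup>\<close>: below it the gain in the power of \<open>|f|\<close> supplies the missing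
  logarithms, above it the set is so small that the logarithmic bound applies.\<close>

lemma critical_power_local_mass:
  assumes S: "0 < S"
  shows "\<exists>C>0. \<forall>K f s \<rho> z. 0 < K \<and> 0 < \<rho> \<and> f \<in> borel_measurable borel \<and> log_bounded \<rho> K f \<and> 0 < s \<and> s \<le> S \<and>
     (\<forall>x. \<bar>f x\<bar> \<le> K * (s powr (- N) * Lg s powr (- N))) \<longrightarrow>
     (\<integral>\<^sup>+x\<in>ball z \<rho>. ennreal (\<bar>f x\<bar> powr (1 + 1 / N)) \<partial>lborel)
       \<le> ennreal (C * K powr (1 + 1 / N) * (s powr (- 1) * Lg s powr (- N - 1)))"
proof -
  obtain C1 where C1: "0 < C1" and comp: "\<And>s. 0 < s \<Longrightarrow> s \<le> S \<Longrightarrow> Lg s \<le> C1 * Lg (s powr N * Lg s powr (N + N * N))"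
    using Lg_comp[of N "N + N * N" S] N_pos S by (auto simp: add_nonneg_nonneg)
  have "(\<integral>\<^sup>+x\<in>ball z \<rho>. ennreal (\<bar>f x\<bar> powr (1 + 1 / N)) \<partial>lborel)
       \<le> ennreal ((1 + C1 powr N) * K powr (1 + 1 / N) * (s powr (- 1) * Lg s powr (- N - 1)))"
    if K: "0 < K" and \<rho>: "0 < \<rho>" and [measurable]: "f \<in> borel_measurable borel" and f: "log_bounded \<rho> K f" and s: "0 < s" "s \<le> S"
      and sup: "\<And>x. \<bar>f x\<bar> \<le> K * (s powr (- N) * Lg s powr (- N))" for K f s \<rho> z
  proof -
    have L: "0 < Lg s" using Lg_pos s by simp
    define lev where "lev = K * (s powr (- N) * Lg s powr (- (N + N * N)))"
    have lev: "0 < lev" using K s L by (simp add: lev_def)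
    \<comment> \<open>This is K / \<open>lev\<close>, which by Chebyshev bounds the measure of the
      part of the ball where |f| exceeds \<open>lev\<close>.\<close>
    define m where "m = s powr N * Lg s powr (N + N * N)"
    have m: "0 < m" using s L by (simp add: m_def)
    define E where "E = {x. lev < \<bar>f x\<bar>} \<inter> ball z \<rho>"
    have [measurable]: "E \<in> sets borel" unfolding E_def by measurable
    \<comment> \<open>Bounds for |f|^(1/N): \<open>a\<close> below the level, \<open>b\<close>
      everywhere by the sup bound. The number \<open>a\<close> is smaller than \<open>b\<close> by
      exactly the factor L(s)^(-N) that the set E supplies through its small mass.\<close>
    define a b where "a = K powr (1 / N) * (s powr (- 1) * Lg s powr (- 1 - N))"
      and "b = K powr (1 / N) * (s powr (- 1) * Lg s powr (- 1))"
    have ab: "0 \<le> a" "0 \<le> b" using K s L by (auto simp: a_def b_def)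
    have a: "lev powr (1 / N) = a"
      using K s L N_pos by (simp add: lev_def a_def powr_mult powr_powr add_divide_distrib diff_divide_distrib)
    have b: "(K * (s powr (- N) * Lg s powr (- N))) powr (1 / N) = b"
      using K s L N_pos by (simp add: b_def powr_mult powr_powr)
    have pt: "ennreal (\<bar>f x\<bar> powr (1 + 1 / N)) * indicator (ball z \<rho>) x
      \<le> ennreal a * (ennreal \<bar>f x\<bar> * indicator (ball z \<rho>) x) + ennreal b * (ennreal \<bar>f x\<bar> * indicator (E \<inter> ball z \<rho>) x)" for x
    proof (cases "x \<in> ball z \<rho>")
      case True
      have pw: "\<bar>f x\<bar> powr (1 + 1 / N) = \<bar>f x\<bar> powr (1 / N) * \<bar>f x\<bar>"
        by (cases "f x = 0") (auto simp: powr_add)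
      show ?thesis
      proof (cases "x \<in> E")
        case E: True
        have "\<bar>f x\<bar> powr (1 / N) \<le> b" unfolding b[symmetric] using sup[of x] N_pos by (intro powr_mono2) auto
        then have "\<bar>f x\<bar> powr (1 + 1 / N) \<le> b * \<bar>f x\<bar>" unfolding pw by (intro mult_right_mono) auto
        then have "ennreal (\<bar>f x\<bar> powr (1 + 1 / N)) \<le> ennreal b * ennreal \<bar>f x\<bar>"
          using ab by (simp add: ennreal_mult[symmetric] ennreal_leI)
        then show ?thesis using True E by (simp add: add_increasing)
      next
        case False
        then have "\<bar>f x\<bar> powr (1 / N) \<le> a" unfolding a[symmetric] using True N_pos by (intro powr_mono2) (auto simp: E_def)
        then have "\<bar>f x\<bar> powr (1 + 1 / N) \<le> a * \<bar>f x\<bar>" unfolding pw by (intro mult_right_mono) auto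
        then have "ennreal (\<bar>f x\<bar> powr (1 + 1 / N)) \<le> ennreal a * ennreal \<bar>f x\<bar>"
          using ab by (simp add: ennreal_mult[symmetric] ennreal_leI)
        then show ?thesis using True by (simp add: add_increasing2)
      qed
    qed simp
    have mass: "(\<integral>\<^sup>+x\<in>ball z \<rho>. ennreal \<bar>f x\<bar> \<partial>lborel) \<le> ennreal K"
      by (rule log_bounded_ball[OF f \<rho>]) (use K in simp)
    have "ennreal lev * emeasure lborel E = (\<integral>\<^sup>+x. ennreal lev * indicator E x \<partial>lborel)"
      by (simp add: nn_integral_cmult_indicator)
    also have "\<dots> \<le> (\<integral>\<^sup>+x\<in>ball z \<rho>. ennreal \<bar>f x\<bar> \<partial>lborel)"
      by (intro nn_integral_mono) (auto simp: E_def indicator_def intro!: ennreal_leI)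
    also note mass
    finally have 1: "ennreal lev * emeasure lborel E \<le> ennreal K" .
    have Km: "K = lev * m"
      using K s L by (simp only: lev_def m_def powr_minus) (simp add: field_simps)
    have "emeasure lborel E \<le> ennreal m"
    proof -
      have "ennreal (1 / lev) * (ennreal lev * emeasure lborel E) \<le> ennreal (1 / lev) * ennreal K"
        by (intro mult_left_mono 1) auto
      moreover have "ennreal (1 / lev) * (ennreal lev * emeasure lborel E) = emeasure lborel E"
        using lev by (simp add: mult.assoc[symmetric] ennreal_mult[symmetric])
      moreover have "ennreal (1 / lev) * ennreal K = ennreal m"
        using lev K Km m by (simp add: ennreal_mult[symmetric])
      ultimately show ?thesis by simp
    qed
    then have 2: "(\<integral>\<^sup>+x\<in>E \<inter> ball z \<rho>. ennreal \<bar>f x\<bar> \<partial>lborel) \<le> ennreal (K * Lg m powr (- N))"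
      using K by (intro log_bounded_le[OF f _ _ m]) auto
    \<comment> \<open>The measure m is s^N times a power of L(s), so its logarithmic weight is
      comparable to that of s.\<close>
    have "Lg m powr (- N) \<le> (Lg s / C1) powr (- N)"
      using comp[OF s] C1 L N_pos by (intro powr_mono2') (auto simp: m_def field_simps)
    also have "\<dots> = C1 powr N * Lg s powr (- N)"
      using C1 L by (simp add: powr_divide powr_minus_divide)
    finally have 3: "K * Lg m powr (- N) \<le> K * (C1 powr N * Lg s powr (- N))"
      using K by (intro mult_left_mono) auto
    have "(\<integral>\<^sup>+x\<in>ball z \<rho>. ennreal (\<bar>f x\<bar> powr (1 + 1 / N)) \<partial>lborel) \<le>
       (\<integral>\<^sup>+x. ennreal a * (ennreal \<bar>f x\<bar> * indicator (ball z \<rho>) x) + ennreal b * (ennreal \<bar>f x\<bar> * indicator (E \<inter> ball z \<rho>) x) \<partial>lborel)"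
      by (intro nn_integral_mono pt)
    also have "\<dots> = ennreal a * (\<integral>\<^sup>+x\<in>ball z \<rho>. ennreal \<bar>f x\<bar> \<partial>lborel) + ennreal b * (\<integral>\<^sup>+x\<in>E \<inter> ball z \<rho>. ennreal \<bar>f x\<bar> \<partial>lborel)"
      by (subst nn_integral_add) (auto simp: nn_integral_cmult)
    also have "\<dots> \<le> ennreal a * ennreal K + ennreal b * ennreal (K * (C1 powr N * Lg s powr (- N)))"
      using mass 2 ennreal_leI[OF 3] by (intro add_mono mult_left_mono) auto
    also have "\<dots> = ennreal (a * K + b * (K * (C1 powr N * Lg s powr (- N))))"
      using ab K by (simp add: ennreal_mult[symmetric])
    also have "a * K + b * (K * (C1 powr N * Lg s powr (- N))) = (1 + C1 powr N) * K powr (1 + 1 / N) * (s powr (- 1) * Lg s powr (- N - 1))"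
    proof -
      have e1: "Lg s powr (- N - 1) = Lg s powr (- 1) * Lg s powr (- N)"
        unfolding powr_add[symmetric] by (rule arg_cong[where f="\<lambda>e. Lg s powr e"]) simp
      have e2: "Lg s powr (- 1 - N) = Lg s powr (- N - 1)"
        by (rule arg_cong[where f="\<lambda>e. Lg s powr e"]) simp
      have e3: "K powr (1 + 1 / N) = K powr (1 / N) * K" using K by (simp add: powr_add)
      have "k * (X * (Y * Z)) * K + k * (X * Y) * (K * (c * Z)) = (1 + c) * (k * K) * (X * (Y * Z))" for k X Y Z c
        by (simp add: algebra_simps)
      then show ?thesis unfolding a_def b_def e2 e3 e1 .
    qed
    finally show ?thesis .
  qed
  then show ?thesis by (intro exI[of _ "1 + C1 powr N"]) (auto simp: add_pos_nonneg)
qed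

section \<open>The Duhamel integral of a source term\<close>

definition duh :: "('a \<Rightarrow> real \<Rightarrow> real) \<Rightarrow> 'a \<Rightarrow> real \<Rightarrow> ennreal" where
  "duh f x t = (\<integral>\<^sup>+s\<in>{0<..<t}. conv (\<lambda>y. f y s) (t - s) x \<partial>lborel)"

text \<open>The shape of |u|^(1 + 1/N) when u obeys the norm and sup bounds: (s L(s))^(-N) raised to
  the power 1 + 1/N is (s L(s))^(-N-1), and the mass is the one found in
  \<open>critical_power_local_mass\<close>.\<close>

definition source_bound :: "real \<Rightarrow> real \<Rightarrow> real \<Rightarrow> ('a \<Rightarrow> real \<Rightarrow> real) \<Rightarrow> bool" where
  "source_bound T \<rho> M f \<longleftrightarrow> (\<forall>s\<in>{0<..<T}.
     (\<forall>z. (\<integral>\<^sup>+y\<in>ball z \<rho>. ennreal \<bar>f y s\<bar> \<partial>lborel) \<le> ennreal (M * (s powr (- 1) * Lg s powr (- N - 1)))) \<and>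
     (\<forall>y. \<bar>f y s\<bar> \<le> M * (s powr (- N - 1) * Lg s powr (- N - 1))))"

lemma borel_measurable_conv_param [measurable (raw)]:
  assumes [measurable]: "case_prod f \<in> borel_measurable (borel \<Otimes>\<^sub>M borel)"
    "g \<in> borel_measurable M" "h \<in> borel_measurable M" "k \<in> borel_measurable M"
  shows "(\<lambda>w. conv (\<lambda>y. f y (g w)) (h w) (k w)) \<in> borel_measurable M"
  unfolding conv_def by measurable

lemma nn_integral_duh:
  assumes [measurable]: "case_prod f \<in> borel_measurable (borel \<Otimes>\<^sub>M borel)" "E \<in> sets borel"
  shows "(\<integral>\<^sup>+x\<in>E. duh f x t \<partial>lborel) = (\<integral>\<^sup>+s\<in>{0<..<t}. (\<integral>\<^sup>+x\<in>E. conv (\<lambda>y. f y s) (t - s) x \<partial>lborel) \<partial>lborel)"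
proof -
  have "(\<integral>\<^sup>+x\<in>E. duh f x t \<partial>lborel) =
     (\<integral>\<^sup>+x. \<integral>\<^sup>+s. conv (\<lambda>y. f y s) (t - s) x * indicator {0<..<t} s * indicator E x \<partial>lborel \<partial>lborel)"
    unfolding duh_def by (subst nn_integral_multc) auto
  also have "\<dots> = (\<integral>\<^sup>+s. \<integral>\<^sup>+x. conv (\<lambda>y. f y s) (t - s) x * indicator {0<..<t} s * indicator E x \<partial>lborel \<partial>lborel)"
    by (rule lborel_pair.Fubini') measurable
  also have "\<dots> = (\<integral>\<^sup>+s\<in>{0<..<t}. (\<integral>\<^sup>+x\<in>E. conv (\<lambda>y. f y s) (t - s) x \<partial>lborel) \<partial>lborel)"
  proof (intro nn_integral_cong)
    fix s :: real
    show "(\<integral>\<^sup>+x. conv (\<lambda>y. f y s) (t - s) x * indicator {0<..<t} s * indicator E x \<partial>lborel)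
      = (\<integral>\<^sup>+x\<in>E. conv (\<lambda>y. f y s) (t - s) x \<partial>lborel) * indicator {0<..<t} s"
      by (subst nn_integral_multc[symmetric]) (auto simp: mult_ac)
  qed
  finally show ?thesis .
qed

lemma conv_source_mass:
  assumes f[measurable]: "case_prod f \<in> borel_measurable (borel \<Otimes>\<^sub>M borel)" and E[measurable]: "E \<in> sets borel"
    and src: "source_bound T \<rho> M f" and s: "0 < s" "s < T" "s < t"
  shows "(\<integral>\<^sup>+x\<in>E \<inter> ball z \<rho>. conv (\<lambda>y. f y s) (t - s) x \<partial>lborel) \<le> ennreal (M * (s powr (- 1) * Lg s powr (- N - 1)))"
proof (rule conv_le_transl)
  show "(\<integral>\<^sup>+x\<in>E \<inter> ball z \<rho>. ennreal \<bar>f (x - w) s\<bar> \<partial>lborel) \<le> ennreal (M * (s powr (- 1) * Lg s powr (- N - 1)))" for w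
  proof (rule transl_ball_le)
    fix z E'
    have "(\<integral>\<^sup>+x\<in>E' \<inter> ball z \<rho>. ennreal \<bar>f x s\<bar> \<partial>lborel) \<le> (\<integral>\<^sup>+x\<in>ball z \<rho>. ennreal \<bar>f x s\<bar> \<partial>lborel)"
      by (intro nn_integral_mono) (auto simp: indicator_def)
    also have "\<dots> \<le> ennreal (M * (s powr (- 1) * Lg s powr (- N - 1)))"
      using src s by (auto simp: source_bound_def)
    finally show "(\<integral>\<^sup>+x\<in>E' \<inter> ball z \<rho>. ennreal \<bar>f x s\<bar> \<partial>lborel) \<le> ennreal (M * (s powr (- 1) * Lg s powr (- N - 1)))" .
  qed measurable
qed (use s in auto)

text \<open>Convolution does not increase the uniform local mass, so only the time integral of 1/(s
  L(s)^(N+1)) remains. The bound is the same for all E and vanishes as t tends to 0; both limits at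
  the initial time rest on it.\<close>

lemma duh_mass:
  assumes f[measurable]: "case_prod f \<in> borel_measurable (borel \<Otimes>\<^sub>M borel)" and E[measurable]: "E \<in> sets borel"
    and src: "source_bound T \<rho> M f" and t: "0 < t" "t < T" "T \<le> S" and M: "0 \<le> M"
  shows "(\<integral>\<^sup>+x\<in>E \<inter> ball z \<rho>. duh f x t \<partial>lborel) \<le> ennreal ((exp 1 * S + 1) / N * M * Lg t powr (- N))"
proof -
  have "(\<integral>\<^sup>+x\<in>E \<inter> ball z \<rho>. duh f x t \<partial>lborel)
      = (\<integral>\<^sup>+s\<in>{0<..<t}. (\<integral>\<^sup>+x\<in>E \<inter> ball z \<rho>. conv (\<lambda>y. f y s) (t - s) x \<partial>lborel) \<partial>lborel)"
    by (rule nn_integral_duh) measurable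
  also have "\<dots> \<le> (\<integral>\<^sup>+s. ennreal M * (ennreal (s powr (- 1) * Lg s powr (- N - 1)) * indicator {0<..<t} s) \<partial>lborel)"
  proof (rule nn_integral_mono)
    fix s :: real
    show "(\<integral>\<^sup>+x\<in>E \<inter> ball z \<rho>. conv (\<lambda>y. f y s) (t - s) x \<partial>lborel) * indicator {0<..<t} s
       \<le> ennreal M * (ennreal (s powr (- 1) * Lg s powr (- N - 1)) * indicator {0<..<t} s)"
      using conv_source_mass[OF f E src, of s t z] t M
      by (cases "s \<in> {0<..<t}") (auto simp: ennreal_mult[symmetric])
  qed
  also have "\<dots> = ennreal M * (\<integral>\<^sup>+s\<in>{0<..<t}. ennreal (s powr (- 1) * Lg s powr (- N - 1)) \<partial>lborel)"
    by (rule nn_integral_cmult) measurable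
  also have "\<dots> \<le> ennreal M * ennreal ((exp 1 * S + 1) / N * Lg t powr (- N))"
    using t by (intro mult_left_mono nn_integral_Lg N_pos) auto
  also have "\<dots> = ennreal ((exp 1 * S + 1) / N * M * Lg t powr (- N))"
    using M N_pos t by (subst ennreal_mult[symmetric]) (auto simp: mult_ac)
  finally show ?thesis .
qed

text \<open>Split at s = t/2. Before it, the kernel smooths by (t - s)^(-N) \<le> (t/2)^(-N), and
  the mass of the source integrates to a multiple of L(t)^(-N). After it, the sup bound of the
  source is used on an interval of length t/2, which lowers the exponent N + 1 of 1/t to N.\<close>

lemma duh_le_sup:
  assumes S: "0 < S"
  shows "\<exists>C>0. \<forall>T M f t x. case_prod f \<in> borel_measurable (borel \<Otimes>\<^sub>M borel) \<and> source_bound T (T powr (1 / \<theta>)) M f \<and>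
     0 < t \<and> t < T \<and> T \<le> S \<and> 0 \<le> M \<longrightarrow> duh f x t \<le> ennreal (C * M * (t powr (- N) * Lg t powr (- N)))"
proof -
  obtain C0 where C0: "0 < C0" and loc: "\<And>f t \<rho> M x. f \<in> borel_measurable borel \<Longrightarrow> 0 < t \<Longrightarrow> 0 < \<rho> \<Longrightarrow>
     (\<And>z. (\<integral>\<^sup>+y\<in>ball z \<rho>. ennreal \<bar>f y\<bar> \<partial>lborel) \<le> M) \<Longrightarrow>
     conv f t x \<le> ennreal (C0 / (min (t powr (1 / \<theta>)) \<rho>) ^ DIM('a)) * M"
    using conv_le_local by blast
  define C where "C = 2 powr N * (C0 * ((exp 1 * S + 1) / N) + 1)"
  have "0 < C" using C0 S N_pos by (simp add: C_def add_pos_nonneg)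
  moreover have "duh f x t \<le> ennreal (C * M * (t powr (- N) * Lg t powr (- N)))"
    if f[measurable]: "case_prod f \<in> borel_measurable (borel \<Otimes>\<^sub>M borel)" and src: "source_bound T (T powr (1 / \<theta>)) M f"
      and t: "0 < t" "t < T" "T \<le> S" and M: "0 \<le> M" for T M f t x
  proof -
    let ?m = "\<lambda>s. s powr (- 1) * Lg s powr (- N - 1)"
    have t2: "(t / 2) powr (- N) = 2 powr N * t powr (- N)" using t by (simp add: powr_divide powr_minus_divide)
    define A B where "A = C0 * (t / 2) powr (- N) * M" and "B = M * ((t / 2) powr (- N - 1) * Lg t powr (- N))"
    have AB: "0 \<le> A" "0 \<le> B" using C0 M by (auto simp: A_def B_def)
    have pt: "conv (\<lambda>y. f y s) (t - s) x * indicator {0<..<t} s \<le>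
        ennreal A * (ennreal (?m s) * indicator {0<..<t} s) + ennreal B * indicator {t/2..t} s" for s
    proof (cases "s \<in> {0<..<t}")
      case True
      then have s: "0 < s" "s < t" "s < T" using t by auto
      have [measurable]: "(\<lambda>y. f y s) \<in> borel_measurable borel" by measurable
      show ?thesis
      proof (cases "s < t / 2")
        case lt: True
        have "conv (\<lambda>y. f y s) (t - s) x \<le> ennreal (C0 / (min ((t - s) powr (1 / \<theta>)) (T powr (1 / \<theta>))) ^ DIM('a)) * ennreal (M * ?m s)"
          using src s t by (intro loc) (auto simp: source_bound_def)
        \<comment> \<open>Here the radius T^(1/\<theta>) matters: it is the diffusion length of the
          whole time interval, so it never truncates the smoothing.\<close>
        also have "min ((t - s) powr (1 / \<theta>)) (T powr (1 / \<theta>)) = (t - s) powr (1 / \<theta>)"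
          using s t theta by (intro min_absorb1 powr_mono2) auto
        also have "C0 / ((t - s) powr (1 / \<theta>)) ^ DIM('a) = C0 * (t - s) powr (- N)"
          using s by (simp add: powr_inverse_theta_power powr_minus_divide)
        also have "ennreal (C0 * (t - s) powr (- N)) * ennreal (M * ?m s) \<le> ennreal (C0 * (t / 2) powr (- N)) * ennreal (M * ?m s)"
          using lt t C0 N_pos by (intro mult_right_mono ennreal_leI mult_left_mono powr_mono2') auto
        also have "\<dots> = ennreal A * ennreal (?m s)"
          using C0 M by (simp add: A_def ennreal_mult[symmetric] mult_ac)
        finally show ?thesis using True by (simp add: add_increasing2)
      next
        case False
        have "conv (\<lambda>y. f y s) (t - s) x \<le> ennreal (M * (s powr (- N - 1) * Lg s powr (- N - 1)))"
          using src s t by (intro conv_le_sup) (auto simp: source_bound_def)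
        also have "\<dots> \<le> ennreal B"
          unfolding B_def
        proof (intro ennreal_leI mult_left_mono mult_mono M)
          show "s powr (- N - 1) \<le> (t / 2) powr (- N - 1)"
            using False t N_pos by (intro powr_mono2') auto
          \<comment> \<open>One logarithm is given away, as L \<ge> 1.\<close>
          have "Lg s powr (- N - 1) \<le> Lg s powr (- N)" using Lg_ge_1[OF s(1)] by (intro powr_mono) auto
          also have "\<dots> \<le> Lg t powr (- N)" using s N_pos by (intro Lg_powr_antimono) auto
          finally show "Lg s powr (- N - 1) \<le> Lg t powr (- N)" .
        qed auto
        finally show ?thesis using True False by (simp add: add_increasing)
      qed
    qed simp
    have "duh f x t \<le> (\<integral>\<^sup>+s. ennreal A * (ennreal (?m s) * indicator {0<..<t} s) + ennreal B * indicator {t/2..t} s \<partial>lborel)"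
      unfolding duh_def by (intro nn_integral_mono pt)
    also have "\<dots> = ennreal A * (\<integral>\<^sup>+s\<in>{0<..<t}. ennreal (?m s) \<partial>lborel) + ennreal B * ennreal (t / 2)"
      using t by (subst nn_integral_add) (auto simp: nn_integral_cmult nn_integral_cmult_indicator)
    also have "\<dots> \<le> ennreal A * ennreal ((exp 1 * S + 1) / N * Lg t powr (- N)) + ennreal B * ennreal (t / 2)"
      using t by (intro add_right_mono mult_left_mono nn_integral_Lg N_pos) auto
    also have "\<dots> = ennreal (A * ((exp 1 * S + 1) / N * Lg t powr (- N)) + B * (t / 2))"
      using AB t N_pos by (simp add: ennreal_mult[symmetric] ennreal_plus[symmetric] del: ennreal_plus)
    also have "A * ((exp 1 * S + 1) / N * Lg t powr (- N)) + B * (t / 2) = C * M * (t powr (- N) * Lg t powr (- N))"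
    proof -
      have "(t / 2) powr (- N - 1) * (t / 2) = (t / 2) powr (- N)"
        using t powr_add[of "t / 2" "- N - 1" 1] by simp
      then have "B * (t / 2) = M * ((t / 2) powr (- N) * Lg t powr (- N))" by (simp add: B_def mult_ac)
      then show ?thesis by (simp add: A_def C_def t2 algebra_simps)
    qed
    finally show ?thesis .
  qed
  ultimately show ?thesis by blast
qed

text \<open>The time integral is split at \<open>s0 = \<sigma>\<^bsup>1/N\<^esup> L(\<sigma>)\<close>, using the local mass before and the sup bound after.\<close>

lemma duh_log_bound:
  assumes S: "0 < S"
  shows "\<exists>C>0. \<forall>T \<rho> M f t z E \<sigma>. case_prod f \<in> borel_measurable (borel \<Otimes>\<^sub>M borel) \<and> source_bound T \<rho> M f \<and>
     0 < t \<and> t < T \<and> T \<le> S \<and> 0 \<le> M \<and> E \<in> sets borel \<and> 0 < \<sigma> \<and> emeasure lborel E = ennreal \<sigma> \<longrightarrow>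
     (\<integral>\<^sup>+x\<in>E \<inter> ball z \<rho>. duh f x t \<partial>lborel) \<le> ennreal (C * M * Lg \<sigma> powr (- N))"
proof -
  obtain C1 where C1: "0 < C1" and comp: "\<And>s. 0 < s \<Longrightarrow> s \<le> 1 \<Longrightarrow> Lg s \<le> C1 * Lg (s powr (1 / N) * Lg s powr 1)"
    using Lg_comp[of "1 / N" 1 1] N_pos by auto
  define c where "c = (exp 1 * S + 1) / N"
  have c: "0 < c" using S N_pos by (simp add: c_def add_pos_nonneg)
  \<comment> \<open>The three summands belong to the case \<sigma> > 1, to the times before s0, and
    to the times after s0.\<close>
  define C where "C = c * Lg 1 powr N + c * C1 powr N + 1 / N"
  have C: "0 < C" using c N_pos by (simp add: C_def add_nonneg_pos)
  moreover have "(\<integral>\<^sup>+x\<in>E \<inter> ball z \<rho>. duh f x t \<partial>lborel) \<le> ennreal (C * M * Lg \<sigma> powr (- N))"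
    if f[measurable]: "case_prod f \<in> borel_measurable (borel \<Otimes>\<^sub>M borel)" and src: "source_bound T \<rho> M f"
      and t: "0 < t" "t < T" "T \<le> S" and M: "0 \<le> M" and E[measurable]: "E \<in> sets borel"
      and \<sigma>: "0 < \<sigma>" "emeasure lborel E = ennreal \<sigma>" for T \<rho> M f t z E \<sigma>
  proof (cases "1 < \<sigma>")
    \<comment> \<open>For large sets L(\<sigma>)^(-N) is bounded below by L(1)^(-N), so the bound of
      the mass on whole balls suffices.\<close>
    case True
    have "(\<integral>\<^sup>+x\<in>E \<inter> ball z \<rho>. duh f x t \<partial>lborel) \<le> ennreal (c * M * Lg t powr (- N))"
      unfolding c_def by (rule duh_mass[OF f E src t M])
    also have "\<dots> \<le> ennreal (C * M * Lg \<sigma> powr (- N))"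
    proof (rule ennreal_leI)
      have "c * M * Lg t powr (- N) \<le> c * M * 1"
        using c M t N_pos by (intro mult_left_mono Lg_powr_le_1) auto
      also have "\<dots> = c * Lg 1 powr N * M * Lg 1 powr (- N)"
        using Lg_pos[of 1] by (simp add: powr_minus)
      also have "\<dots> \<le> c * Lg 1 powr N * M * Lg \<sigma> powr (- N)"
        using True c M N_pos by (intro mult_left_mono Lg_powr_antimono) auto
      also have "\<dots> \<le> C * M * Lg \<sigma> powr (- N)"
        using M c N_pos by (intro mult_right_mono) (auto simp: C_def)
      finally show "c * M * Lg t powr (- N) \<le> C * M * Lg \<sigma> powr (- N)" .
    qed
    finally show ?thesis .
  next
    case False
    let ?m = "\<lambda>s. s powr (- 1) * Lg s powr (- N - 1)"
    have L: "0 < Lg \<sigma>" using \<sigma> Lg_pos by simp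
    \<comment> \<open>Chosen so that \<sigma> s0^(-N) = L(\<sigma>)^(-N), which is what the sup
      bound yields after s0, while L(s0) stays comparable to L(\<sigma>), which is what the mass
      bound needs before s0.\<close>
    define s0 where "s0 = \<sigma> powr (1 / N) * Lg \<sigma>"
    have s0: "0 < s0" using \<sigma> L by (simp add: s0_def)
    \<comment> \<open>The source acts only up to time t, and a \<le> S is required by
      \<open>nn_integral_Lg\<close>.\<close>
    define a where "a = min s0 t"
    have a: "0 < a" "a \<le> s0" "a \<le> S" using s0 t by (auto simp: a_def)
    have La: "Lg a powr (- N) \<le> C1 powr N * Lg \<sigma> powr (- N)"
    proof -
      have "Lg a powr (- N) \<le> Lg s0 powr (- N)" using a N_pos by (intro Lg_powr_antimono) auto
      also have "\<dots> \<le> (Lg \<sigma> / C1) powr (- N)"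
        using comp[OF \<sigma>(1)] False C1 L N_pos by (intro powr_mono2') (auto simp: s0_def field_simps)
      also have "\<dots> = C1 powr N * Lg \<sigma> powr (- N)"
        using C1 L by (simp add: powr_divide powr_minus_divide)
      finally show ?thesis .
    qed
    have s0N: "\<sigma> * s0 powr (- N) = Lg \<sigma> powr (- N)"
      using \<sigma> L N_pos by (simp add: s0_def powr_mult powr_powr powr_minus)
    have pt: "(\<integral>\<^sup>+x\<in>E \<inter> ball z \<rho>. conv (\<lambda>y. f y s) (t - s) x \<partial>lborel) * indicator {0<..<t} s \<le>
        ennreal M * (ennreal (?m s) * indicator {0<..<a} s) + ennreal (M * \<sigma>) * (ennreal (s powr (- N - 1)) * indicator {s0..} s)" for s
    proof (cases "s \<in> {0<..<t}")
      case True
      then have s: "0 < s" "s < t" "s < T" using t by auto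
      show ?thesis
      proof (cases "s < s0")
        case lt: True
        then have "s \<in> {0<..<a}" using s by (auto simp: a_def)
        then show ?thesis
          using conv_source_mass[OF f E src s(1,3,2), of z] True M lt by (simp add: ennreal_mult[symmetric])
      next
        case False
        have [measurable]: "(\<lambda>y. f y s) \<in> borel_measurable borel" by measurable
        have "(\<integral>\<^sup>+x\<in>E \<inter> ball z \<rho>. conv (\<lambda>y. f y s) (t - s) x \<partial>lborel)
            \<le> (\<integral>\<^sup>+x. ennreal (M * (s powr (- N - 1) * Lg s powr (- N - 1))) * indicator E x \<partial>lborel)"
        proof (intro nn_integral_mono)
          fix x
          have "conv (\<lambda>y. f y s) (t - s) x \<le> ennreal (M * (s powr (- N - 1) * Lg s powr (- N - 1)))"
            using src s t by (intro conv_le_sup) (auto simp: source_bound_def)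
          then show "conv (\<lambda>y. f y s) (t - s) x * indicator (E \<inter> ball z \<rho>) x
             \<le> ennreal (M * (s powr (- N - 1) * Lg s powr (- N - 1))) * indicator E x"
            by (auto simp: indicator_def)
        qed
        also have "\<dots> = ennreal (M * (s powr (- N - 1) * Lg s powr (- N - 1))) * ennreal \<sigma>"
          by (simp add: nn_integral_cmult_indicator \<sigma>)
        also have "\<dots> \<le> ennreal (M * (s powr (- N - 1) * 1)) * ennreal \<sigma>"
          using Lg_powr_le_1[OF s(1), of "N + 1"] N_pos M
          by (intro mult_right_mono ennreal_leI mult_left_mono) auto
        also have "\<dots> = ennreal (M * \<sigma>) * ennreal (s powr (- N - 1))"
          using M \<sigma> by (simp add: ennreal_mult[symmetric] mult_ac)
        finally show ?thesis using True False by (simp add: add_increasing)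
      qed
    qed simp
    have "(\<integral>\<^sup>+x\<in>E \<inter> ball z \<rho>. duh f x t \<partial>lborel)
        = (\<integral>\<^sup>+s\<in>{0<..<t}. (\<integral>\<^sup>+x\<in>E \<inter> ball z \<rho>. conv (\<lambda>y. f y s) (t - s) x \<partial>lborel) \<partial>lborel)"
      by (rule nn_integral_duh) measurable
    also have "\<dots> \<le> (\<integral>\<^sup>+s. ennreal M * (ennreal (?m s) * indicator {0<..<a} s) + ennreal (M * \<sigma>) * (ennreal (s powr (- N - 1)) * indicator {s0..} s) \<partial>lborel)"
      by (intro nn_integral_mono pt)
    also have "\<dots> = ennreal M * (\<integral>\<^sup>+s\<in>{0<..<a}. ennreal (?m s) \<partial>lborel) + ennreal (M * \<sigma>) * (\<integral>\<^sup>+s\<in>{s0..}. ennreal (s powr (- N - 1)) \<partial>lborel)"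
      by (subst nn_integral_add) (auto simp: nn_integral_cmult)
    also have "\<dots> \<le> ennreal M * ennreal (c * Lg a powr (- N)) + ennreal (M * \<sigma>) * ennreal (s0 powr (- N) / N)"
      unfolding nn_integral_powr_tail[OF N_pos s0] c_def
      using a by (intro add_right_mono mult_left_mono nn_integral_Lg N_pos) auto
    also have "\<dots> = ennreal (M * (c * Lg a powr (- N)) + M * (\<sigma> * s0 powr (- N)) / N)"
      using M c \<sigma> N_pos by (simp add: ennreal_mult[symmetric] ennreal_plus[symmetric] mult_ac del: ennreal_plus)
    also have "\<dots> \<le> ennreal (C * M * Lg \<sigma> powr (- N))"
    proof (rule ennreal_leI)
      have "M * (c * Lg a powr (- N)) + M * (\<sigma> * s0 powr (- N)) / N \<le> M * (c * (C1 powr N * Lg \<sigma> powr (- N))) + M * Lg \<sigma> powr (- N) / N"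
        unfolding s0N using M c La by (intro add_right_mono mult_left_mono) auto
      also have "\<dots> = (c * C1 powr N + 1 / N) * M * Lg \<sigma> powr (- N)" by (simp add: algebra_simps)
      also have "\<dots> \<le> C * M * Lg \<sigma> powr (- N)"
        using M c by (intro mult_right_mono) (auto simp: C_def)
      finally show "M * (c * Lg a powr (- N)) + M * (\<sigma> * s0 powr (- N)) / N \<le> C * M * Lg \<sigma> powr (- N)" .
    qed
    finally show ?thesis .
  qed
  ultimately show ?thesis by blast
qed

end

section \<open>The fixed point iteration\<close>

lemma borel_measurable_Fp [measurable]: "Fp p \<in> borel_measurable borel"
  unfolding Fp_def by measurable

lemma Fp_0 [simp]: "Fp p 0 = 0"
  by (simp add: Fp_def)

lemma Fp_minus: "Fp p (- a) = - Fp p a"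
  by (simp add: Fp_def)

lemma Fp_diff_nonneg:
  assumes p: "1 < p" and b: "0 \<le> b" "b \<le> a"
  shows "\<bar>Fp p a - Fp p b\<bar> \<le> p * (a powr (p - 1) * (a - b))"
proof (cases "b = a")
  case False
  then have ab: "b < a" "0 < a" using b by auto
  have Fp: "Fp p s = s powr p" if "0 \<le> s" for s
    using that p powr_add[of s "p - 1" 1] by (cases "s = 0") (auto simp: Fp_def)
  have cont: "continuous_on {b..a} (\<lambda>s. s powr p)"
    using b p by (intro continuous_on_powr' continuous_intros) auto
  obtain l z where z: "b < z" "z < a" "((\<lambda>s. s powr p) has_real_derivative l) (at z)"
      "a powr p - b powr p = (a - b) * l"
  proof -
    have "\<And>x. b < x \<Longrightarrow> x < a \<Longrightarrow> (\<lambda>s. s powr p) differentiable (at x)"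
      using b by (auto intro!: differentiableI derivative_eq_intros simp: real_differentiable_def)
    from MVT[OF ab(1) cont this] show ?thesis using that by blast
  qed
  have z0: "0 < z" using z b by simp
  have "((\<lambda>s. s powr p) has_real_derivative p * z powr (p - 1)) (at z)"
    by (rule has_real_derivative_powr[OF z0])
  then have l: "l = p * z powr (p - 1)" using z(3) by (rule DERIV_unique[symmetric])
  have "a powr p - b powr p \<le> (a - b) * (p * a powr (p - 1))"
    unfolding z(4) l using ab p z z0 by (intro mult_left_mono powr_mono2) auto
  moreover have "0 \<le> a powr p - b powr p" using b p by (simp add: powr_mono2)
  ultimately show ?thesis using b by (simp add: Fp mult_ac)
qed simp

text \<open>Arguments of the same sign are reduced by oddness to the mean value theorem on the
  nonnegative half-line. For opposite signs |a - b| = |a| + |b|, and the two terms |a|^p and |b|^p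
  are estimated directly.\<close>

lemma Fp_diff:
  assumes p: "1 < p"
  shows "\<bar>Fp p a - Fp p b\<bar> \<le> p * ((\<bar>a\<bar> + \<bar>b\<bar>) powr (p - 1) * \<bar>a - b\<bar>)"
proof -
  have same: "\<bar>Fp p a - Fp p b\<bar> \<le> p * ((\<bar>a\<bar> + \<bar>b\<bar>) powr (p - 1) * \<bar>a - b\<bar>)" if "0 \<le> b" "b \<le> a" for a b
  proof -
    have "\<bar>Fp p a - Fp p b\<bar> \<le> p * (a powr (p - 1) * (a - b))" by (rule Fp_diff_nonneg[OF p that])
    also have "\<dots> \<le> p * ((\<bar>a\<bar> + \<bar>b\<bar>) powr (p - 1) * \<bar>a - b\<bar>)"
      using that p by (intro mult_left_mono mult_mono powr_mono2) auto
    finally show ?thesis .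
  qed
  have opp: "\<bar>Fp p a - Fp p b\<bar> \<le> p * ((\<bar>a\<bar> + \<bar>b\<bar>) powr (p - 1) * \<bar>a - b\<bar>)" if "0 \<le> a" "b \<le> 0" for a b
  proof -
    have "\<bar>Fp p a - Fp p b\<bar> \<le> \<bar>Fp p a\<bar> + \<bar>Fp p b\<bar>" by simp
    also have "\<dots> = \<bar>a\<bar> powr (p - 1) * \<bar>a\<bar> + \<bar>b\<bar> powr (p - 1) * \<bar>b\<bar>" by (simp add: Fp_def abs_mult)
    also have "\<dots> \<le> (\<bar>a\<bar> + \<bar>b\<bar>) powr (p - 1) * \<bar>a\<bar> + (\<bar>a\<bar> + \<bar>b\<bar>) powr (p - 1) * \<bar>b\<bar>"
      using p by (intro add_mono mult_right_mono powr_mono2) auto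
    also have "\<dots> = 1 * ((\<bar>a\<bar> + \<bar>b\<bar>) powr (p - 1) * \<bar>a - b\<bar>)"
      using that by (simp add: algebra_simps)
    also have "\<dots> \<le> p * ((\<bar>a\<bar> + \<bar>b\<bar>) powr (p - 1) * \<bar>a - b\<bar>)"
      using p by (intro mult_right_mono) auto
    finally show ?thesis .
  qed
  consider "0 \<le> b" "b \<le> a" | "0 \<le> a" "a \<le> b" | "0 \<le> a" "b \<le> 0" | "a \<le> 0" "0 \<le> b"
    | "0 \<le> - b" "- b \<le> - a" | "0 \<le> - a" "- a \<le> - b" by linarith
  then show ?thesis
  proof cases
    case 1 then show ?thesis by (rule same)
  next
    case 2 then show ?thesis using same[of a b] by (simp add: abs_minus_commute add.commute)
  next
    case 3 then show ?thesis by (rule opp)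
  next
    case 4 then show ?thesis using opp[of b a] by (simp add: abs_minus_commute add.commute)
  next
    case 5
    have "\<bar>Fp p (- a) - Fp p (- b)\<bar> \<le> p * ((\<bar>- a\<bar> + \<bar>- b\<bar>) powr (p - 1) * \<bar>- a - - b\<bar>)"
      by (rule same[OF 5])
    then show ?thesis by (simp add: Fp_minus abs_minus_commute)
  next
    case 6
    have "\<bar>Fp p (- b) - Fp p (- a)\<bar> \<le> p * ((\<bar>- b\<bar> + \<bar>- a\<bar>) powr (p - 1) * \<bar>- b - - a\<bar>)"
      by (rule same[OF 6])
    then show ?thesis by (simp add: Fp_minus add.commute)
  qed
qed

context critical_exponent
begin

section \<open>The linear and Duhamel terms as real-valued integrals\<close>

definition lin :: "('a \<Rightarrow> real) \<Rightarrow> 'a \<Rightarrow> real \<Rightarrow> real" where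
  "lin \<phi> x t = (\<integral>y. G (x - y) t * \<phi> y \<partial>lborel)"

text \<open>The Duhamel term is taken as one integral over space-time. A single integrability
  condition then gives linearity, and it is the condition that the notion of solution
  demands.\<close>

definition dint_integrand :: "('a \<Rightarrow> real \<Rightarrow> real) \<Rightarrow> 'a \<Rightarrow> real \<Rightarrow> 'a \<times> real \<Rightarrow> real" where
  "dint_integrand f x t z = indicator {0<..<t} (snd z) * (G (x - fst z) (t - snd z) * f (fst z) (snd z))"

definition dint :: "('a \<Rightarrow> real \<Rightarrow> real) \<Rightarrow> 'a \<Rightarrow> real \<Rightarrow> real" where
  "dint f x t = (\<integral>z. dint_integrand f x t z \<partial>(lborel \<Otimes>\<^sub>M lborel))"

lemma borel_measurable_lin [measurable]:
  assumes [measurable]: "\<phi> \<in> borel_measurable borel"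
  shows "case_prod (lin \<phi>) \<in> borel_measurable (borel \<Otimes>\<^sub>M borel)"
  unfolding lin_def by measurable

lemma borel_measurable_dint_integrand [measurable (raw)]:
  assumes [measurable]: "case_prod f \<in> borel_measurable (borel \<Otimes>\<^sub>M borel)"
    "g \<in> borel_measurable M" "h \<in> borel_measurable M" "k \<in> M \<rightarrow>\<^sub>M (borel \<Otimes>\<^sub>M borel)"
  shows "(\<lambda>w. dint_integrand f (g w) (h w) (k w)) \<in> borel_measurable M"
  unfolding dint_integrand_def indicator_def greaterThanLessThan_iff by measurable

lemma borel_measurable_dint [measurable]:
  assumes [measurable]: "case_prod f \<in> borel_measurable (borel \<Otimes>\<^sub>M borel)"
  shows "case_prod (dint f) \<in> borel_measurable (borel \<Otimes>\<^sub>M borel)"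
  unfolding dint_def by measurable

lemma abs_lin_le:
  assumes [measurable]: "\<phi> \<in> borel_measurable borel" and t: "0 < t"
  shows "ennreal \<bar>lin \<phi> x t\<bar> \<le> conv \<phi> t x"
proof (cases "integrable lborel (\<lambda>y. G (x - y) t * \<phi> y)")
  case True
  have "ennreal (norm (lin \<phi> x t)) \<le> (\<integral>\<^sup>+y. ennreal (norm (G (x - y) t * \<phi> y)) \<partial>lborel)"
    unfolding lin_def by (rule integral_norm_bound_ennreal[OF True])
  also have "\<dots> = conv \<phi> t x"
    unfolding conv_def using G_nonneg[OF t] by (simp add: abs_mult)
  finally show ?thesis by simp
next
  \<comment> \<open>The Bochner integral of a non-integrable function is 0, so the bound needs no
    finiteness assumption.\<close>
  case False
  then show ?thesis by (simp add: lin_def not_integrable_integral_eq)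
qed

lemma integrable_lin:
  assumes [measurable]: "\<phi> \<in> borel_measurable borel" and t: "0 < t" and "conv \<phi> t x < \<infinity>"
  shows "integrable lborel (\<lambda>y. G (x - y) t * \<phi> y)"
  using assms(3) G_nonneg[OF t] unfolding integrable_iff_bounded conv_def by (auto simp: abs_mult)

lemma nn_integral_dint_integrand:
  assumes [measurable]: "case_prod f \<in> borel_measurable (borel \<Otimes>\<^sub>M borel)"
  shows "(\<integral>\<^sup>+z. ennreal (norm (dint_integrand f x t z)) \<partial>(lborel \<Otimes>\<^sub>M lborel)) = duh f x t"
proof -
  have "(\<integral>\<^sup>+z. ennreal (norm (dint_integrand f x t z)) \<partial>(lborel \<Otimes>\<^sub>M lborel))
      = (\<integral>\<^sup>+s. \<integral>\<^sup>+y. ennreal (norm (dint_integrand f x t (y, s))) \<partial>lborel \<partial>lborel)"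
    by (rule lborel_pair.nn_integral_snd[symmetric]) measurable
  also have "\<dots> = duh f x t"
    unfolding duh_def
  proof (intro nn_integral_cong)
    fix s :: real
    show "(\<integral>\<^sup>+y. ennreal (norm (dint_integrand f x t (y, s))) \<partial>lborel) = conv (\<lambda>y. f y s) (t - s) x * indicator {0<..<t} s"
      using G_nonneg[of "t - s"]
      by (cases "s \<in> {0<..<t}") (auto simp: dint_integrand_def conv_def abs_mult)
  qed
  finally show ?thesis .
qed

lemma integrable_dint:
  assumes [measurable]: "case_prod f \<in> borel_measurable (borel \<Otimes>\<^sub>M borel)" and "duh f x t < \<infinity>"
  shows "integrable (lborel \<Otimes>\<^sub>M lborel) (dint_integrand f x t)"
  using assms(2) unfolding integrable_iff_bounded nn_integral_dint_integrand[OF assms(1)] by auto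

lemma abs_dint_le:
  assumes [measurable]: "case_prod f \<in> borel_measurable (borel \<Otimes>\<^sub>M borel)"
  shows "ennreal \<bar>dint f x t\<bar> \<le> duh f x t"
proof (cases "integrable (lborel \<Otimes>\<^sub>M lborel) (dint_integrand f x t)")
  case True
  from integral_norm_bound_ennreal[OF True] show ?thesis
    unfolding nn_integral_dint_integrand[OF assms] by (simp add: dint_def)
next
  case False
  then show ?thesis by (simp add: dint_def not_integrable_integral_eq)
qed

lemma dint_diff:
  assumes [measurable]: "case_prod f \<in> borel_measurable (borel \<Otimes>\<^sub>M borel)" "case_prod g \<in> borel_measurable (borel \<Otimes>\<^sub>M borel)"
    and "duh f x t < \<infinity>" "duh g x t < \<infinity>"
  shows "dint f x t - dint g x t = dint (\<lambda>y s. f y s - g y s) x t"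
proof -
  have "dint f x t - dint g x t = (\<integral>z. dint_integrand f x t z - dint_integrand g x t z \<partial>(lborel \<Otimes>\<^sub>M lborel))"
    unfolding dint_def using assms by (intro Bochner_Integration.integral_diff[symmetric] integrable_dint)
  then show ?thesis by (simp add: dint_def dint_integrand_def algebra_simps)
qed

text \<open>The class of the iteration, with one constant K for the norm bound and the sup bound.
  The sup bound holds at every point rather than almost everywhere, so the iterates can be compared
  and passed to the limit pointwise.\<close>

definition adm :: "real \<Rightarrow> real \<Rightarrow> real \<Rightarrow> ('a \<Rightarrow> real \<Rightarrow> real) \<Rightarrow> bool" where
  "adm T \<rho> K u \<longleftrightarrow> (\<forall>t\<in>{0<..<T}. log_bounded \<rho> K (\<lambda>x. u x t) \<and>
     (\<forall>x. \<bar>u x t\<bar> \<le> K * (t powr (- N) * Lg t powr (- N))))"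

lemma adm_cong:
  assumes "\<And>x t. 0 < t \<Longrightarrow> t < T \<Longrightarrow> u x t = v x t"
  shows "adm T \<rho> K u \<longleftrightarrow> adm T \<rho> K v"
  using assms by (auto simp: adm_def)

lemma adm_mono: "adm T \<rho> K u \<Longrightarrow> K \<le> K' \<Longrightarrow> adm T \<rho> K' u"
  unfolding adm_def
proof (intro ballI conjI allI)
  fix t x assume a: "\<forall>t\<in>{0<..<T}. log_bounded \<rho> K (\<lambda>x. u x t) \<and> (\<forall>x. \<bar>u x t\<bar> \<le> K * (t powr (- N) * Lg t powr (- N)))"
    and K: "K \<le> K'" and t: "t \<in> {0<..<T}"
  then show "log_bounded \<rho> K' (\<lambda>x. u x t)" using log_bounded_mono by blast
  have "K * (t powr (- N) * Lg t powr (- N)) \<le> K' * (t powr (- N) * Lg t powr (- N))"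
    using K by (intro mult_right_mono) auto
  moreover have "\<bar>u x t\<bar> \<le> K * (t powr (- N) * Lg t powr (- N))" using a t by blast
  ultimately show "\<bar>u x t\<bar> \<le> K' * (t powr (- N) * Lg t powr (- N))" by linarith
qed

lemma adm_add:
  assumes "adm T \<rho> K u" "adm T \<rho> K' v" and K: "0 \<le> K" "0 \<le> K'"
    and [measurable]: "case_prod u \<in> borel_measurable (borel \<Otimes>\<^sub>M borel)" "case_prod v \<in> borel_measurable (borel \<Otimes>\<^sub>M borel)"
    and w: "\<And>x t. 0 < t \<Longrightarrow> t < T \<Longrightarrow> \<bar>w x t\<bar> \<le> \<bar>u x t\<bar> + \<bar>v x t\<bar>"
  shows "adm T \<rho> (K + K') w"
  unfolding adm_def
proof (intro ballI conjI allI)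
  fix t assume t: "t \<in> {0<..<T}"
  show "log_bounded \<rho> (K + K') (\<lambda>x. w x t)"
    using assms t by (intro log_bounded_add[where f="\<lambda>x. u x t" and g="\<lambda>x. v x t"]) (auto simp: adm_def)
  fix x
  have "\<bar>u x t\<bar> \<le> K * (t powr (- N) * Lg t powr (- N))" "\<bar>v x t\<bar> \<le> K' * (t powr (- N) * Lg t powr (- N))"
    using assms t by (auto simp: adm_def)
  then show "\<bar>w x t\<bar> \<le> (K + K') * (t powr (- N) * Lg t powr (- N))"
    using w[of t x] t by (simp add: distrib_right)
qed

lemma adm_lim:
  assumes f: "\<And>k. adm T \<rho> K (f k)" and [measurable]: "\<And>k. case_prod (f k) \<in> borel_measurable (borel \<Otimes>\<^sub>M borel)"
    and lim: "\<And>x t. 0 < t \<Longrightarrow> t < T \<Longrightarrow> (\<lambda>k. f k x t) \<longlonglongrightarrow> g x t"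
  shows "adm T \<rho> K g"
  unfolding adm_def
proof (intro ballI conjI allI)
  fix t assume t: "t \<in> {0<..<T}"
  show "log_bounded \<rho> K (\<lambda>x. g x t)"
  proof (rule log_bounded_lim)
    show "log_bounded \<rho> K (\<lambda>x. f k x t)" for k using f[of k] t unfolding adm_def by blast
    show "(\<lambda>k. f k x t) \<longlonglongrightarrow> g x t" for x using t by (intro lim) auto
  qed measurable
  fix x
  have b: "\<bar>f k x t\<bar> \<le> K * (t powr (- N) * Lg t powr (- N))" for k
    using f[of k] t unfolding adm_def by blast
  have "(\<lambda>k. \<bar>f k x t\<bar>) \<longlonglongrightarrow> \<bar>g x t\<bar>" using t by (intro tendsto_rabs lim) auto
  then show "\<bar>g x t\<bar> \<le> K * (t powr (- N) * Lg t powr (- N))"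
    by (rule LIMSEQ_le_const2) (use b in blast)
qed

lemma adm_zero: "0 \<le> K \<Longrightarrow> adm T \<rho> K (\<lambda>x t. 0)"
  by (simp add: adm_def log_bounded_def)

text \<open>For the sup bound, the local smoothing estimate is used with radius t^(1/\<theta>), not
  T^(1/\<theta>): a ball of that radius has volume v t^N, so the norm of the data bounds its mass by
  K L(v t^N)^(-N), comparable to K L(t)^(-N). The norm bound passes through because S(t) averages
  translates.\<close>

lemma lin_adm:
  assumes S: "0 < S"
  shows "\<exists>C\<ge>1. \<forall>\<phi> T K. \<phi> \<in> borel_measurable borel \<and> 0 < T \<and> T \<le> S \<and> 0 \<le> K \<and> log_bounded (T powr (1 / \<theta>)) K \<phi> \<longrightarrow>
     adm T (T powr (1 / \<theta>)) (C * K) (lin \<phi>) \<and> (\<forall>t\<in>{0<..<T}. \<forall>x. conv \<phi> t x < \<infinity>)"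
proof -
  obtain C0 where C0: "0 < C0" and loc: "\<And>f t \<rho> M x. f \<in> borel_measurable borel \<Longrightarrow> 0 < t \<Longrightarrow> 0 < \<rho> \<Longrightarrow>
     (\<And>z. (\<integral>\<^sup>+y\<in>ball z \<rho>. ennreal \<bar>f y\<bar> \<partial>lborel) \<le> M) \<Longrightarrow>
     conv f t x \<le> ennreal (C0 / (min (t powr (1 / \<theta>)) \<rho>) ^ DIM('a)) * M"
    using conv_le_local by blast
  define v where "v = unit_ball_vol (real (DIM('a)))"
  have v: "0 < v" by (simp add: v_def)
  obtain C1 where C1: "0 < C1" and comp: "\<And>s. 0 < s \<Longrightarrow> Lg s \<le> C1 * Lg (v * s powr N)"
    using Lg_comp_const[OF N_pos v] by blast
  \<comment> \<open>The summand 1 makes C \<ge> 1, so that C K also covers the norm bound, which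
    holds with K itself.\<close>
  define C where "C = C0 * C1 powr N + 1"
  have "1 \<le> C" using C0 by (simp add: C_def)
  moreover have "adm T (T powr (1 / \<theta>)) (C * K) (lin \<phi>) \<and> (\<forall>t\<in>{0<..<T}. \<forall>x. conv \<phi> t x < \<infinity>)"
    if [measurable]: "\<phi> \<in> borel_measurable borel" and T: "0 < T" "T \<le> S" and K: "0 \<le> K"
      and \<phi>: "log_bounded (T powr (1 / \<theta>)) K \<phi>" for \<phi> T K
  proof -
    have bound: "conv \<phi> t x \<le> ennreal (C * K * (t powr (- N) * Lg t powr (- N)))" if t: "0 < t" "t < T" for t x
    proof -
      define \<tau> where "\<tau> = t powr (1 / \<theta>)"
      have \<tau>: "0 < \<tau>" "\<tau> \<le> T powr (1 / \<theta>)" "\<tau> ^ DIM('a) = t powr N"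
        using t theta powr_inverse_theta_power[OF t(1)] by (auto simp: \<tau>_def intro!: powr_mono2)
      have "conv \<phi> t x \<le> ennreal (C0 / (min (t powr (1 / \<theta>)) \<tau>) ^ DIM('a)) * ennreal (K * Lg (v * \<tau> ^ DIM('a)) powr (- N))"
        unfolding v_def using t \<tau> K by (intro loc log_bounded_small_ball[OF \<phi>]) auto
      also have "\<dots> = ennreal (C0 / t powr N) * ennreal (K * Lg (v * t powr N) powr (- N))"
        by (simp add: \<tau>_def[symmetric] \<tau>)
      also have "\<dots> = ennreal (C0 / t powr N * (K * Lg (v * t powr N) powr (- N)))"
        using C0 K by (intro ennreal_mult[symmetric]) auto
      also have "\<dots> \<le> ennreal (C0 / t powr N * (K * (C1 powr N * Lg t powr (- N))))"
      proof (intro ennreal_leI mult_left_mono K)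
        have "Lg (v * t powr N) powr (- N) \<le> (Lg t / C1) powr (- N)"
          using comp[OF t(1)] C1 Lg_pos[OF t(1)] N_pos by (intro powr_mono2') (auto simp: field_simps)
        also have "\<dots> = C1 powr N * Lg t powr (- N)"
          using C1 Lg_pos[OF t(1)] by (simp add: powr_divide powr_minus_divide)
        finally show "Lg (v * t powr N) powr (- N) \<le> C1 powr N * Lg t powr (- N)" .
      qed (use C0 in auto)
      also have "\<dots> \<le> ennreal (C * K * (t powr (- N) * Lg t powr (- N)))"
      proof (rule ennreal_leI)
        have "C0 / t powr N * (K * (C1 powr N * Lg t powr (- N))) = (C0 * C1 powr N) * K * (t powr (- N) * Lg t powr (- N))"
          by (simp add: powr_minus_divide)
        also have "\<dots> \<le> C * K * (t powr (- N) * Lg t powr (- N))"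
          using K by (intro mult_right_mono) (auto simp: C_def)
        finally show "C0 / t powr N * (K * (C1 powr N * Lg t powr (- N))) \<le> C * K * (t powr (- N) * Lg t powr (- N))" .
      qed
      finally show ?thesis .
    qed
    have "adm T (T powr (1 / \<theta>)) (C * K) (lin \<phi>)"
      unfolding adm_def
    proof (intro ballI conjI allI)
      fix t x assume t: "t \<in> {0<..<T}"
      have "ennreal \<bar>lin \<phi> x t\<bar> \<le> ennreal (C * K * (t powr (- N) * Lg t powr (- N)))"
        using abs_lin_le[of \<phi> t x] bound[of t x] t by (auto intro: order_trans)
      then show "\<bar>lin \<phi> x t\<bar> \<le> C * K * (t powr (- N) * Lg t powr (- N))"
        using K \<open>1 \<le> C\<close> by (subst (asm) ennreal_le_iff) auto
    next
      fix t assume t: "t \<in> {0<..<T}"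
      have "log_bounded (T powr (1 / \<theta>)) K (\<lambda>x. lin \<phi> x t)"
        unfolding log_bounded_def
      proof (intro allI impI)
        fix z :: 'a and E :: "'a set" and s
        assume E: "E \<in> sets borel \<and> 0 < s \<and> emeasure lborel E = ennreal s"
        then have [measurable]: "E \<in> sets borel" by simp
        have "(\<integral>\<^sup>+x\<in>E \<inter> ball z (T powr (1 / \<theta>)). ennreal \<bar>lin \<phi> x t\<bar> \<partial>lborel)
            \<le> (\<integral>\<^sup>+x\<in>E \<inter> ball z (T powr (1 / \<theta>)). conv \<phi> t x \<partial>lborel)"
          using t by (intro nn_integral_mono mult_right_mono abs_lin_le) auto
        also have "\<dots> \<le> ennreal (K * Lg s powr (- N))"
        proof (rule conv_le_transl)
          show "(\<integral>\<^sup>+x\<in>E \<inter> ball z (T powr (1 / \<theta>)). ennreal \<bar>\<phi> (x - w)\<bar> \<partial>lborel) \<le> ennreal (K * Lg s powr (- N))" for w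
            using \<phi> E by (intro transl_ball_le) (auto simp: log_bounded_def)
        qed (use t in auto)
        finally show "(\<integral>\<^sup>+x\<in>E \<inter> ball z (T powr (1 / \<theta>)). ennreal \<bar>lin \<phi> x t\<bar> \<partial>lborel) \<le> ennreal (K * Lg s powr (- N))" .
      qed
      then show "log_bounded (T powr (1 / \<theta>)) (C * K) (\<lambda>x. lin \<phi> x t)"
        by (rule log_bounded_mono) (use mult_right_mono[OF \<open>1 \<le> C\<close> K] in simp)
    qed
    moreover have "conv \<phi> t x < \<infinity>" if "t \<in> {0<..<T}" for t x
      using bound[of t x] that by (auto intro: le_less_trans)
    ultimately show ?thesis by blast
  qed
  ultimately show ?thesis by blast
qed

lemma dint_adm:
  assumes S: "0 < S"
  shows "\<exists>C>0. \<forall>T M f. case_prod f \<in> borel_measurable (borel \<Otimes>\<^sub>M borel) \<and> source_bound T (T powr (1 / \<theta>)) M f \<and>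
     T \<le> S \<and> 0 \<le> M \<longrightarrow> adm T (T powr (1 / \<theta>)) (C * M) (dint f) \<and> (\<forall>t\<in>{0<..<T}. \<forall>x. duh f x t < \<infinity>)"
proof -
  obtain C1 where C1: "0 < C1" and sup: "\<And>T M f t x. case_prod f \<in> borel_measurable (borel \<Otimes>\<^sub>M borel) \<Longrightarrow>
     source_bound T (T powr (1 / \<theta>)) M f \<Longrightarrow> 0 < t \<Longrightarrow> t < T \<Longrightarrow> T \<le> S \<Longrightarrow> 0 \<le> M \<Longrightarrow>
     duh f x t \<le> ennreal (C1 * M * (t powr (- N) * Lg t powr (- N)))"
    using duh_le_sup[OF S] by blast
  obtain C2 where C2: "0 < C2" and mass: "\<And>T \<rho> M f t z E \<sigma>. case_prod f \<in> borel_measurable (borel \<Otimes>\<^sub>M borel) \<Longrightarrow>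
     source_bound T \<rho> M f \<Longrightarrow> 0 < t \<Longrightarrow> t < T \<Longrightarrow> T \<le> S \<Longrightarrow> 0 \<le> M \<Longrightarrow> E \<in> sets borel \<Longrightarrow> 0 < \<sigma> \<Longrightarrow>
     emeasure lborel E = ennreal \<sigma> \<Longrightarrow> (\<integral>\<^sup>+x\<in>E \<inter> ball z \<rho>. duh f x t \<partial>lborel) \<le> ennreal (C2 * M * Lg \<sigma> powr (- N))"
    using duh_log_bound[OF S] by blast
  have "adm T (T powr (1 / \<theta>)) ((C1 + C2) * M) (dint f) \<and> (\<forall>t\<in>{0<..<T}. \<forall>x. duh f x t < \<infinity>)"
    if f[measurable]: "case_prod f \<in> borel_measurable (borel \<Otimes>\<^sub>M borel)" and src: "source_bound T (T powr (1 / \<theta>)) M f"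
      and T: "T \<le> S" and M: "0 \<le> M" for T M f
  proof -
    have "adm T (T powr (1 / \<theta>)) ((C1 + C2) * M) (dint f)"
      unfolding adm_def
    proof (intro ballI conjI allI)
      fix t x assume t: "t \<in> {0<..<T}"
      have "ennreal \<bar>dint f x t\<bar> \<le> ennreal (C1 * M * (t powr (- N) * Lg t powr (- N)))"
        using abs_dint_le[OF f, of x t] sup[OF f src, of t x] t T M by (auto intro: order_trans)
      then have "\<bar>dint f x t\<bar> \<le> C1 * M * (t powr (- N) * Lg t powr (- N))"
        using M C1 by (subst (asm) ennreal_le_iff) auto
      also have "\<dots> \<le> (C1 + C2) * M * (t powr (- N) * Lg t powr (- N))"
        using C2 M by (intro mult_right_mono) auto
      finally show "\<bar>dint f x t\<bar> \<le> (C1 + C2) * M * (t powr (- N) * Lg t powr (- N))" .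
    next
      fix t assume t: "t \<in> {0<..<T}"
      have "log_bounded (T powr (1 / \<theta>)) (C2 * M) (\<lambda>x. dint f x t)"
        unfolding log_bounded_def
      proof (intro allI impI)
        fix z :: 'a and E :: "'a set" and s
        assume E: "E \<in> sets borel \<and> 0 < s \<and> emeasure lborel E = ennreal s"
        have "(\<integral>\<^sup>+x\<in>E \<inter> ball z (T powr (1 / \<theta>)). ennreal \<bar>dint f x t\<bar> \<partial>lborel)
            \<le> (\<integral>\<^sup>+x\<in>E \<inter> ball z (T powr (1 / \<theta>)). duh f x t \<partial>lborel)"
          by (intro nn_integral_mono mult_right_mono abs_dint_le f) auto
        also have "\<dots> \<le> ennreal (C2 * M * Lg s powr (- N))"
          using t T M E by (intro mass[OF f src]) auto
        finally show "(\<integral>\<^sup>+x\<in>E \<inter> ball z (T powr (1 / \<theta>)). ennreal \<bar>dint f x t\<bar> \<partial>lborel) \<le> ennreal (C2 * M * Lg s powr (- N))" .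
      qed
      then show "log_bounded (T powr (1 / \<theta>)) ((C1 + C2) * M) (\<lambda>x. dint f x t)"
        using C1 M by (elim log_bounded_mono) (auto intro!: mult_right_mono)
    qed
    moreover have "duh f x t < \<infinity>" if "t \<in> {0<..<T}" for t x
      using sup[OF f src, of t x] that T M by (auto intro: le_less_trans)
    ultimately show ?thesis by blast
  qed
  then show ?thesis using C1 C2 by (intro exI[of _ "C1 + C2"]) auto
qed

text \<open>The difference is at most p w^(1/N) |h| with w = |u| + |v| and h = u - v, and the bound
  has to be linear in the distance d. Rescaling w by 2K and h by d before splitting the product puts
  both factors at size 1 in the class; each is then handled by
  \<open>critical_power_local_mass\<close>, and the scale (2K)^(1/N) d comes out in front. With v =
  0 this also bounds the nonlinear term itself.\<close>

lemma Fp_source_bound: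
  assumes S: "0 < S"
  shows "\<exists>C>0. \<forall>T \<rho> K d u v. 0 < K \<and> 0 < d \<and> 0 < \<rho> \<and> T \<le> S \<and>
     case_prod u \<in> borel_measurable (borel \<Otimes>\<^sub>M borel) \<and> case_prod v \<in> borel_measurable (borel \<Otimes>\<^sub>M borel) \<and>
     adm T \<rho> K u \<and> adm T \<rho> K v \<and> adm T \<rho> d (\<lambda>x t. u x t - v x t) \<longrightarrow>
     source_bound T \<rho> (C * K powr (1 / N) * d) (\<lambda>y s. Fp (1 + 1 / N) (u y s) - Fp (1 + 1 / N) (v y s))"
proof -
  define p where "p = 1 + 1 / N"
  have p: "1 < p" "p - 1 = 1 / N" using N_pos by (auto simp: p_def)
  obtain C1 where C1: "0 < C1" and NL: "\<And>K f s \<rho> z. 0 < K \<Longrightarrow> 0 < \<rho> \<Longrightarrow> f \<in> borel_measurable borel \<Longrightarrow> log_bounded \<rho> K f \<Longrightarrow>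
     0 < s \<Longrightarrow> s \<le> S \<Longrightarrow> (\<And>x. \<bar>f x\<bar> \<le> K * (s powr (- N) * Lg s powr (- N))) \<Longrightarrow>
     (\<integral>\<^sup>+x\<in>ball z \<rho>. ennreal (\<bar>f x\<bar> powr p) \<partial>lborel)
       \<le> ennreal (C1 * K powr p * (s powr (- 1) * Lg s powr (- N - 1)))"
    using critical_power_local_mass[OF S] unfolding p_def by blast
  define C where "C = p * 2 powr (1 / N) * (2 * C1 + 1)"
  have C: "0 < C" using p C1 by (simp add: C_def)
  moreover have "source_bound T \<rho> (C * K powr (1 / N) * d) (\<lambda>y s. Fp p (u y s) - Fp p (v y s))"
    if K: "0 < K" and d: "0 < d" and \<rho>: "0 < \<rho>" and T: "T \<le> S"
      and [measurable]: "case_prod u \<in> borel_measurable (borel \<Otimes>\<^sub>M borel)" "case_prod v \<in> borel_measurable (borel \<Otimes>\<^sub>M borel)"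
      and u: "adm T \<rho> K u" and v: "adm T \<rho> K v" and uv: "adm T \<rho> d (\<lambda>x t. u x t - v x t)" for T \<rho> K d u v
  proof -
    define w where "w x t = \<bar>u x t\<bar> + \<bar>v x t\<bar>" for x t
    define h where "h x t = u x t - v x t" for x t
    have [measurable]: "case_prod w \<in> borel_measurable (borel \<Otimes>\<^sub>M borel)" "case_prod h \<in> borel_measurable (borel \<Otimes>\<^sub>M borel)"
      unfolding w_def h_def by measurable
    have w: "adm T \<rho> (K + K) w"
      by (rule adm_add[OF u v]) (use K in \<open>auto simp: w_def\<close>)
    have h: "adm T \<rho> d h" using uv by (simp add: h_def[abs_def])
    define A where "A = p * ((2 * K) powr (1 / N) * d)"
    have A: "0 < A" using p K d by (simp add: A_def)
    have AC: "A * (2 * C1 + 1) = C * K powr (1 / N) * d" using K by (simp add: A_def C_def powr_mult mult_ac)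
    have pt0: "\<bar>Fp p (u x t) - Fp p (v x t)\<bar> \<le> p * (w x t powr (1 / N) * \<bar>h x t\<bar>)" for x t
      using Fp_diff[OF p(1), of "u x t" "v x t"] unfolding w_def h_def p(2) .
    \<comment> \<open>A crude form of Young's inequality: replace the smaller of the two factors by
      the larger one.\<close>
    have young: "a powr (1 / N) * b \<le> a powr p + b powr p" if "0 \<le> a" "0 \<le> b" for a b :: real
    proof (cases "a \<le> b")
      case True
      have "a powr (1 / N) * b \<le> b powr (1 / N) * b" using True that N_pos by (intro mult_right_mono powr_mono2) auto
      also have "\<dots> = b powr p" using that by (cases "b = 0") (auto simp: p_def powr_add)
      finally show ?thesis by (simp add: add_increasing)
    next
      case False
      have "a powr (1 / N) * b \<le> a powr (1 / N) * a" using False by (intro mult_left_mono) auto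
      also have "\<dots> = a powr p" using that by (cases "a = 0") (auto simp: p_def powr_add)
      finally show ?thesis by (simp add: add_increasing2)
    qed
    have pt: "\<bar>Fp p (u x t) - Fp p (v x t)\<bar> \<le> (A / (2 * K) powr p) * \<bar>w x t\<bar> powr p + (A / d powr p) * \<bar>h x t\<bar> powr p" for x t
    proof -
      have w0: "0 \<le> w x t" by (simp add: w_def)
      have "p * (w x t powr (1 / N) * \<bar>h x t\<bar>) = A * ((w x t / (2 * K)) powr (1 / N) * (\<bar>h x t\<bar> / d))"
        using K d w0 by (simp add: A_def powr_divide)
      also have "\<dots> \<le> A * ((w x t / (2 * K)) powr p + (\<bar>h x t\<bar> / d) powr p)"
        using A K d w0 by (intro mult_left_mono young) auto
      also have "\<dots> = (A / (2 * K) powr p) * \<bar>w x t\<bar> powr p + (A / d powr p) * \<bar>h x t\<bar> powr p"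
        using K d w0 by (simp add: powr_divide distrib_left)
      finally show ?thesis using pt0[of x t] by linarith
    qed
    show ?thesis
      unfolding source_bound_def
    proof (intro ballI conjI allI)
      fix s z assume s: "s \<in> {0<..<T}"
      let ?m = "s powr (- 1) * Lg s powr (- N - 1)"
      have W: "(\<integral>\<^sup>+x\<in>ball z \<rho>. ennreal (\<bar>w x s\<bar> powr p) \<partial>lborel) \<le> ennreal (C1 * (2 * K) powr p * ?m)"
        using w s K \<rho> T by (intro NL) (auto simp: adm_def)
      have H: "(\<integral>\<^sup>+x\<in>ball z \<rho>. ennreal (\<bar>h x s\<bar> powr p) \<partial>lborel) \<le> ennreal (C1 * d powr p * ?m)"
        using h s d \<rho> T by (intro NL) (auto simp: adm_def)
      have "(\<integral>\<^sup>+y\<in>ball z \<rho>. ennreal \<bar>Fp p (u y s) - Fp p (v y s)\<bar> \<partial>lborel) \<le>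
         (\<integral>\<^sup>+y. ennreal (A / (2 * K) powr p) * (ennreal (\<bar>w y s\<bar> powr p) * indicator (ball z \<rho>) y) +
            ennreal (A / d powr p) * (ennreal (\<bar>h y s\<bar> powr p) * indicator (ball z \<rho>) y) \<partial>lborel)"
      proof (rule nn_integral_mono)
        fix y
        have "ennreal \<bar>Fp p (u y s) - Fp p (v y s)\<bar> \<le> ennreal (A / (2 * K) powr p) * ennreal (\<bar>w y s\<bar> powr p) + ennreal (A / d powr p) * ennreal (\<bar>h y s\<bar> powr p)"
          using ennreal_leI[OF pt[of y s]] A by (simp add: ennreal_mult[symmetric])
        then show "ennreal \<bar>Fp p (u y s) - Fp p (v y s)\<bar> * indicator (ball z \<rho>) y \<le>
          ennreal (A / (2 * K) powr p) * (ennreal (\<bar>w y s\<bar> powr p) * indicator (ball z \<rho>) y) +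
            ennreal (A / d powr p) * (ennreal (\<bar>h y s\<bar> powr p) * indicator (ball z \<rho>) y)"
          by (auto simp: indicator_def)
      qed
      also have "\<dots> = ennreal (A / (2 * K) powr p) * (\<integral>\<^sup>+y\<in>ball z \<rho>. ennreal (\<bar>w y s\<bar> powr p) \<partial>lborel) +
            ennreal (A / d powr p) * (\<integral>\<^sup>+y\<in>ball z \<rho>. ennreal (\<bar>h y s\<bar> powr p) \<partial>lborel)"
        by (subst nn_integral_add) (auto simp: nn_integral_cmult)
      also have "\<dots> \<le> ennreal (A / (2 * K) powr p) * ennreal (C1 * (2 * K) powr p * ?m) + ennreal (A / d powr p) * ennreal (C1 * d powr p * ?m)"
        by (intro add_mono mult_left_mono W H) auto
      also have "\<dots> = ennreal (A * (2 * C1) * ?m)"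
      proof -
        have "A / (2 * K) powr p * (C1 * (2 * K) powr p * ?m) + A / d powr p * (C1 * d powr p * ?m) = A * (2 * C1) * ?m"
          using K d by simp
        then show ?thesis
          using A C1 by (simp add: ennreal_mult[symmetric] ennreal_plus[symmetric] del: ennreal_plus)
      qed
      also have "\<dots> \<le> ennreal (A * (2 * C1 + 1) * ?m)"
        using A by (intro ennreal_leI mult_right_mono) auto
      finally show "(\<integral>\<^sup>+y\<in>ball z \<rho>. ennreal \<bar>Fp p (u y s) - Fp p (v y s)\<bar> \<partial>lborel) \<le> ennreal (C * K powr (1 / N) * d * ?m)"
        unfolding AC .
    next
      fix s y assume s: "s \<in> {0<..<T}"
      define b where "b = s powr (- N) * Lg s powr (- N)"
      have b: "0 < b" using s Lg_pos[of s] by (simp add: b_def)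
      have bb: "b powr (1 / N) * b = s powr (- N - 1) * Lg s powr (- N - 1)"
      proof -
        have "b powr (1 / N) * b = b powr p" using b by (simp add: p_def powr_add)
        also have "\<dots> = s powr (- N * p) * Lg s powr (- N * p)" by (simp only: b_def powr_mult powr_powr)
        also have "- N * p = - N - 1" using N_pos by (simp add: p_def algebra_simps)
        finally show ?thesis .
      qed
      have wb: "w y s \<le> (2 * K) * b" and hb: "\<bar>h y s\<bar> \<le> d * b"
        using w h s by (auto simp: adm_def b_def intro: order_trans[OF abs_ge_self])
      have "\<bar>Fp p (u y s) - Fp p (v y s)\<bar> \<le> p * (w y s powr (1 / N) * \<bar>h y s\<bar>)" by (rule pt0)
      also have "\<dots> \<le> p * (((2 * K) * b) powr (1 / N) * (d * b))"
        using wb hb p N_pos b d K by (intro mult_left_mono mult_mono powr_mono2) (auto simp: w_def)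
      also have "\<dots> = A * (b powr (1 / N) * b)"
        by (simp add: A_def powr_mult)
      also have "\<dots> \<le> A * (2 * C1 + 1) * (b powr (1 / N) * b)"
        using A C1 b by (intro mult_right_mono) auto
      finally show "\<bar>Fp p (u y s) - Fp p (v y s)\<bar> \<le> C * K powr (1 / N) * d * (s powr (- N - 1) * Lg s powr (- N - 1))"
        unfolding AC bb .
    qed
  qed
  ultimately show ?thesis unfolding p_def by blast
qed


section \<open>Contraction and Picard iteration\<close>

abbreviation nonlin :: "('a \<Rightarrow> real \<Rightarrow> real) \<Rightarrow> 'a \<Rightarrow> real \<Rightarrow> real" where
  "nonlin u \<equiv> (\<lambda>y s. Fp (1 + 1 / N) (u y s))"

lemma borel_measurable_nonlin:
  assumes [measurable]: "case_prod u \<in> borel_measurable (borel \<Otimes>\<^sub>M borel)"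
  shows "case_prod (nonlin u) \<in> borel_measurable (borel \<Otimes>\<^sub>M borel)"
  by measurable

lemma adm_supD: "adm T \<rho> K u \<Longrightarrow> 0 < t \<Longrightarrow> t < T \<Longrightarrow> \<bar>u x t\<bar> \<le> K * (t powr (- N) * Lg t powr (- N))"
  by (simp add: adm_def)

lemma nonlin_contraction:
  assumes S: "0 < S"
  shows "\<exists>\<kappa>>0. \<exists>M\<ge>0. \<forall>T d u v. 0 < T \<and> T \<le> S \<and> 0 < d \<and>
     case_prod u \<in> borel_measurable (borel \<Otimes>\<^sub>M borel) \<and> case_prod v \<in> borel_measurable (borel \<Otimes>\<^sub>M borel) \<and>
     adm T (T powr (1 / \<theta>)) \<kappa> u \<and> adm T (T powr (1 / \<theta>)) \<kappa> v \<and> adm T (T powr (1 / \<theta>)) d (\<lambda>x t. u x t - v x t) \<longrightarrow>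
     source_bound T (T powr (1 / \<theta>)) (M * d) (\<lambda>y s. nonlin u y s - nonlin v y s) \<and>
     adm T (T powr (1 / \<theta>)) (d / 2) (dint (\<lambda>y s. nonlin u y s - nonlin v y s)) \<and>
     (\<forall>t\<in>{0<..<T}. \<forall>x. duh (\<lambda>y s. nonlin u y s - nonlin v y s) x t < \<infinity>)"
proof -
  obtain C1 where C1: "0 < C1" and D: "\<And>T M f. case_prod f \<in> borel_measurable (borel \<Otimes>\<^sub>M borel) \<Longrightarrow>
     source_bound T (T powr (1 / \<theta>)) M f \<Longrightarrow> T \<le> S \<Longrightarrow> 0 \<le> M \<Longrightarrow>
     adm T (T powr (1 / \<theta>)) (C1 * M) (dint f) \<and> (\<forall>t\<in>{0<..<T}. \<forall>x. duh f x t < \<infinity>)"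
    using dint_adm[OF S] by blast
  obtain C2 where C2: "0 < C2" and F0: "\<forall>T \<rho> K d u v. 0 < K \<and> 0 < d \<and> 0 < \<rho> \<and> T \<le> S \<and>
     case_prod u \<in> borel_measurable (borel \<Otimes>\<^sub>M borel) \<and> case_prod v \<in> borel_measurable (borel \<Otimes>\<^sub>M borel) \<and>
     adm T \<rho> K u \<and> adm T \<rho> K v \<and> adm T \<rho> d (\<lambda>x t. u x t - v x t) \<longrightarrow>
     source_bound T \<rho> (C2 * K powr (1 / N) * d) (\<lambda>y s. nonlin u y s - nonlin v y s)"
    using Fp_source_bound[OF S] by (elim exE conjE) (rule that)
  \<comment> \<open>Solves C1 C2 \<kappa>^(1/N) = 1/2, so that the Duhamel map halves distances
    within the class of constant \<kappa>.\<close>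
  define \<kappa> where "\<kappa> = (1 / (2 * C1 * C2)) powr N"
  have \<kappa>: "0 < \<kappa>" using C1 C2 by (simp add: \<kappa>_def)
  have \<kappa>N: "C1 * (C2 * \<kappa> powr (1 / N) * d) = d / 2" for d
  proof -
    have "\<kappa> powr (1 / N) = 1 / (2 * C1 * C2)" using C1 C2 N_pos by (simp add: \<kappa>_def powr_powr)
    then show ?thesis using C1 C2 by simp
  qed
  define M where "M = C2 * \<kappa> powr (1 / N)"
  have M: "0 \<le> M" using C2 by (simp add: M_def)
  have *: "source_bound T (T powr (1 / \<theta>)) (M * d) (\<lambda>y s. nonlin u y s - nonlin v y s) \<and>
     adm T (T powr (1 / \<theta>)) (d / 2) (dint (\<lambda>y s. nonlin u y s - nonlin v y s)) \<and>
     (\<forall>t\<in>{0<..<T}. \<forall>x. duh (\<lambda>y s. nonlin u y s - nonlin v y s) x t < \<infinity>)"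
    if T: "0 < T" "T \<le> S" and d: "0 < d" and
     [measurable]: "case_prod u \<in> borel_measurable (borel \<Otimes>\<^sub>M borel)" "case_prod v \<in> borel_measurable (borel \<Otimes>\<^sub>M borel)" and
     uv: "adm T (T powr (1 / \<theta>)) \<kappa> u" "adm T (T powr (1 / \<theta>)) \<kappa> v" "adm T (T powr (1 / \<theta>)) d (\<lambda>x t. u x t - v x t)" for T d u v
  proof -
    have src: "source_bound T (T powr (1 / \<theta>)) (C2 * \<kappa> powr (1 / N) * d) (\<lambda>y s. nonlin u y s - nonlin v y s)"
      using T by (intro F0[rule_format] conjI \<kappa> d uv that(4,5)) simp_all
    have m: "case_prod (\<lambda>y s. nonlin u y s - nonlin v y s) \<in> borel_measurable (borel \<Otimes>\<^sub>M borel)"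
      by measurable
    have "adm T (T powr (1 / \<theta>)) (C1 * (C2 * \<kappa> powr (1 / N) * d)) (dint (\<lambda>y s. nonlin u y s - nonlin v y s)) \<and>
      (\<forall>t\<in>{0<..<T}. \<forall>x. duh (\<lambda>y s. nonlin u y s - nonlin v y s) x t < \<infinity>)"
      by (rule D[OF m src T(2)]) (use d C2 in simp)
    then show ?thesis using src unfolding \<kappa>N M_def by blast
  qed
  show ?thesis
    by (intro exI[of _ \<kappa>] conjI[OF \<kappa>] exI[of _ M] conjI[OF M] allI impI, elim conjE, rule *)
qed

fun picard :: "('a \<Rightarrow> real) \<Rightarrow> nat \<Rightarrow> 'a \<Rightarrow> real \<Rightarrow> real" where
  "picard \<phi> 0 = (\<lambda>x t. 0)"
| "picard \<phi> (Suc k) = (\<lambda>x t. lin \<phi> x t + dint (nonlin (picard \<phi> k)) x t)"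

lemma borel_measurable_picard [measurable]:
  assumes [measurable]: "\<phi> \<in> borel_measurable borel"
  shows "case_prod (picard \<phi> k) \<in> borel_measurable (borel \<Otimes>\<^sub>M borel)"
proof (induction k)
  case (Suc k)
  note [measurable] = Suc
  show ?case unfolding picard.simps by measurable
qed simp

text \<open>Successive iterates differ by at most \<kappa> 2^(-k) in the class, hence converge at
  every point of 0 < t < T. The class is closed under pointwise limits, and the contraction applied
  to the limit and an iterate carries the equation to the limit.\<close>

lemma mild_solution_exists:
  assumes S: "0 < S"
  shows "\<exists>\<kappa>>0. \<exists>M\<ge>0. \<forall>T \<phi>. 0 < T \<and> T \<le> S \<and> \<phi> \<in> borel_measurable borel \<and> adm T (T powr (1 / \<theta>)) (\<kappa> / 2) (lin \<phi>) \<longrightarrow>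
     (\<exists>u. case_prod u \<in> borel_measurable (borel \<Otimes>\<^sub>M borel) \<and> adm T (T powr (1 / \<theta>)) \<kappa> u \<and>
        source_bound T (T powr (1 / \<theta>)) M (nonlin u) \<and>
        (\<forall>t\<in>{0<..<T}. \<forall>x. duh (nonlin u) x t < \<infinity> \<and> u x t = lin \<phi> x t + dint (nonlin u) x t))"
proof -
  obtain \<kappa> M where \<kappa>: "0 < \<kappa>" and M: "0 \<le> M" and contr0: "\<forall>T d u v. 0 < T \<and> T \<le> S \<and> 0 < d \<and>
     case_prod u \<in> borel_measurable (borel \<Otimes>\<^sub>M borel) \<and> case_prod v \<in> borel_measurable (borel \<Otimes>\<^sub>M borel) \<and>
     adm T (T powr (1 / \<theta>)) \<kappa> u \<and> adm T (T powr (1 / \<theta>)) \<kappa> v \<and> adm T (T powr (1 / \<theta>)) d (\<lambda>x t. u x t - v x t) \<longrightarrow>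
     source_bound T (T powr (1 / \<theta>)) (M * d) (\<lambda>y s. nonlin u y s - nonlin v y s) \<and>
     adm T (T powr (1 / \<theta>)) (d / 2) (dint (\<lambda>y s. nonlin u y s - nonlin v y s)) \<and>
     (\<forall>t\<in>{0<..<T}. \<forall>x. duh (\<lambda>y s. nonlin u y s - nonlin v y s) x t < \<infinity>)"
    using nonlin_contraction[OF S] by (elim exE conjE) (rule that)
  note contr = contr0[rule_format, OF conjI[OF _ conjI[OF _ conjI[OF _ conjI[OF _ conjI[OF _ conjI[OF _ conjI]]]]]]]
  have "\<exists>u. case_prod u \<in> borel_measurable (borel \<Otimes>\<^sub>M borel) \<and> adm T (T powr (1 / \<theta>)) \<kappa> u \<and>
        source_bound T (T powr (1 / \<theta>)) (M * \<kappa>) (nonlin u) \<and>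
        (\<forall>t\<in>{0<..<T}. \<forall>x. duh (nonlin u) x t < \<infinity> \<and> u x t = lin \<phi> x t + dint (nonlin u) x t)"
    if T: "0 < T" "T \<le> S" and [measurable]: "\<phi> \<in> borel_measurable borel"
      and lin: "adm T (T powr (1 / \<theta>)) (\<kappa> / 2) (lin \<phi>)" for T \<phi>
  proof -
    define \<rho> where "\<rho> = T powr (1 / \<theta>)"
    note contr' = contr[OF T, folded \<rho>_def]
    define U where "U = picard \<phi>"
    have Um[measurable]: "case_prod (U k) \<in> borel_measurable (borel \<Otimes>\<^sub>M borel)" for k
      unfolding U_def by measurable
    have U0: "U 0 = (\<lambda>x t. 0)" and USuc: "U (Suc k) x t = lin \<phi> x t + dint (nonlin (U k)) x t" for k x t
      by (auto simp: U_def)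
    have zero: "adm T \<rho> \<kappa> (\<lambda>x t. 0)" using \<kappa> by (simp add: adm_zero)
    \<comment> \<open>The contraction against v = 0 with d = \<kappa>. The Duhamel term then takes
      at most \<kappa>/2, which together with \<kappa>/2 from the linear term keeps the iterates in
      the class.\<close>
    have single: "source_bound T \<rho> (M * \<kappa>) (nonlin u) \<and> adm T \<rho> (\<kappa> / 2) (dint (nonlin u)) \<and>
        (\<forall>t\<in>{0<..<T}. \<forall>x. duh (nonlin u) x t < \<infinity>)"
      if [measurable]: "case_prod u \<in> borel_measurable (borel \<Otimes>\<^sub>M borel)" and u: "adm T \<rho> \<kappa> u" for u
      using contr'[of \<kappa> u "\<lambda>x t. 0"] \<kappa> u zero by simp
    have admU: "adm T \<rho> \<kappa> (U k)" for k
    proof (induction k)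
      case 0
      then show ?case using zero by (simp add: U0)
    next
      case (Suc k)
      have D: "adm T \<rho> (\<kappa> / 2) (dint (nonlin (U k)))" using single[OF Um Suc] by (elim conjE)
      have L: "adm T \<rho> (\<kappa> / 2) (lin \<phi>)" using lin unfolding \<rho>_def .
      have "adm T \<rho> (\<kappa> / 2 + \<kappa> / 2) (U (Suc k))"
      proof (rule adm_add[OF L D _ _ borel_measurable_lin borel_measurable_dint[OF borel_measurable_nonlin[OF Um]]])
        show "\<bar>U (Suc k) x t\<bar> \<le> \<bar>lin \<phi> x t\<bar> + \<bar>dint (nonlin (U k)) x t\<bar>" for x t
          unfolding USuc by (rule abs_triangle_ineq)
      qed (use \<kappa> that in simp_all)
      then show ?case by simp
    qed
    have diff: "dint (nonlin u) x t - dint (nonlin v) x t = dint (\<lambda>y s. nonlin u y s - nonlin v y s) x t"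
      if "case_prod u \<in> borel_measurable (borel \<Otimes>\<^sub>M borel)" "adm T \<rho> \<kappa> u"
        "case_prod v \<in> borel_measurable (borel \<Otimes>\<^sub>M borel)" "adm T \<rho> \<kappa> v" "0 < t" "t < T" for u v x t
      using single[OF that(1,2)] single[OF that(3,4)] that
      by (intro dint_diff borel_measurable_nonlin) auto
    have step: "adm T \<rho> (\<kappa> * (1/2) ^ k) (\<lambda>x t. U (Suc k) x t - U k x t)" for k
    proof (induction k)
      case 0
      have "adm T \<rho> (\<kappa> + 0) (\<lambda>x t. U (Suc 0) x t - U 0 x t)"
        by (rule adm_add[OF admU[of "Suc 0"] adm_zero]) (use \<kappa> in \<open>auto simp: U0\<close>)
      then show ?case by simp
    next
      case (Suc k)
      have "adm T \<rho> (\<kappa> * (1/2) ^ k / 2) (dint (\<lambda>y s. nonlin (U (Suc k)) y s - nonlin (U k) y s))"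
        using contr'[OF _ Um Um admU admU Suc] \<kappa> by simp
      also have "adm T \<rho> (\<kappa> * (1/2) ^ k / 2) (dint (\<lambda>y s. nonlin (U (Suc k)) y s - nonlin (U k) y s)) \<longleftrightarrow>
          adm T \<rho> (\<kappa> * (1/2) ^ k / 2) (\<lambda>x t. U (Suc (Suc k)) x t - U (Suc k) x t)"
      proof (rule adm_cong)
        fix x t assume t: "0 < t" "t < T"
        show "dint (\<lambda>y s. nonlin (U (Suc k)) y s - nonlin (U k) y s) x t = U (Suc (Suc k)) x t - U (Suc k) x t"
          using diff[OF Um admU Um admU t, of "Suc k" x k] USuc[of "Suc k" x t] USuc[of k x t] by linarith
      qed
      finally show ?case by simp
    qed
    \<comment> \<open>The factor 2 (1 - 2^(-j)) is the partial geometric sum; in this exact form the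
      induction on j closes.\<close>
    have tele: "adm T \<rho> (\<kappa> * (1/2) ^ k * 2 * (1 - (1/2) ^ j)) (\<lambda>x t. U (k + j) x t - U k x t)" for k j
    proof (induction j)
      case 0
      then show ?case by (simp add: adm_zero)
    next
      case (Suc j)
      have nn: "0 \<le> \<kappa> * (1/2) ^ k * 2 * (1 - (1/2) ^ j)"
        using \<kappa> by (intro mult_nonneg_nonneg) (auto simp: power_le_one)
      have "adm T \<rho> (\<kappa> * (1/2) ^ k * 2 * (1 - (1/2) ^ j) + \<kappa> * (1/2) ^ (k + j)) (\<lambda>x t. U (k + Suc j) x t - U k x t)"
        by (rule adm_add[OF Suc step[of "k + j"] nn]) (use \<kappa> in auto)
      also have "\<kappa> * (1/2) ^ k * 2 * (1 - (1/2) ^ j) + \<kappa> * (1/2) ^ (k + j) = \<kappa> * (1/2) ^ k * 2 * (1 - (1/2) ^ Suc j)"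
        by (simp add: power_add field_simps)
      finally show ?case .
    qed
    define u where "u x t = lim (\<lambda>k. U k x t)" for x t
    have um[measurable]: "case_prod u \<in> borel_measurable (borel \<Otimes>\<^sub>M borel)"
      unfolding u_def by measurable
    have conv: "(\<lambda>k. U k x t) \<longlonglongrightarrow> u x t" if t: "0 < t" "t < T" for x t
    proof -
      define b where "b = t powr (- N) * Lg t powr (- N)"
      have "summable (\<lambda>k. U (Suc k) x t - U k x t)"
      proof (rule summable_comparison_test)
        show "\<exists>n0. \<forall>k\<ge>n0. norm (U (Suc k) x t - U k x t) \<le> \<kappa> * (1/2) ^ k * b"
          using step t by (auto simp: adm_def b_def)
        show "summable (\<lambda>k. \<kappa> * (1/2) ^ k * b)"
          by (intro summable_mult summable_mult2 summable_geometric) auto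
      qed
      then have "convergent (\<lambda>n. \<Sum>k<n. U (Suc k) x t - U k x t)" by (simp add: summable_iff_convergent)
      then have "convergent (\<lambda>n. U n x t)" unfolding sum_lessThan_telescope[where f="\<lambda>k. U k x t"] by (simp add: U0)
      then show ?thesis unfolding u_def by (simp add: convergent_LIMSEQ_iff)
    qed
    have admu: "adm T \<rho> \<kappa> u" by (rule adm_lim[OF admU Um conv])
    have close: "adm T \<rho> (\<kappa> * (1/2) ^ k * 2) (\<lambda>x t. u x t - U k x t)" for k
    proof (rule adm_lim)
      show "adm T \<rho> (\<kappa> * (1/2) ^ k * 2) (\<lambda>x t. U (k + j) x t - U k x t)" for j
        by (rule adm_mono[OF tele]) (use \<kappa> in auto)
      show "(\<lambda>j. U (k + j) x t - U k x t) \<longlonglongrightarrow> u x t - U k x t" if "0 < t" "t < T" for x t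
        using LIMSEQ_ignore_initial_segment[OF conv[OF that, of x], of k]
        by (intro tendsto_diff tendsto_const) (simp add: add.commute)
    qed measurable
    have eq: "u x t = lin \<phi> x t + dint (nonlin u) x t" if t: "0 < t" "t < T" for x t
    proof -
      define b where "b = t powr (- N) * Lg t powr (- N)"
      \<comment> \<open>Contraction of the pair formed by the limit and the k-th iterate, whose
        distance is at most 2 \<kappa> 2^(-k). It replaces a dominated convergence argument for the
        nonlinear term.\<close>
      have bnd: "norm (dint (nonlin (U k)) x t - dint (nonlin u) x t) \<le> \<kappa> * b * (1/2) ^ k" for k
      proof -
        have d: "0 < \<kappa> * (1/2) ^ k * 2" using \<kappa> by simp
        have "adm T \<rho> (\<kappa> * (1/2) ^ k * 2 / 2) (dint (\<lambda>y s. nonlin u y s - nonlin (U k) y s))"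
          using contr'[OF d um Um admu admU close[of k]] by (elim conjE)
        then have "\<bar>dint (\<lambda>y s. nonlin u y s - nonlin (U k) y s) x t\<bar> \<le> \<kappa> * (1/2) ^ k * 2 / 2 * b"
          unfolding b_def using t by (rule adm_supD)
        then have "\<bar>dint (nonlin u) x t - dint (nonlin (U k)) x t\<bar> \<le> \<kappa> * (1/2) ^ k * 2 / 2 * b"
          unfolding diff[OF um admu Um admU t] .
        also have "\<kappa> * (1/2) ^ k * 2 / 2 * b = \<kappa> * b * (1/2) ^ k" by simp
        finally show ?thesis by (simp only: real_norm_def abs_minus_commute)
      qed
      have "(\<lambda>k. \<kappa> * b * (1/2) ^ k) \<longlonglongrightarrow> 0"
        by (intro tendsto_mult_right_zero LIMSEQ_power_zero) simp
      then have "(\<lambda>k. dint (nonlin (U k)) x t - dint (nonlin u) x t) \<longlonglongrightarrow> 0"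
        by (rule Lim_null_comparison[OF always_eventually[OF allI[OF bnd]]])
      then have "(\<lambda>k. dint (nonlin (U k)) x t) \<longlonglongrightarrow> dint (nonlin u) x t"
        by (rule LIM_zero_cancel)
      then have "(\<lambda>k. lin \<phi> x t + dint (nonlin (U k)) x t) \<longlonglongrightarrow> lin \<phi> x t + dint (nonlin u) x t"
        by (rule tendsto_add[OF tendsto_const])
      then have "(\<lambda>k. U (Suc k) x t) \<longlonglongrightarrow> lin \<phi> x t + dint (nonlin u) x t" unfolding USuc .
      moreover have "(\<lambda>k. U (Suc k) x t) \<longlonglongrightarrow> u x t" using conv[OF t] by (rule LIMSEQ_Suc)
      ultimately show ?thesis using LIMSEQ_unique by blast
    qed
    have "source_bound T \<rho> (M * \<kappa>) (nonlin u)" "\<forall>t\<in>{0<..<T}. \<forall>x. duh (nonlin u) x t < \<infinity>"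
      using single[OF um admu] by simp_all
    moreover have "\<forall>t\<in>{0<..<T}. \<forall>x. u x t = lin \<phi> x t + dint (nonlin u) x t" using eq by simp
    ultimately show ?thesis
      using um admu unfolding \<rho>_def by blast
  qed
  moreover have "0 \<le> M * \<kappa>" using \<kappa> M by simp
  ultimately show ?thesis using \<kappa> by blast
qed

end

section \<open>Norms, covering and continuity in time\<close>

lemma enn_root_1: "enn_root 1 x = x"
  unfolding enn_root_def by (cases x) (auto simp: top_ennreal.rep_eq)

lemma triple_norm_1:
  "triple_norm 1 \<gamma> \<rho> f = (SUP z. SUP s\<in>{0<..}. ennreal (Lg s powr \<gamma>) *
     (SUP E\<in>{E \<in> sets lebesgue. emeasure lebesgue E = ennreal s}. (\<integral>\<^sup>+x\<in>E \<inter> ball z \<rho>. ennreal \<bar>f x\<bar> \<partial>lborel)))"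
  for f :: "'a::euclidean_space \<Rightarrow> real"
proof -
  have "ennreal (\<bar>f x * indicator (ball z \<rho>) x\<bar> powr 1) * indicator E x = ennreal \<bar>f x\<bar> * indicator (E \<inter> ball z \<rho>) x" for x z E
    by (auto simp: indicator_def)
  then show ?thesis
    unfolding triple_norm_def LlogL_norm_def enn_root_1 Lg_def nn_integral_completion by simp
qed

lemma triple_norm_cong_AE:
  fixes f g :: "'a::euclidean_space \<Rightarrow> real"
  assumes "AE x in lborel. f x = g x"
  shows "triple_norm 1 \<gamma> \<rho> f = triple_norm 1 \<gamma> \<rho> g"
proof -
  have "(\<integral>\<^sup>+x\<in>E \<inter> ball z \<rho>. ennreal \<bar>f x\<bar> \<partial>lborel) = (\<integral>\<^sup>+x\<in>E \<inter> ball z \<rho>. ennreal \<bar>g x\<bar> \<partial>lborel)" for E z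
    using assms by (intro nn_integral_cong_AE) auto
  then show ?thesis unfolding triple_norm_1 by simp
qed

lemma triple_norm_leD:
  fixes f :: "'a::euclidean_space \<Rightarrow> real"
  assumes B: "triple_norm 1 \<gamma> \<rho> f \<le> B" and E: "E \<in> sets borel" "emeasure lborel E = ennreal s" "0 < s"
  shows "ennreal (Lg s powr \<gamma>) * (\<integral>\<^sup>+x\<in>E \<inter> ball z \<rho>. ennreal \<bar>f x\<bar> \<partial>lborel) \<le> B"
proof -
  have E': "E \<in> {E \<in> sets lebesgue. emeasure lebesgue E = ennreal s}"
    using E by simp
  have "ennreal (Lg s powr \<gamma>) * (\<integral>\<^sup>+x\<in>E \<inter> ball z \<rho>. ennreal \<bar>f x\<bar> \<partial>lborel) \<le> ennreal (Lg s powr \<gamma>) *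
     (SUP E\<in>{E \<in> sets lebesgue. emeasure lebesgue E = ennreal s}. (\<integral>\<^sup>+x\<in>E \<inter> ball z \<rho>. ennreal \<bar>f x\<bar> \<partial>lborel))"
    by (intro mult_left_mono SUP_upper[OF E']) auto
  also have "\<dots> \<le> triple_norm 1 \<gamma> \<rho> f"
    unfolding triple_norm_1 using E(3) by (intro SUP_upper2[of z] SUP_upper2[of s]) auto
  finally show ?thesis using B by (rule order_trans)
qed

text \<open>Borel sets suffice: a Lebesgue measurable set differs from its Borel main part by a
  subset of a null set, which changes neither the measure nor the integral.\<close>

lemma triple_norm_leI:
  fixes f :: "'a::euclidean_space \<Rightarrow> real"
  assumes B: "\<And>z E s. E \<in> sets borel \<Longrightarrow> emeasure lborel E = ennreal s \<Longrightarrow> 0 < s \<Longrightarrow>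
     ennreal (Lg s powr \<gamma>) * (\<integral>\<^sup>+x\<in>E \<inter> ball z \<rho>. ennreal \<bar>f x\<bar> \<partial>lborel) \<le> B"
  shows "triple_norm 1 \<gamma> \<rho> f \<le> B"
  unfolding triple_norm_1
proof (intro SUP_least)
  fix z :: 'a and s :: real assume s: "s \<in> {0<..}"
  define b where "b = ennreal (Lg s powr (- \<gamma>)) * B"
  have L: "Lg s powr \<gamma> * Lg s powr (- \<gamma>) = 1" using Lg_pos[of s] s by (simp add: powr_minus)
  have "(SUP E\<in>{E \<in> sets lebesgue. emeasure lebesgue E = ennreal s}. (\<integral>\<^sup>+x\<in>E \<inter> ball z \<rho>. ennreal \<bar>f x\<bar> \<partial>lborel)) \<le> b"
  proof (intro SUP_least)
    fix E :: "'a set" assume "E \<in> {E \<in> sets lebesgue. emeasure lebesgue E = ennreal s}"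
    then have E: "E \<in> sets lebesgue" "emeasure lebesgue E = ennreal s" by auto
    define E' where "E' = main_part lborel E"
    have E': "E' \<in> sets borel" "emeasure lborel E' = ennreal s" using main_part_sets[OF E(1)] E by (auto simp: E'_def)
    obtain Z where Z: "Z \<in> null_sets lborel" "null_part lborel E \<subseteq> Z" using null_part[OF E(1)] by blast
    have "E = E' \<union> null_part lborel E" using E by (simp add: E'_def)
    then have EE: "x \<in> E \<longleftrightarrow> x \<in> E'" if "x \<notin> Z" for x using that Z by auto
    have "AE x in lborel. x \<notin> Z" by (rule AE_not_in[OF Z(1)])
    then have "(\<integral>\<^sup>+x\<in>E \<inter> ball z \<rho>. ennreal \<bar>f x\<bar> \<partial>lborel) = (\<integral>\<^sup>+x\<in>E' \<inter> ball z \<rho>. ennreal \<bar>f x\<bar> \<partial>lborel)"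
      by (intro nn_integral_cong_AE) (auto simp: indicator_def EE)
    also have "\<dots> = ennreal (Lg s powr (- \<gamma>)) * (ennreal (Lg s powr \<gamma>) * (\<integral>\<^sup>+x\<in>E' \<inter> ball z \<rho>. ennreal \<bar>f x\<bar> \<partial>lborel))"
      using L by (simp add: mult.assoc[symmetric] ennreal_mult[symmetric] mult.commute)
    also have "\<dots> \<le> b"
      unfolding b_def using B[OF E'] s by (intro mult_left_mono) auto
    finally show "(\<integral>\<^sup>+x\<in>E \<inter> ball z \<rho>. ennreal \<bar>f x\<bar> \<partial>lborel) \<le> b" .
  qed
  then have "ennreal (Lg s powr \<gamma>) * (SUP E\<in>{E \<in> sets lebesgue. emeasure lebesgue E = ennreal s}. (\<integral>\<^sup>+x\<in>E \<inter> ball z \<rho>. ennreal \<bar>f x\<bar> \<partial>lborel))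
     \<le> ennreal (Lg s powr \<gamma>) * b" by (intro mult_left_mono) auto
  also have "\<dots> = B" using L by (simp add: b_def mult.assoc[symmetric] ennreal_mult[symmetric])
  finally show "ennreal (Lg s powr \<gamma>) * (SUP E\<in>{E \<in> sets lebesgue. emeasure lebesgue E = ennreal s}. (\<integral>\<^sup>+x\<in>E \<inter> ball z \<rho>. ennreal \<bar>f x\<bar> \<partial>lborel)) \<le> B" .
qed

text \<open>The integral over E within a unit ball is at most B min(s, v), and L(s)^\<gamma> min(s,
  v) is bounded: L(s)^\<gamma> is at most a constant times 1/s for small s, and at most
  L(1)^\<gamma> for s > 1. At positive times this reduces membership and continuity in the norm to
  uniform bounds.\<close>

lemma ul_norm_le_sup:
  assumes \<gamma>: "0 \<le> \<gamma>"
  shows "\<exists>C>0. \<forall>(f::'a::euclidean_space \<Rightarrow> real) B. 0 \<le> B \<and> (\<forall>x. \<bar>f x\<bar> \<le> B) \<longrightarrow> ul_norm 1 \<gamma> f \<le> ennreal (C * B)"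
proof -
  define v where "v = unit_ball_vol (real (DIM('a)))"
  have v: "0 < v" by (simp add: v_def)
  \<comment> \<open>With exponent 1/(\<gamma>+1), raising to the power \<gamma> + 1 gives exactly
    1/s, and \<gamma> = 0 needs no separate case.\<close>
  obtain C1 where C1: "0 < C1" "\<And>s. 0 < s \<Longrightarrow> s \<le> 1 \<Longrightarrow> Lg s \<le> C1 * s powr (- (1 / (\<gamma> + 1)))"
    using Lg_le_powr[of "1 / (\<gamma> + 1)" 1] \<gamma> by auto
  define C where "C = C1 powr (\<gamma> + 1) + Lg 1 powr \<gamma> * v"
  have C: "0 < C" using C1 v by (simp add: C_def add_pos_nonneg)
  have key: "Lg s powr \<gamma> * min s v \<le> C" if s: "0 < s" for s
  proof (cases "s \<le> 1")
    case True
    have "Lg s powr \<gamma> \<le> Lg s powr (\<gamma> + 1)" using Lg_ge_1[OF s] by (intro powr_mono) auto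
    also have "\<dots> \<le> (C1 * s powr (- (1 / (\<gamma> + 1)))) powr (\<gamma> + 1)"
      using C1(2)[OF s True] Lg_pos[OF s] \<gamma> by (intro powr_mono2) auto
    also have "\<dots> = C1 powr (\<gamma> + 1) * s powr (- (1 / (\<gamma> + 1)) * (\<gamma> + 1))"
      by (simp only: powr_mult powr_powr)
    also have "- (1 / (\<gamma> + 1)) * (\<gamma> + 1) = - 1" using \<gamma> by simp
    finally have "Lg s powr \<gamma> * min s v \<le> C1 powr (\<gamma> + 1) * s powr (- 1) * s"
      using s v by (intro mult_mono) auto
    also have "\<dots> = C1 powr (\<gamma> + 1)" using s by (simp add: powr_minus)
    also have "\<dots> \<le> C" using v by (simp add: C_def)
    finally show ?thesis .
  next
    case False
    have "Lg s powr \<gamma> * min s v \<le> Lg 1 powr \<gamma> * v"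
      using False \<gamma> v Lg_antimono[of 1 s] Lg_pos[OF s] by (intro mult_mono powr_mono2) auto
    also have "\<dots> \<le> C" by (simp add: C_def)
    finally show ?thesis .
  qed
  have "ul_norm 1 \<gamma> f \<le> ennreal (C * B)" if B: "0 \<le> B" and f: "\<And>x. \<bar>f x\<bar> \<le> B" for f :: "'a \<Rightarrow> real" and B
    unfolding ul_norm_def
  proof (rule triple_norm_leI)
    fix z :: 'a and E :: "'a set" and s :: real
    assume E[measurable]: "E \<in> sets borel" and s: "emeasure lborel E = ennreal s" "0 < s"
    have "(\<integral>\<^sup>+x\<in>E \<inter> ball z 1. ennreal \<bar>f x\<bar> \<partial>lborel) \<le> (\<integral>\<^sup>+x. ennreal B * indicator (E \<inter> ball z 1) x \<partial>lborel)"
      by (intro nn_integral_mono mult_right_mono ennreal_leI f) auto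
    also have "\<dots> = ennreal B * emeasure lborel (E \<inter> ball z 1)" by (simp add: nn_integral_cmult_indicator)
    also have "\<dots> \<le> ennreal B * ennreal (min s v)"
    proof (intro mult_left_mono)
      have "emeasure lborel (E \<inter> ball z 1) \<le> emeasure lborel E" by (intro emeasure_mono) auto
      moreover have "emeasure lborel (E \<inter> ball z 1) \<le> emeasure lborel (ball z 1)" by (intro emeasure_mono) auto
      moreover have "emeasure lborel (ball z 1) = ennreal v" by (simp add: emeasure_ball v_def)
      ultimately show "emeasure lborel (E \<inter> ball z 1) \<le> ennreal (min s v)" using s by (simp add: min_def)
    qed simp
    finally have "ennreal (Lg s powr \<gamma>) * (\<integral>\<^sup>+x\<in>E \<inter> ball z 1. ennreal \<bar>f x\<bar> \<partial>lborel) \<le> ennreal (Lg s powr \<gamma>) * (ennreal B * ennreal (min s v))"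
      by (auto intro!: mult_left_mono)
    also have "\<dots> = ennreal (Lg s powr \<gamma> * min s v * B)"
      using B s v by (simp add: ennreal_mult[symmetric] mult_ac)
    also have "\<dots> \<le> ennreal (C * B)"
      using key[OF s(2)] B by (intro ennreal_leI mult_right_mono) auto
    finally show "ennreal (Lg s powr \<gamma>) * (\<integral>\<^sup>+x\<in>E \<inter> ball z 1. ennreal \<bar>f x\<bar> \<partial>lborel) \<le> ennreal (C * B)" .
  qed
  then show ?thesis using C by blast
qed

text \<open>By compactness a ball of radius R is covered by finitely many balls of radius \<rho>.
  The covering is translated along with z, so its cardinality does not depend on the centre. This
  changes the radius T^(1/\<theta>) into 1 or into that of a support.\<close>

lemma ball_covering:
  assumes \<rho>: "0 < \<rho>"
  shows "\<exists>m>0. \<forall>(z::'a::euclidean_space) E g M. g \<in> borel_measurable borel \<and> E \<in> sets borel \<and>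
     (\<forall>z'. (\<integral>\<^sup>+x\<in>E \<inter> ball z' \<rho>. g x \<partial>lborel) \<le> M) \<longrightarrow> (\<integral>\<^sup>+x\<in>E \<inter> ball z R. g x \<partial>lborel) \<le> ennreal m * M"
proof -
  have "cball (0::'a) R \<subseteq> (\<Union>c\<in>cball 0 R. ball c \<rho>)" using \<rho> by auto
  from compactE_image[OF compact_cball _ this]
  obtain C where C: "C \<subseteq> cball 0 R" "finite C" "cball (0::'a) R \<subseteq> (\<Union>c\<in>C. ball c \<rho>)" by auto
  have "(\<integral>\<^sup>+x\<in>E \<inter> ball z R. g x \<partial>lborel) \<le> ennreal (real (card C) + 1) * M"
    if [measurable]: "g \<in> borel_measurable borel" "E \<in> sets borel"
      and M: "\<And>z'. (\<integral>\<^sup>+x\<in>E \<inter> ball z' \<rho>. g x \<partial>lborel) \<le> M" for z :: 'a and E g M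
  proof -
    have "(\<integral>\<^sup>+x\<in>E \<inter> ball z R. g x \<partial>lborel) \<le> (\<integral>\<^sup>+x. (\<Sum>c\<in>C. g x * indicator (E \<inter> ball (z + c) \<rho>) x) \<partial>lborel)"
    proof (rule nn_integral_mono)
      fix x
      show "g x * indicator (E \<inter> ball z R) x \<le> (\<Sum>c\<in>C. g x * indicator (E \<inter> ball (z + c) \<rho>) x)"
      proof (cases "x \<in> E \<inter> ball z R")
        case True
        then have "x - z \<in> cball 0 R" by (simp add: dist_norm norm_minus_commute)
        then obtain c where c: "c \<in> C" "x - z \<in> ball c \<rho>" using C by auto
        then have "x \<in> E \<inter> ball (z + c) \<rho>" using True by (simp add: dist_norm algebra_simps)
        then have "g x * indicator (E \<inter> ball z R) x \<le> g x * indicator (E \<inter> ball (z + c) \<rho>) x"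
          using True by simp
        also have "\<dots> \<le> (\<Sum>c\<in>C. g x * indicator (E \<inter> ball (z + c) \<rho>) x)"
          using c C by (intro member_le_sum) auto
        finally show ?thesis .
      qed simp
    qed
    also have "\<dots> = (\<Sum>c\<in>C. \<integral>\<^sup>+x\<in>E \<inter> ball (z + c) \<rho>. g x \<partial>lborel)"
      by (rule nn_integral_sum) measurable
    also have "\<dots> \<le> (\<Sum>c\<in>C. M)" by (intro sum_mono M)
    also have "\<dots> = of_nat (card C) * M" by simp
    also have "\<dots> \<le> ennreal (real (card C) + 1) * M"
      by (intro mult_right_mono) (auto simp: ennreal_of_nat_eq_real_of_nat intro!: ennreal_leI)
    finally show ?thesis .
  qed
  then show ?thesis by (intro exI[of _ "real (card C) + 1"]) auto
qed

lemma tendsto_ennreal_zeroI: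
  fixes f :: "'b \<Rightarrow> ennreal"
  assumes "\<And>e. 0 < e \<Longrightarrow> eventually (\<lambda>x. f x \<le> ennreal e) F"
  shows "(f \<longlongrightarrow> 0) F"
proof (rule order_tendstoI)
  fix a :: ennreal assume "0 < a"
  then obtain b where b: "0 < b" "b < a" using dense by blast
  then obtain e where e: "b = ennreal e" "0 < e"
    by (cases b) (auto simp: ennreal_zero_less_top)
  show "eventually (\<lambda>x. f x < a) F"
    using assms[OF e(2)] by eventually_elim (use b e in \<open>auto intro: le_less_trans\<close>)
qed auto

context critical_exponent
begin

text \<open>Bound for the relative change of the kernel when time grows by the factor r. The first
  term comes from the increment of t^N G and carries the factor 2^(\<theta> N/2) of the shifted time
  2^(\<theta>/2) s; the second comes from the change of t^(-N).\<close>

definition omega :: "real \<Rightarrow> real" where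
  "omega r = 2 * (r powr (2 / \<theta>) - 1) * 2 powr (\<theta> * N / 2) + (1 - r powr (- N))"

lemma omega_mono: "1 \<le> r \<Longrightarrow> r \<le> q \<Longrightarrow> omega r \<le> omega q"
  unfolding omega_def using theta N_pos
  by (intro add_mono mult_left_mono mult_right_mono diff_mono powr_mono2 powr_mono2') auto

lemma omega_nonneg: "1 \<le> r \<Longrightarrow> 0 \<le> omega r"
  using omega_mono[of 1 r] by (simp add: omega_def)

lemma omega_tendsto: "(omega \<longlongrightarrow> 0) (at 1)"
proof -
  have "isCont omega 1" unfolding omega_def by (intro continuous_intros) auto
  then show ?thesis by (simp add: isCont_def omega_def)
qed

lemma G_diff:
  assumes "0 < t" "t \<le> s"
  shows "\<bar>G x s - G x t\<bar> \<le> omega (s / t) * (G x (2 powr (\<theta> / 2) * s) + G x t)"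
proof -
  define c where "c = 2 powr (\<theta> / 2)"
  have s: "0 < s" and c: "0 < c" using assms by (auto simp: c_def)
  have cN: "c powr N = 2 powr (\<theta> * N / 2)" by (simp add: c_def powr_powr mult.commute)
  define a b where "a = 2 * ((s / t) powr (2 / \<theta>) - 1) * 2 powr (\<theta> * N / 2)" and "b = 1 - (s / t) powr (- N)"
  have st: "1 \<le> s / t" using assms by simp
  have ab: "0 \<le> a" "0 \<le> b"
    using st theta N_pos ge_one_powr_ge_zero[of "s / t" "2 / \<theta>"] powr_mono2'[of "- N" 1 "s / t"]
    by (auto simp: a_def b_def)
  have om: "omega (s / t) = a + b" by (simp add: omega_def a_def b_def)
  have g: "0 \<le> G x (c * s)" "0 \<le> G x t" using s c assms by (auto intro!: G_nonneg)
  have st': "(s / t) powr (- N) = t powr N / s powr N" using assms s by (simp add: powr_minus powr_divide)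
  \<comment> \<open>Freezing the factor s^(-N) isolates the increment of t^N G: the full difference
    is Q - b G(x,t), with both parts nonnegative.\<close>
  define Q where "Q = (s powr N * G x s - t powr N * G x t) / s powr N"
  have "G x s - G x t = Q - b * G x t"
    using s by (simp add: Q_def b_def st' field_simps)
  moreover have "0 \<le> Q"
    using G_modulus(1)[OF assms, of x] by (simp add: Q_def)
  moreover have "Q \<le> a * G x (c * s)"
  proof -
    have "Q \<le> (2 * ((s / t) powr (2 / \<theta>) - 1) * ((c * s) powr N * G x (c * s))) / s powr N"
      unfolding Q_def using G_modulus(2)[OF assms, of x] by (intro divide_right_mono) (auto simp: c_def)
    also have "\<dots> = a * G x (c * s)" using s c by (simp add: a_def powr_mult cN)
    finally show ?thesis .
  qed
  moreover have "0 \<le> b * G x t" using ab g by simp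
  ultimately have "\<bar>G x s - G x t\<bar> \<le> a * G x (c * s) + b * G x t" by linarith
  also have "\<dots> \<le> (a + b) * (G x (c * s) + G x t)"
    using ab g by (simp add: algebra_simps)
  finally show ?thesis by (simp add: om c_def)
qed

lemma nn_integral_G_diff:
  assumes [measurable]: "f \<in> borel_measurable borel" and t: "0 < t" "t \<le> s"
  shows "(\<integral>\<^sup>+y. ennreal (\<bar>G (x - y) s - G (x - y) t\<bar> * \<bar>f y\<bar>) \<partial>lborel)
     \<le> ennreal (omega (s / t)) * (conv f (2 powr (\<theta> / 2) * s) x + conv f t x)"
proof -
  have o: "0 \<le> omega (s / t)" using t by (intro omega_nonneg) simp
  have cs: "0 < 2 powr (\<theta> / 2) * s" using t by simp
  note nn = G_nonneg[OF cs] G_nonneg[OF t(1)]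
  have "(\<integral>\<^sup>+y. ennreal (\<bar>G (x - y) s - G (x - y) t\<bar> * \<bar>f y\<bar>) \<partial>lborel) \<le>
     (\<integral>\<^sup>+y. ennreal (omega (s / t)) * (ennreal (G (x - y) (2 powr (\<theta> / 2) * s) * \<bar>f y\<bar>) + ennreal (G (x - y) t * \<bar>f y\<bar>)) \<partial>lborel)"
  proof (rule nn_integral_mono)
    fix y
    have "\<bar>G (x - y) s - G (x - y) t\<bar> * \<bar>f y\<bar> \<le> omega (s / t) * (G (x - y) (2 powr (\<theta> / 2) * s) + G (x - y) t) * \<bar>f y\<bar>"
      by (intro mult_right_mono G_diff t) auto
    then show "ennreal (\<bar>G (x - y) s - G (x - y) t\<bar> * \<bar>f y\<bar>)
      \<le> ennreal (omega (s / t)) * (ennreal (G (x - y) (2 powr (\<theta> / 2) * s) * \<bar>f y\<bar>) + ennreal (G (x - y) t * \<bar>f y\<bar>))"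
      using nn o by (simp add: ennreal_mult[symmetric] ennreal_plus[symmetric] algebra_simps ennreal_leI del: ennreal_plus)
  qed
  also have "\<dots> = ennreal (omega (s / t)) * (conv f (2 powr (\<theta> / 2) * s) x + conv f t x)"
    unfolding conv_def by (subst nn_integral_cmult) (auto simp: nn_integral_add)
  finally show ?thesis .
qed


lemma omega_small:
  assumes "0 < \<epsilon>"
  shows "\<exists>\<eta>>0. \<forall>r. 1 \<le> r \<and> r < 1 + \<eta> \<longrightarrow> omega r \<le> \<epsilon>"
proof -
  obtain d where d: "0 < d" "\<And>r. r \<noteq> 1 \<Longrightarrow> norm (r - 1) < d \<Longrightarrow> norm (omega r - 0) < \<epsilon>"
    using LIM_D[OF omega_tendsto assms] by blast
  have "omega r \<le> \<epsilon>" if r: "1 \<le> r" "r < 1 + d" for r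
  proof (cases "r = 1")
    case True
    then show ?thesis using assms by (simp add: omega_def)
  next
    case False
    then show ?thesis using d(2)[of r] r by simp
  qed
  then show ?thesis using d(1) by blast
qed

lemma conv_le_local_ge:
  assumes "0 < \<rho>" "0 < a"
  shows "\<exists>C>0. \<forall>f \<tau> M x. f \<in> borel_measurable borel \<and> a \<le> \<tau> \<and>
     (\<forall>z. (\<integral>\<^sup>+y\<in>ball z \<rho>. ennreal \<bar>f y\<bar> \<partial>lborel) \<le> M) \<longrightarrow> conv f \<tau> x \<le> ennreal C * M"
proof -
  obtain C0 where C0: "0 < C0" and loc: "\<And>f t \<rho> M x. f \<in> borel_measurable borel \<Longrightarrow> 0 < t \<Longrightarrow> 0 < \<rho> \<Longrightarrow>
     (\<And>z. (\<integral>\<^sup>+y\<in>ball z \<rho>. ennreal \<bar>f y\<bar> \<partial>lborel) \<le> M) \<Longrightarrow>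
     conv f t x \<le> ennreal (C0 / (min (t powr (1 / \<theta>)) \<rho>) ^ DIM('a)) * M"
    using conv_le_local by blast
  define C where "C = C0 / (min (a powr (1 / \<theta>)) \<rho>) ^ DIM('a)"
  have pos: "0 < min (a powr (1 / \<theta>)) \<rho>" using assms by simp
  have C: "0 < C" using C0 pos by (simp add: C_def)
  have "conv f \<tau> x \<le> ennreal C * M"
    if f: "f \<in> borel_measurable borel" and \<tau>: "a \<le> \<tau>" and M: "\<And>z. (\<integral>\<^sup>+y\<in>ball z \<rho>. ennreal \<bar>f y\<bar> \<partial>lborel) \<le> M" for f \<tau> M x
  proof -
    have "conv f \<tau> x \<le> ennreal (C0 / (min (\<tau> powr (1 / \<theta>)) \<rho>) ^ DIM('a)) * M"
      using \<tau> assms by (intro loc f M) auto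
    also have "\<dots> \<le> ennreal C * M"
    proof (intro mult_right_mono ennreal_leI)
      have "min (a powr (1 / \<theta>)) \<rho> \<le> min (\<tau> powr (1 / \<theta>)) \<rho>"
        using \<tau> assms theta by (intro min.mono powr_mono2) auto
      then have "(min (a powr (1 / \<theta>)) \<rho>) ^ DIM('a) \<le> (min (\<tau> powr (1 / \<theta>)) \<rho>) ^ DIM('a)"
        using pos by (intro power_mono less_imp_le[OF pos])
      then show "C0 / (min (\<tau> powr (1 / \<theta>)) \<rho>) ^ DIM('a) \<le> C"
        unfolding C_def by (rule frac_le[OF less_imp_le[OF C0] order_refl zero_less_power[OF pos]])
    qed simp
    finally show ?thesis .
  qed
  then show ?thesis using C by blast
qed

lemma two_powr_ge: "0 < \<tau> \<Longrightarrow> \<tau> \<le> 2 powr (\<theta> / 2) * \<tau>"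
  using ge_one_powr_ge_zero[of 2 "\<theta> / 2"] theta mult_right_mono[of 1 "2 powr (\<theta> / 2)" \<tau>] by simp

text \<open>For times at least t0/2 the convolution with |\<phi>| is bounded uniformly in x, so the
  difference is at most \<open>omega (s / t)\<close> times a constant. It is small once s/t is near
  1, and \<delta> is independent of x.\<close>

lemma lin_time_cont:
  assumes [measurable]: "\<phi> \<in> borel_measurable borel" and \<rho>: "0 < \<rho>" and K: "0 \<le> K"
    and \<phi>: "\<And>z. (\<integral>\<^sup>+y\<in>ball z \<rho>. ennreal \<bar>\<phi> y\<bar> \<partial>lborel) \<le> ennreal K" and t0: "0 < t0" and \<epsilon>: "0 < \<epsilon>"
  shows "\<exists>\<delta>>0. \<forall>t s x. t0 - \<delta> < t \<and> t \<le> s \<and> s < t0 + \<delta> \<longrightarrow> \<bar>lin \<phi> x s - lin \<phi> x t\<bar> \<le> \<epsilon>"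
proof -
  obtain C where C: "0 < C" and loc: "\<And>f \<tau> M x. f \<in> borel_measurable borel \<Longrightarrow> t0 / 2 \<le> \<tau> \<Longrightarrow>
     (\<And>z. (\<integral>\<^sup>+y\<in>ball z \<rho>. ennreal \<bar>f y\<bar> \<partial>lborel) \<le> M) \<Longrightarrow> conv f \<tau> x \<le> ennreal C * M"
    using conv_le_local_ge[OF \<rho>, of "t0 / 2"] t0 by auto
  define B where "B = C * K"
  have B: "0 \<le> B" using C K by (simp add: B_def)
  have cB: "conv \<phi> \<tau> x \<le> ennreal B" if "t0 / 2 \<le> \<tau>" for \<tau> x
    using loc[OF _ that \<phi>, of x] C K by (simp add: B_def ennreal_mult)
  obtain \<eta> where \<eta>: "0 < \<eta>" "\<And>r. 1 \<le> r \<Longrightarrow> r < 1 + \<eta> \<Longrightarrow> omega r \<le> \<epsilon> / (2 * B + 1)"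
    using omega_small[of "\<epsilon> / (2 * B + 1)"] \<epsilon> B by auto
  \<comment> \<open>The first term keeps t above t0/2; the second gives s - t < 2 \<delta> \<le>
    \<eta> t0/2 \<le> \<eta> t, hence s/t < 1 + \<eta>.\<close>
  define \<delta> where "\<delta> = min (t0 / 2) (\<eta> * t0 / 4)"
  have \<delta>: "0 < \<delta>" "\<delta> \<le> t0 / 2" "\<delta> \<le> \<eta> * t0 / 4" using t0 \<eta> by (auto simp: \<delta>_def)
  have "\<bar>lin \<phi> x s - lin \<phi> x t\<bar> \<le> \<epsilon>" if ts: "t0 - \<delta> < t" "t \<le> s" "s < t0 + \<delta>" for t s x
  proof -
    have t: "t0 / 2 < t" "0 < t" using ts \<delta> t0 by auto
    have s: "0 < s" "t0 / 2 \<le> s" using t ts by auto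
    have r: "1 \<le> s / t" "s / t < 1 + \<eta>"
    proof -
      show "1 \<le> s / t" using t ts by simp
      have "s - t < 2 * \<delta>" using ts by linarith
      also have "\<dots> \<le> \<eta> * (t0 / 2)" using \<delta> by simp
      also have "\<dots> \<le> \<eta> * t" using t \<eta> by (intro mult_left_mono) auto
      finally show "s / t < 1 + \<eta>" using t by (simp add: field_simps)
    qed
    have cs: "t0 / 2 \<le> 2 powr (\<theta> / 2) * s" using s two_powr_ge[OF s(1)] by linarith
    have fin: "conv \<phi> s x < \<infinity>" "conv \<phi> t x < \<infinity>" using cB[of s x] cB[of t x] t s by (auto intro: le_less_trans)
    have i: "integrable lborel (\<lambda>y. G (x - y) s * \<phi> y)" "integrable lborel (\<lambda>y. G (x - y) t * \<phi> y)"
      using fin t s by (auto intro!: integrable_lin)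
    have "lin \<phi> x s - lin \<phi> x t = (\<integral>y. G (x - y) s * \<phi> y - G (x - y) t * \<phi> y \<partial>lborel)"
      unfolding lin_def by (rule Bochner_Integration.integral_diff[OF i, symmetric])
    then have "ennreal \<bar>lin \<phi> x s - lin \<phi> x t\<bar> \<le> (\<integral>\<^sup>+y. ennreal (norm (G (x - y) s * \<phi> y - G (x - y) t * \<phi> y)) \<partial>lborel)"
      using integral_norm_bound_ennreal[OF Bochner_Integration.integrable_diff[OF i]] by simp
    also have "\<dots> = (\<integral>\<^sup>+y. ennreal (\<bar>G (x - y) s - G (x - y) t\<bar> * \<bar>\<phi> y\<bar>) \<partial>lborel)"
      by (simp add: abs_mult[symmetric] left_diff_distrib)
    also have "\<dots> \<le> ennreal (omega (s / t)) * (conv \<phi> (2 powr (\<theta> / 2) * s) x + conv \<phi> t x)"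
      by (rule nn_integral_G_diff) (use t ts in auto)
    also have "\<dots> \<le> ennreal (\<epsilon> / (2 * B + 1)) * (ennreal B + ennreal B)"
      using \<eta>(2)[OF r] t cs by (intro mult_mono add_mono cB ennreal_leI) auto
    also have "\<dots> = ennreal (\<epsilon> / (2 * B + 1) * (2 * B))"
      using \<epsilon> B by (simp add: ennreal_mult[symmetric] ennreal_plus[symmetric] del: ennreal_plus)
    also have "\<dots> \<le> ennreal \<epsilon>"
      using \<epsilon> B by (intro ennreal_leI) (simp add: field_simps)
    finally show ?thesis using \<epsilon> by (simp add: ennreal_le_iff)
  qed
  then show ?thesis using \<delta>(1) by blast
qed

text \<open>The kernel is singular where the source time reaches t, so the last stretch of length
  \<eta> before t is separated. There the sup bound of the source and the shortness of the stretch
  suffice; at earlier source times both t - s and t' - s are at least \<eta>, and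
  \<open>omega\<close> applies. All bounds are uniform in x.\<close>

lemma dint_time_cont:
  assumes f[measurable]: "case_prod f \<in> borel_measurable (borel \<Otimes>\<^sub>M borel)" and src: "source_bound T \<rho> M f"
    and M: "0 \<le> M" and \<rho>: "0 < \<rho>" and t0: "0 < t0" "t0 < T" and TS: "T \<le> S" and \<epsilon>: "0 < \<epsilon>"
    and fin: "\<And>t x. 0 < t \<Longrightarrow> t < T \<Longrightarrow> duh f x t < \<infinity>"
  shows "\<exists>\<delta>>0. \<forall>t s x. t0 - \<delta> < t \<and> t \<le> s \<and> s < t0 + \<delta> \<and> s < T \<longrightarrow> \<bar>dint f x s - dint f x t\<bar> \<le> \<epsilon>"
proof -
  let ?m = "\<lambda>s. s powr (- 1) * Lg s powr (- N - 1)"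
  define A where "A = 2 * (M * (t0 / 4) powr (- N - 1)) + 1"
  have A: "0 < A" using M by (simp add: A_def add_nonneg_pos)
  \<comment> \<open>A bounds both Duhamel integrands near the end, and the time interval there is
    shorter than 2 \<eta>, so this part costs at most \<epsilon>/2.\<close>
  define \<eta> where "\<eta> = min (t0 / 4) (\<epsilon> / (4 * A))"
  have \<eta>: "0 < \<eta>" "\<eta> \<le> t0 / 4" "A * (2 * \<eta>) \<le> \<epsilon> / 2"
  proof -
    show "0 < \<eta>" "\<eta> \<le> t0 / 4" using t0 \<epsilon> A by (auto simp: \<eta>_def)
    have "\<eta> \<le> \<epsilon> / (4 * A)" by (simp add: \<eta>_def)
    then show "A * (2 * \<eta>) \<le> \<epsilon> / 2" using A by (simp add: field_simps)
  qed
  obtain C where C: "0 < C" and loc: "\<And>f \<tau> M x. f \<in> borel_measurable borel \<Longrightarrow> \<eta> \<le> \<tau> \<Longrightarrow>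
     (\<And>z. (\<integral>\<^sup>+y\<in>ball z \<rho>. ennreal \<bar>f y\<bar> \<partial>lborel) \<le> M) \<Longrightarrow> conv f \<tau> x \<le> ennreal C * M"
    using conv_le_local_ge[OF \<rho> \<eta>(1)] by auto
  define c where "c = (exp 1 * S + 1) / N"
  have c: "0 < c" using t0 TS N_pos by (simp add: c_def add_pos_nonneg)
  define B where "B = 2 * (C * M) * c + 1"
  have B: "0 < B" using C M c by (simp add: B_def add_nonneg_pos)
  obtain \<eta>' where \<eta>': "0 < \<eta>'" "\<And>r. 1 \<le> r \<Longrightarrow> r < 1 + \<eta>' \<Longrightarrow> omega r \<le> \<epsilon> / (2 * B)"
    using omega_small[of "\<epsilon> / (2 * B)"] \<epsilon> B by auto
  \<comment> \<open>The condition 2 \<delta> \<le> \<eta> \<eta>' gives (t' - s)/(t - s) < 1 +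
    \<eta>' as soon as t - s \<ge> \<eta>, and 2 \<delta> \<le> \<eta> bounds the length of
    [t - \<eta>, t'] by 2 \<eta>. With \<eta> \<le> t0/4, the bound \<delta> \<le> t0/2 keeps the
    end stretch above t0/4.\<close>
  define \<delta> where "\<delta> = min (min (t0 / 2) (\<eta> / 2)) (\<eta> * \<eta>' / 2)"
  have \<delta>: "0 < \<delta>" "\<delta> \<le> t0 / 2" "2 * \<delta> \<le> \<eta>" "2 * \<delta> \<le> \<eta> * \<eta>'" using t0 \<eta> \<eta>' by (auto simp: \<delta>_def)
  have "\<bar>dint f x t' - dint f x t\<bar> \<le> \<epsilon>" if ts: "t0 - \<delta> < t" "t \<le> t'" "t' < t0 + \<delta>" "t' < T" for t t' x
  proof -
    have t: "t0 / 2 < t" "0 < t" "0 < t'" "t < T" using ts \<delta> t0 by auto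
    have tt: "t' - t < 2 * \<delta>" using ts by linarith
    define w where "w = \<epsilon> / (2 * B)"
    have w: "0 < w" using \<epsilon> B by (simp add: w_def)
    define J where "J s = (\<integral>\<^sup>+y. ennreal (norm (dint_integrand f x t' (y, s) - dint_integrand f x t (y, s))) \<partial>lborel)" for s
    have J: "J s \<le> ennreal (w * (2 * (C * M))) * (ennreal (?m s) * indicator {0<..<t} s) + ennreal A * indicator {t - \<eta>..t'} s" for s
    proof -
      have fs[measurable]: "(\<lambda>y. f y s) \<in> borel_measurable borel" by measurable
      consider "s \<le> 0 \<or> t' \<le> s" | "0 < s" "s < t - \<eta>" | "0 < s" "t - \<eta> \<le> s" "s < t'" by linarith
      then show ?thesis
      proof cases
        case 1
        then have "dint_integrand f x t' (y, s) = 0" "dint_integrand f x t (y, s) = 0" for y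
          using ts by (auto simp: dint_integrand_def)
        then show ?thesis by (simp add: J_def)
      next
        case 2
        then have s: "0 < s" "s < t" "s < t'" "s < T" "\<eta> \<le> t - s" "\<eta> \<le> t' - s" using \<eta> ts t by auto
        have loc': "conv (\<lambda>y. f y s) \<tau> x \<le> ennreal (C * M * ?m s)" if "\<eta> \<le> \<tau>" for \<tau>
        proof -
          have "conv (\<lambda>y. f y s) \<tau> x \<le> ennreal C * ennreal (M * ?m s)"
            using src s by (intro loc fs that) (auto simp: source_bound_def)
          also have "\<dots> = ennreal (C * M * ?m s)" using C M by (simp add: ennreal_mult[symmetric] mult.assoc)
          finally show ?thesis .
        qed
        have r: "1 \<le> (t' - s) / (t - s)" "(t' - s) / (t - s) < 1 + \<eta>'"
        proof -
          show "1 \<le> (t' - s) / (t - s)" using s ts by simp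
          have "t' - t < \<eta> * \<eta>'" using tt \<delta> by simp
          also have "\<dots> \<le> (t - s) * \<eta>'" using s \<eta>' by (intro mult_right_mono) auto
          finally show "(t' - s) / (t - s) < 1 + \<eta>'" using s by (simp add: field_simps)
        qed
        have cs: "\<eta> \<le> 2 powr (\<theta> / 2) * (t' - s)" using s two_powr_ge[of "t' - s"] by linarith
        have "J s = (\<integral>\<^sup>+y. ennreal (\<bar>G (x - y) (t' - s) - G (x - y) (t - s)\<bar> * \<bar>f y s\<bar>) \<partial>lborel)"
          unfolding J_def using s by (simp add: dint_integrand_def abs_mult[symmetric] left_diff_distrib)
        also have "\<dots> \<le> ennreal (omega ((t' - s) / (t - s))) * (conv (\<lambda>y. f y s) (2 powr (\<theta> / 2) * (t' - s)) x + conv (\<lambda>y. f y s) (t - s) x)"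
          by (rule nn_integral_G_diff) (use s ts in auto)
        also have "\<dots> \<le> ennreal w * (ennreal (C * M * ?m s) + ennreal (C * M * ?m s))"
          using \<eta>'(2)[OF r] s cs
          by (intro mult_mono add_mono loc' ennreal_leI) (auto simp: w_def)
        also have "\<dots> = ennreal (w * (2 * (C * M))) * ennreal (?m s)"
          using w C M by (simp add: ennreal_mult[symmetric] ennreal_plus[symmetric] mult_ac del: ennreal_plus)
        finally show ?thesis using s by (simp add: add_increasing2)
      next
        case 3
        have s: "t0 / 4 \<le> s" "s < T" using 3 \<eta> t ts by auto
        have sup: "conv (\<lambda>y. f y s) \<tau> x \<le> ennreal (M * (t0 / 4) powr (- N - 1))" if "0 < \<tau>" for \<tau>
        proof (rule conv_le_sup[OF fs that])
          fix y
          have "\<bar>f y s\<bar> \<le> M * (s powr (- N - 1) * Lg s powr (- N - 1))" using src 3 s by (auto simp: source_bound_def)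
          also have "\<dots> \<le> M * ((t0 / 4) powr (- N - 1) * 1)"
            using s t0 N_pos M 3 Lg_powr_le_1[of s "N + 1"] by (intro mult_left_mono mult_mono powr_mono2') auto
          finally show "\<bar>f y s\<bar> \<le> M * (t0 / 4) powr (- N - 1)" by simp
        qed
        have "J s \<le> (\<integral>\<^sup>+y. ennreal (norm (dint_integrand f x t' (y, s))) + ennreal (norm (dint_integrand f x t (y, s))) \<partial>lborel)"
          unfolding J_def
          by (intro nn_integral_mono) (simp add: ennreal_plus[symmetric] ennreal_leI abs_triangle_ineq4 del: ennreal_plus)
        also have "\<dots> = (\<integral>\<^sup>+y. ennreal (norm (dint_integrand f x t' (y, s))) \<partial>lborel) + (\<integral>\<^sup>+y. ennreal (norm (dint_integrand f x t (y, s))) \<partial>lborel)"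
          by (rule nn_integral_add) measurable
        also have "\<dots> \<le> ennreal (M * (t0 / 4) powr (- N - 1)) + ennreal (M * (t0 / 4) powr (- N - 1))"
        proof -
          have "(\<integral>\<^sup>+y. ennreal (norm (dint_integrand f x \<tau> (y, s))) \<partial>lborel) \<le> ennreal (M * (t0 / 4) powr (- N - 1))" for \<tau>
          proof (cases "s < \<tau>")
            case True
            then have "(\<integral>\<^sup>+y. ennreal (norm (dint_integrand f x \<tau> (y, s))) \<partial>lborel) = conv (\<lambda>y. f y s) (\<tau> - s) x"
              using 3 G_nonneg[of "\<tau> - s"] by (simp add: dint_integrand_def conv_def abs_mult)
            then show ?thesis using sup[of "\<tau> - s"] True by simp
          qed (simp add: dint_integrand_def)
          then show ?thesis by (intro add_mono) auto
        qed
        also have "\<dots> \<le> ennreal A"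
          using M by (simp add: ennreal_plus[symmetric] A_def ennreal_leI del: ennreal_plus)
        finally show ?thesis using 3 by (simp add: add_increasing)
      qed
    qed
    have i: "integrable (lborel \<Otimes>\<^sub>M lborel) (dint_integrand f x t')" "integrable (lborel \<Otimes>\<^sub>M lborel) (dint_integrand f x t)"
      using fin t ts by (auto intro!: integrable_dint f)
    have "dint f x t' - dint f x t = (\<integral>z. dint_integrand f x t' z - dint_integrand f x t z \<partial>(lborel \<Otimes>\<^sub>M lborel))"
      unfolding dint_def by (rule Bochner_Integration.integral_diff[OF i, symmetric])
    then have "ennreal \<bar>dint f x t' - dint f x t\<bar> \<le> (\<integral>\<^sup>+z. ennreal (norm (dint_integrand f x t' z - dint_integrand f x t z)) \<partial>(lborel \<Otimes>\<^sub>M lborel))"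
      using integral_norm_bound_ennreal[OF Bochner_Integration.integrable_diff[OF i]] by simp
    also have "\<dots> = (\<integral>\<^sup>+s. J s \<partial>lborel)"
      unfolding J_def by (rule lborel_pair.nn_integral_snd[symmetric]) measurable
    also have "\<dots> \<le> (\<integral>\<^sup>+s. ennreal (w * (2 * (C * M))) * (ennreal (?m s) * indicator {0<..<t} s) + ennreal A * indicator {t - \<eta>..t'} s \<partial>lborel)"
      by (intro nn_integral_mono J)
    also have "\<dots> = ennreal (w * (2 * (C * M))) * (\<integral>\<^sup>+s\<in>{0<..<t}. ennreal (?m s) \<partial>lborel) + ennreal A * ennreal (t' - (t - \<eta>))"
      using \<eta> ts by (subst nn_integral_add) (auto simp: nn_integral_cmult nn_integral_cmult_indicator)
    also have "\<dots> \<le> ennreal (w * (2 * (C * M))) * ennreal (c * 1) + ennreal A * ennreal (2 * \<eta>)"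
    proof (intro add_mono mult_left_mono)
      have "(\<integral>\<^sup>+s\<in>{0<..<t}. ennreal (?m s) \<partial>lborel) \<le> ennreal (c * Lg t powr (- N))"
        unfolding c_def using t TS by (intro nn_integral_Lg N_pos) auto
      also have "\<dots> \<le> ennreal (c * 1)"
        using c t N_pos by (intro ennreal_leI mult_left_mono Lg_powr_le_1) auto
      finally show "(\<integral>\<^sup>+s\<in>{0<..<t}. ennreal (?m s) \<partial>lborel) \<le> ennreal (c * 1)" .
      show "ennreal (t' - (t - \<eta>)) \<le> ennreal (2 * \<eta>)" using tt \<delta> by (intro ennreal_leI) auto
    qed auto
    also have "\<dots> = ennreal (w * (2 * (C * M) * c) + A * (2 * \<eta>))"
      using w C M c A \<eta> by (simp add: ennreal_mult[symmetric] ennreal_plus[symmetric] mult.assoc del: ennreal_plus)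
    also have "\<dots> \<le> ennreal \<epsilon>"
    proof (rule ennreal_leI)
      have "w * (2 * (C * M) * c) \<le> w * B" using w by (intro mult_left_mono) (auto simp: B_def)
      also have "\<dots> = \<epsilon> / 2" using B by (simp add: w_def)
      finally show "w * (2 * (C * M) * c) + A * (2 * \<eta>) \<le> \<epsilon>" using \<eta>(3) by linarith
    qed
    finally show ?thesis using \<epsilon> by (simp add: ennreal_le_iff)
  qed
  then show ?thesis using \<delta>(1) by blast
qed

text \<open>The mass on a set of measure \<sigma> is bounded by L(\<sigma>)^(-N) and also by
  L(t)^(-N), up to constants. Multiplied by L(\<sigma>)^\<gamma>, the smaller of the two is at most
  L(t)^(-(N-\<gamma>)) whichever of the logarithms is larger; this is where \<gamma> < N is needed
  for a limit 0.\<close>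

lemma dint_ul_norm_small:
  assumes f[measurable]: "case_prod f \<in> borel_measurable (borel \<Otimes>\<^sub>M borel)" and src: "source_bound T \<rho> M f"
    and M: "0 \<le> M" and \<rho>: "0 < \<rho>" and S: "0 < S" "T \<le> S" and \<gamma>: "0 \<le> \<gamma>" "\<gamma> < N"
  shows "\<exists>C\<ge>0. \<forall>t. 0 < t \<and> t < T \<longrightarrow> ul_norm 1 \<gamma> (\<lambda>x. dint f x t) \<le> ennreal (C * Lg t powr (- (N - \<gamma>)))"
proof -
  obtain m where m: "0 < m" and cover0: "\<forall>(z::'a) E g M. g \<in> borel_measurable borel \<and> E \<in> sets borel \<and>
     (\<forall>z'. (\<integral>\<^sup>+x\<in>E \<inter> ball z' \<rho>. g x \<partial>lborel) \<le> M) \<longrightarrow> (\<integral>\<^sup>+x\<in>E \<inter> ball z 1. g x \<partial>lborel) \<le> ennreal m * M"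
    using ball_covering[OF \<rho>, of 1, where 'a='a] by (elim exE conjE) (rule that)
  note cover = cover0[rule_format, OF conjI[OF _ conjI[OF _ allI]]]
  obtain C1 where C1: "0 < C1" and lb: "\<And>T \<rho> M f t z E \<sigma>. case_prod f \<in> borel_measurable (borel \<Otimes>\<^sub>M borel) \<Longrightarrow>
     source_bound T \<rho> M f \<Longrightarrow> 0 < t \<Longrightarrow> t < T \<Longrightarrow> T \<le> S \<Longrightarrow> 0 \<le> M \<Longrightarrow> E \<in> sets borel \<Longrightarrow> 0 < \<sigma> \<Longrightarrow>
     emeasure lborel E = ennreal \<sigma> \<Longrightarrow> (\<integral>\<^sup>+x\<in>E \<inter> ball z \<rho>. duh f x t \<partial>lborel) \<le> ennreal (C1 * M * Lg \<sigma> powr (- N))"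
    using duh_log_bound[OF S(1)] by blast
  define c where "c = (exp 1 * S + 1) / N"
  have c: "0 < c" using S N_pos by (simp add: c_def add_pos_nonneg)
  define C where "C = m * ((C1 + c) * M)"
  have C: "0 \<le> C" using m C1 c M by (simp add: C_def)
  have "ul_norm 1 \<gamma> (\<lambda>x. dint f x t) \<le> ennreal (C * Lg t powr (- (N - \<gamma>)))" if t: "0 < t" "t < T" for t
    unfolding ul_norm_def
  proof (rule triple_norm_leI)
    fix z :: 'a and E :: "'a set" and \<sigma> :: real
    assume E[measurable]: "E \<in> sets borel" and \<sigma>: "emeasure lborel E = ennreal \<sigma>" "0 < \<sigma>"
    define b where "b = min (Lg \<sigma> powr (- N)) (Lg t powr (- N))"
    have b: "0 \<le> b" by (simp add: b_def)
    have "(\<integral>\<^sup>+x\<in>E \<inter> ball z 1. ennreal \<bar>dint f x t\<bar> \<partial>lborel) \<le> ennreal m * ennreal ((C1 + c) * M * b)"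
    proof (rule cover)
      fix z' :: 'a
      have "(\<integral>\<^sup>+x\<in>E \<inter> ball z' \<rho>. ennreal \<bar>dint f x t\<bar> \<partial>lborel) \<le> (\<integral>\<^sup>+x\<in>E \<inter> ball z' \<rho>. duh f x t \<partial>lborel)"
        by (intro nn_integral_mono mult_right_mono abs_dint_le f) auto
      moreover have "(\<integral>\<^sup>+x\<in>E \<inter> ball z' \<rho>. duh f x t \<partial>lborel) \<le> ennreal (C1 * M * Lg \<sigma> powr (- N))"
        by (rule lb[OF f src t S(2) M E \<sigma>(2,1)])
      moreover have "(\<integral>\<^sup>+x\<in>E \<inter> ball z' \<rho>. duh f x t \<partial>lborel) \<le> ennreal (c * M * Lg t powr (- N))"
        unfolding c_def by (rule duh_mass[OF f E src t S(2) M])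
      moreover have "C1 * M * Lg \<sigma> powr (- N) \<le> (C1 + c) * M * Lg \<sigma> powr (- N)"
          "c * M * Lg t powr (- N) \<le> (C1 + c) * M * Lg t powr (- N)"
        using C1 c M by (auto intro!: mult_right_mono)
      ultimately show "(\<integral>\<^sup>+x\<in>E \<inter> ball z' \<rho>. ennreal \<bar>dint f x t\<bar> \<partial>lborel) \<le> ennreal ((C1 + c) * M * b)"
        unfolding b_def min_def by (auto intro: order_trans ennreal_leI)
    qed measurable
    then have "ennreal (Lg \<sigma> powr \<gamma>) * (\<integral>\<^sup>+x\<in>E \<inter> ball z 1. ennreal \<bar>dint f x t\<bar> \<partial>lborel)
        \<le> ennreal (Lg \<sigma> powr \<gamma>) * (ennreal m * ennreal ((C1 + c) * M * b))"
      by (intro mult_left_mono) auto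
    also have "\<dots> = ennreal (C * (Lg \<sigma> powr \<gamma> * b))"
      using m C1 c M b by (simp add: ennreal_mult[symmetric] C_def mult_ac)
    also have "\<dots> \<le> ennreal (C * Lg t powr (- (N - \<gamma>)))"
    proof (intro ennreal_leI mult_left_mono C)
      show "Lg \<sigma> powr \<gamma> * b \<le> Lg t powr (- (N - \<gamma>))"
      proof (cases "Lg \<sigma> \<le> Lg t")
        case True
        have "Lg \<sigma> powr \<gamma> * b \<le> Lg t powr \<gamma> * Lg t powr (- N)"
          using True \<gamma> Lg_pos[OF \<sigma>(2)] b by (intro mult_mono powr_mono2) (auto simp: b_def)
        then show ?thesis by (simp flip: powr_add)
      next
        case False
        have "Lg \<sigma> powr \<gamma> * b \<le> Lg \<sigma> powr \<gamma> * Lg \<sigma> powr (- N)"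
          by (intro mult_left_mono) (auto simp: b_def)
        also have "\<dots> = Lg \<sigma> powr (- (N - \<gamma>))" by (simp flip: powr_add)
        also have "\<dots> \<le> Lg t powr (- (N - \<gamma>))"
          using False \<gamma> Lg_pos[OF t(1)] by (intro powr_mono2') auto
        finally show ?thesis .
      qed
    qed
    finally show "ennreal (Lg \<sigma> powr \<gamma>) * (\<integral>\<^sup>+x\<in>E \<inter> ball z 1. ennreal \<bar>dint f x t\<bar> \<partial>lborel) \<le> ennreal (C * Lg t powr (- (N - \<gamma>)))" .
  qed
  then show ?thesis using C by blast
qed

lemma dint_local_mass_small:
  assumes f[measurable]: "case_prod f \<in> borel_measurable (borel \<Otimes>\<^sub>M borel)" and src: "source_bound T \<rho> M f"
    and M: "0 \<le> M" and \<rho>: "0 < \<rho>" and S: "0 < S" "T \<le> S"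
  shows "\<exists>C\<ge>0. \<forall>t. 0 < t \<and> t < T \<longrightarrow> (\<integral>\<^sup>+x\<in>ball z R. ennreal \<bar>dint f x t\<bar> \<partial>lborel) \<le> ennreal (C * Lg t powr (- N))"
proof -
  obtain m where m: "0 < m" and cover0: "\<forall>(z::'a) E g M. g \<in> borel_measurable borel \<and> E \<in> sets borel \<and>
     (\<forall>z'. (\<integral>\<^sup>+x\<in>E \<inter> ball z' \<rho>. g x \<partial>lborel) \<le> M) \<longrightarrow> (\<integral>\<^sup>+x\<in>E \<inter> ball z R. g x \<partial>lborel) \<le> ennreal m * M"
    using ball_covering[OF \<rho>, of R, where 'a='a] by (elim exE conjE) (rule that)
  note cover = cover0[rule_format, OF conjI[OF _ conjI[OF _ allI]]]
  define c where "c = (exp 1 * S + 1) / N"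
  have c: "0 < c" using S N_pos by (simp add: c_def add_pos_nonneg)
  have "(\<integral>\<^sup>+x\<in>ball z R. ennreal \<bar>dint f x t\<bar> \<partial>lborel) \<le> ennreal (m * (c * M) * Lg t powr (- N))" if t: "0 < t" "t < T" for t
  proof -
    have "(\<integral>\<^sup>+x\<in>UNIV \<inter> ball z R. ennreal \<bar>dint f x t\<bar> \<partial>lborel) \<le> ennreal m * ennreal (c * M * Lg t powr (- N))"
    proof (rule cover)
      fix z' :: 'a
      have "(\<integral>\<^sup>+x\<in>UNIV \<inter> ball z' \<rho>. ennreal \<bar>dint f x t\<bar> \<partial>lborel) \<le> (\<integral>\<^sup>+x\<in>UNIV \<inter> ball z' \<rho>. duh f x t \<partial>lborel)"
        by (intro nn_integral_mono mult_right_mono abs_dint_le f) auto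
      also have "\<dots> \<le> ennreal (c * M * Lg t powr (- N))"
        unfolding c_def by (rule duh_mass[OF f _ src t S(2) M]) simp
      finally show "(\<integral>\<^sup>+x\<in>UNIV \<inter> ball z' \<rho>. ennreal \<bar>dint f x t\<bar> \<partial>lborel) \<le> ennreal (c * M * Lg t powr (- N))" .
    qed measurable
    also have "\<dots> = ennreal (m * (c * M) * Lg t powr (- N))"
      using m c M by (simp add: ennreal_mult[symmetric] mult.assoc)
    finally show ?thesis by simp
  qed
  then show ?thesis using m c M by (intro exI[of _ "m * (c * M)"]) auto
qed

end

section \<open>The initial trace\<close>

context critical_exponent
begin

lemma integral_lin_eq:
  assumes [measurable]: "\<phi> \<in> borel_measurable borel" and t: "0 < t" and fin: "conv \<phi> t x < \<infinity>"
  shows "lin \<phi> x t = (\<integral>w. G w t * \<phi> (x - w) \<partial>lborel)"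
  using integral_lborel_affine[OF integrable_lin[OF assms], of "-1" x] by (simp add: lin_def)

text \<open>With H(w) the integral of \<psi>(x+w) \<phi>(x), the pairing equals the integral of
  G(w,1) H(t^(1/\<theta>) w). H is bounded, since a shifted test function sees only a ball of radius
  R on which the mass of \<phi> is bounded uniformly in the centre, and it tends to H(0) along
  shrinking shifts. Dominated convergence against a fixed probability density concludes without any
  decay of S(t) \<psi>.\<close>

lemma lin_tendsto_distr:
  assumes [measurable]: "\<phi> \<in> borel_measurable borel" and \<rho>: "0 < \<rho>" and K: "0 \<le> K"
    and \<phi>: "\<And>z. (\<integral>\<^sup>+y\<in>ball z \<rho>. ennreal \<bar>\<phi> y\<bar> \<partial>lborel) \<le> ennreal K"
    and \<psi>: "continuous_on UNIV \<psi>" and B: "\<And>x. \<bar>\<psi> x\<bar> \<le> B" and supp: "\<And>x. R \<le> norm x \<Longrightarrow> \<psi> x = 0"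
  shows "((\<lambda>t. \<integral>x. lin \<phi> x t * \<psi> x \<partial>lborel) \<longlongrightarrow> (\<integral>x. \<phi> x * \<psi> x \<partial>lborel)) (at_right 0)"
proof -
  have [measurable]: "\<psi> \<in> borel_measurable borel" by (rule borel_measurable_continuous_onI[OF \<psi>])
  have B0: "0 \<le> B" using B[of 0] by linarith
  have mass: "\<exists>m>0. \<forall>z. (\<integral>\<^sup>+x\<in>ball z r. ennreal \<bar>\<phi> x\<bar> \<partial>lborel) \<le> ennreal m" for r
  proof -
    obtain m where m: "0 < m" and cover0: "\<forall>(z::'a) E g M. g \<in> borel_measurable borel \<and> E \<in> sets borel \<and>
       (\<forall>z'. (\<integral>\<^sup>+x\<in>E \<inter> ball z' \<rho>. g x \<partial>lborel) \<le> M) \<longrightarrow> (\<integral>\<^sup>+x\<in>E \<inter> ball z r. g x \<partial>lborel) \<le> ennreal m * M"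
      using ball_covering[OF \<rho>, of r, where 'a='a] by (elim exE conjE) (rule that)
    have "(\<integral>\<^sup>+x\<in>ball z r. ennreal \<bar>\<phi> x\<bar> \<partial>lborel) \<le> ennreal (m * K + 1)" for z
    proof -
      have "(\<integral>\<^sup>+x\<in>UNIV \<inter> ball z r. ennreal \<bar>\<phi> x\<bar> \<partial>lborel) \<le> ennreal m * ennreal K"
        using \<phi> by (intro cover0[rule_format]) auto
      also have "\<dots> = ennreal (m * K)" using m K by (simp add: ennreal_mult)
      also have "\<dots> \<le> ennreal (m * K + 1)" by (intro ennreal_leI) simp
      finally show ?thesis by simp
    qed
    moreover have "0 < m * K + 1" using m K by (simp add: add_nonneg_pos)
    ultimately show ?thesis by blast
  qed
  have intball: "integrable lborel (\<lambda>x. indicator (ball z r) x * \<bar>\<phi> x\<bar>)" for z r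
  proof -
    obtain m where "(\<integral>\<^sup>+x\<in>ball z r. ennreal \<bar>\<phi> x\<bar> \<partial>lborel) \<le> ennreal m" using mass[of r] by blast
    moreover have "(\<integral>\<^sup>+x. ennreal (norm (indicator (ball z r) x * \<bar>\<phi> x\<bar>)) \<partial>lborel) = (\<integral>\<^sup>+x\<in>ball z r. ennreal \<bar>\<phi> x\<bar> \<partial>lborel)"
      by (intro nn_integral_cong) (auto simp: indicator_def)
    ultimately show ?thesis by (auto simp: integrable_iff_bounded intro: le_less_trans)
  qed
  \<comment> \<open>A majorant that depends on w through |w| alone, so the same function dominates
    all the shrunken shifts used below.\<close>
  have dom: "\<bar>\<psi> (x + w) * \<phi> x\<bar> \<le> B * (indicator (ball 0 (R + norm w)) x * \<bar>\<phi> x\<bar>)" for x w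
  proof (cases "norm (x + w) < R")
    case True
    then have "norm x < R + norm w" using norm_triangle_ineq4[of "x + w" w] by simp
    then show ?thesis using B[of "x + w"] by (simp add: abs_mult mult_right_mono)
  next
    case False
    then show ?thesis using supp[of "x + w"] B0 by simp
  qed
  define H where "H w = (\<integral>x. \<psi> (x + w) * \<phi> x \<partial>lborel)" for w
  have [measurable]: "H \<in> borel_measurable borel" unfolding H_def by measurable
  have Hint: "integrable lborel (\<lambda>x. \<psi> (x + w) * \<phi> x)" for w
    by (rule Bochner_Integration.integrable_bound[OF integrable_mult_right[OF intball[of 0 "R + norm w"], of B]])
       (use dom B0 in \<open>auto simp: abs_mult\<close>)
  obtain m where m: "0 < m" and massR: "\<And>z. (\<integral>\<^sup>+x\<in>ball z R. ennreal \<bar>\<phi> x\<bar> \<partial>lborel) \<le> ennreal m"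
    using mass[of R] by blast
  have Hbound: "\<bar>H w\<bar> \<le> B * m" for w
  proof -
    have "ennreal \<bar>H w\<bar> \<le> (\<integral>\<^sup>+x. ennreal (norm (\<psi> (x + w) * \<phi> x)) \<partial>lborel)"
      using integral_norm_bound_ennreal[OF Hint[of w]] by (simp add: H_def)
    also have "\<dots> \<le> (\<integral>\<^sup>+x. ennreal B * (ennreal \<bar>\<phi> x\<bar> * indicator (ball (- w) R) x) \<partial>lborel)"
    proof (rule nn_integral_mono)
      fix x
      show "ennreal (norm (\<psi> (x + w) * \<phi> x)) \<le> ennreal B * (ennreal \<bar>\<phi> x\<bar> * indicator (ball (- w) R) x)"
      proof (cases "norm (x + w) < R")
        case True
        then have "x \<in> ball (- w) R" by (simp add: dist_norm norm_minus_commute)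
        then show ?thesis using B[of "x + w"] B0
          by (simp add: ennreal_mult[symmetric] abs_mult ennreal_leI mult_right_mono)
      qed (use supp in simp)
    qed
    also have "\<dots> = ennreal B * (\<integral>\<^sup>+x\<in>ball (- w) R. ennreal \<bar>\<phi> x\<bar> \<partial>lborel)" by (rule nn_integral_cmult) measurable
    also have "\<dots> \<le> ennreal B * ennreal m" by (intro mult_left_mono massR) auto
    also have "\<dots> = ennreal (B * m)" using B0 m by (simp add: ennreal_mult)
    finally show ?thesis using B0 m by (subst (asm) ennreal_le_iff) auto
  qed
  have eq: "(\<integral>x. lin \<phi> x t * \<psi> x \<partial>lborel) = (\<integral>w. G w 1 * H (t powr (1 / \<theta>) *\<^sub>R w) \<partial>lborel)" if t: "0 < t" for t
  proof -
    obtain C where C: "0 < C" and loc: "\<And>f \<tau> M x. f \<in> borel_measurable borel \<Longrightarrow> t \<le> \<tau> \<Longrightarrow>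
       (\<And>z. (\<integral>\<^sup>+y\<in>ball z \<rho>. ennreal \<bar>f y\<bar> \<partial>lborel) \<le> M) \<Longrightarrow> conv f \<tau> x \<le> ennreal C * M"
      using conv_le_local_ge[OF \<rho> t] by auto
    have cb: "conv \<phi> t x \<le> ennreal (C * K)" for x
      using loc[OF _ order_refl \<phi>, of x] C K by (simp add: ennreal_mult)
    have fin: "conv \<phi> t x < \<infinity>" for x using cb[of x] by (auto intro: le_less_trans)
    define F where "F x w = \<psi> x * (G w t * \<phi> (x - w))" for x w
    have Fm[measurable]: "case_prod F \<in> borel_measurable (borel \<Otimes>\<^sub>M borel)" unfolding F_def by measurable
    have "(\<integral>\<^sup>+z. ennreal (norm (case_prod F z)) \<partial>(lborel \<Otimes>\<^sub>M lborel)) = (\<integral>\<^sup>+x. \<integral>\<^sup>+w. ennreal (norm (F x w)) \<partial>lborel \<partial>lborel)"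
      by (subst lborel.nn_integral_fst[symmetric]) auto
    also have "\<dots> = (\<integral>\<^sup>+x. ennreal \<bar>\<psi> x\<bar> * conv \<phi> t x \<partial>lborel)"
    proof (intro nn_integral_cong)
      fix x
      have "(\<integral>\<^sup>+w. ennreal (norm (F x w)) \<partial>lborel) = (\<integral>\<^sup>+w. ennreal \<bar>\<psi> x\<bar> * ennreal (G w t * \<bar>\<phi> (x - w)\<bar>) \<partial>lborel)"
        using G_nonneg[OF t] by (simp add: F_def abs_mult ennreal_mult)
      also have "\<dots> = ennreal \<bar>\<psi> x\<bar> * (\<integral>\<^sup>+w. ennreal (G w t * \<bar>\<phi> (x - w)\<bar>) \<partial>lborel)"
        by (rule nn_integral_cmult) measurable
      finally show "(\<integral>\<^sup>+w. ennreal (norm (F x w)) \<partial>lborel) = ennreal \<bar>\<psi> x\<bar> * conv \<phi> t x"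
        by (subst conv_flip) auto
    qed
    also have "\<dots> \<le> (\<integral>\<^sup>+x. ennreal (B * (C * K)) * indicator (ball (0::'a) R) x \<partial>lborel)"
    proof (rule nn_integral_mono)
      fix x :: 'a
      show "ennreal \<bar>\<psi> x\<bar> * conv \<phi> t x \<le> ennreal (B * (C * K)) * indicator (ball 0 R) x"
      proof (cases "norm x < R")
        case True
        have "ennreal \<bar>\<psi> x\<bar> * conv \<phi> t x \<le> ennreal B * ennreal (C * K)"
          using B[of x] by (intro mult_mono cb ennreal_leI) auto
        then show ?thesis using True B0 C K by (simp add: ennreal_mult)
      qed (use supp in simp)
    qed
    also have "\<dots> < \<infinity>"
      using emeasure_lborel_ball_finite[of "0::'a" R] by (simp add: nn_integral_cmult_indicator ennreal_mult_less_top)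
    finally have Fi: "integrable (lborel \<Otimes>\<^sub>M lborel) (case_prod F)"
      by (simp add: integrable_iff_bounded)
    have Gi: "integrable lborel (\<lambda>w. G w t * H w)"
    proof (rule Bochner_Integration.integrable_bound[OF integrable_mult_left[OF integrable_G[OF t], of "B * m"]])
      show "AE w in lborel. norm (G w t * H w) \<le> norm (G w t * (B * m))"
      proof (rule AE_I2)
        fix w
        have "G w t * \<bar>H w\<bar> \<le> G w t * (B * m)" by (intro mult_left_mono Hbound G_nonneg t)
        then show "norm (G w t * H w) \<le> norm (G w t * (B * m))"
          using G_nonneg[OF t, of w] B0 m by (simp add: abs_mult)
      qed
    qed measurable
    have "(\<integral>x. lin \<phi> x t * \<psi> x \<partial>lborel) = (\<integral>x. \<integral>w. F x w \<partial>lborel \<partial>lborel)"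
      by (simp add: F_def integral_lin_eq[OF _ t fin] mult.commute)
    also have "\<dots> = (\<integral>w. \<integral>x. F x w \<partial>lborel \<partial>lborel)"
      by (rule lborel_pair.Fubini_integral[OF Fi, symmetric])
    also have "\<dots> = (\<integral>w. G w t * H w \<partial>lborel)"
    proof (intro Bochner_Integration.integral_cong refl)
      fix w
      have "H w = (\<integral>x. \<psi> x * \<phi> (x - w) \<partial>lborel)"
        using integral_lborel_affine[OF Hint[of w], of 1 "- w"] by (simp add: H_def)
      moreover have "(\<integral>x. F x w \<partial>lborel) = (\<integral>x. G w t * (\<psi> x * \<phi> (x - w)) \<partial>lborel)"
        by (intro Bochner_Integration.integral_cong refl) (simp add: F_def)
      ultimately show "(\<integral>x. F x w \<partial>lborel) = G w t * H w" by simp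
    qed
    also have "\<dots> = (t powr (1 / \<theta>)) ^ DIM('a) * (\<integral>w. G (t powr (1 / \<theta>) *\<^sub>R w) t * H (t powr (1 / \<theta>) *\<^sub>R w) \<partial>lborel)"
      using integral_lborel_affine[OF Gi, of "t powr (1 / \<theta>)" 0] t by simp
    \<comment> \<open>Self-similarity: t^N G(t^(1/\<theta>) w, t) = G(w, 1), so t remains only in
      the argument of H.\<close>
    also have "\<dots> = (\<integral>w. G w 1 * H (t powr (1 / \<theta>) *\<^sub>R w) \<partial>lborel)"
    proof -
      have "(t powr (1 / \<theta>)) ^ DIM('a) * (G (t powr (1 / \<theta>) *\<^sub>R w) t * h) = G w 1 * h" for w h
        using t powr_inverse_theta_power[OF t]
        by (simp add: G_scale[OF t] G_scale[of 1 w] powr_minus)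
      then show ?thesis by (simp only: integral_mult_right_zero[symmetric])
    qed
    finally show ?thesis .
  qed
  have H0: "H 0 = (\<integral>x. \<phi> x * \<psi> x \<partial>lborel)" by (simp add: H_def mult.commute)
  show ?thesis
  \<comment> \<open>Dominated convergence works along sequences; restricting to times below 1 makes
    the shifts contractions, so the majorant at w serves for all of them.\<close>
  proof (rule tendsto_at_right_sequentially[of 0 1])
    fix \<tau> :: "nat \<Rightarrow> real"
    assume \<tau>: "\<And>n. 0 < \<tau> n" "\<And>n. \<tau> n < 1" "\<tau> \<longlonglongrightarrow> 0"
    define r where "r n = \<tau> n powr (1 / \<theta>)" for n
    have r: "0 \<le> r n" "r n \<le> 1" for n
      using \<tau>(1)[of n] \<tau>(2)[of n] theta powr_mono2[of "1 / \<theta>" "\<tau> n" 1] by (auto simp: r_def less_imp_le)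
    have r0: "r \<longlonglongrightarrow> 0"
    proof -
      have "(\<lambda>n. \<tau> n powr (1 / \<theta>)) \<longlonglongrightarrow> 0 powr (1 / \<theta>)"
        using \<tau> theta by (intro tendsto_powr' tendsto_const) (auto intro!: always_eventually less_imp_le)
      then show ?thesis by (simp add: r_def[abs_def])
    qed
    have Hl: "(\<lambda>n. H (r n *\<^sub>R w)) \<longlonglongrightarrow> H 0" for w
      unfolding H_def
    proof (rule integral_dominated_convergence)
      show "integrable lborel (\<lambda>x. B * (indicator (ball 0 (R + norm w)) x * \<bar>\<phi> x\<bar>))"
        by (intro integrable_mult_right intball)
      show "AE x in lborel. norm (\<psi> (x + r n *\<^sub>R w) * \<phi> x) \<le> B * (indicator (ball 0 (R + norm w)) x * \<bar>\<phi> x\<bar>)" for n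
      proof (rule AE_I2)
        fix x :: 'a
        have "norm (r n *\<^sub>R w) \<le> norm w" using r[of n] by (simp add: mult_left_le_one_le)
        then have "indicator (ball 0 (R + norm (r n *\<^sub>R w))) x \<le> (indicator (ball 0 (R + norm w)) x :: real)"
          by (auto simp: indicator_def)
        then have "B * (indicator (ball 0 (R + norm (r n *\<^sub>R w))) x * \<bar>\<phi> x\<bar>) \<le> B * (indicator (ball 0 (R + norm w)) x * \<bar>\<phi> x\<bar>)"
          using B0 by (intro mult_left_mono mult_right_mono) auto
        then show "norm (\<psi> (x + r n *\<^sub>R w) * \<phi> x) \<le> B * (indicator (ball 0 (R + norm w)) x * \<bar>\<phi> x\<bar>)"
          using dom[of x "r n *\<^sub>R w"] unfolding real_norm_def by linarith
      qed
      show "AE x in lborel. (\<lambda>n. \<psi> (x + r n *\<^sub>R w) * \<phi> x) \<longlonglongrightarrow> \<psi> (x + 0) * \<phi> x"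
      proof (rule AE_I2)
        fix x :: 'a
        have "isCont \<psi> (x + 0)" using \<psi> by (simp add: continuous_on_eq_continuous_at)
        moreover have "(\<lambda>n. x + r n *\<^sub>R w) \<longlonglongrightarrow> x + 0"
          using tendsto_add[OF tendsto_const tendsto_scaleR[OF r0 tendsto_const[of w]], of x] by simp
        ultimately show "(\<lambda>n. \<psi> (x + r n *\<^sub>R w) * \<phi> x) \<longlonglongrightarrow> \<psi> (x + 0) * \<phi> x"
          by (intro tendsto_mult_right) (rule isCont_tendsto_compose)
      qed
    qed measurable
    have "(\<lambda>n. \<integral>w. G w 1 * H (r n *\<^sub>R w) \<partial>lborel) \<longlonglongrightarrow> (\<integral>w. G w 1 * H 0 \<partial>lborel)"
    proof (rule integral_dominated_convergence)
      show "integrable lborel (\<lambda>w. G w 1 * (B * m))" by (intro integrable_mult_left integrable_G) simp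
      show "AE w in lborel. norm (G w 1 * H (r n *\<^sub>R w)) \<le> G w 1 * (B * m)" for n
        using Hbound G_nonneg[of 1] by (intro AE_I2) (auto simp: abs_mult intro!: mult_left_mono)
      show "AE w in lborel. (\<lambda>n. G w 1 * H (r n *\<^sub>R w)) \<longlonglongrightarrow> G w 1 * H 0"
        using Hl by (intro AE_I2 tendsto_mult_left)
    qed measurable
    moreover have "(\<integral>w. G w 1 * H 0 \<partial>lborel) = H 0" using integral_G[of 1] by simp
    ultimately show "(\<lambda>n. \<integral>x. lin \<phi> x (\<tau> n) * \<psi> x \<partial>lborel) \<longlonglongrightarrow> (\<integral>x. \<phi> x * \<psi> x \<partial>lborel)"
      unfolding eq[OF \<tau>(1)] H0[symmetric] r_def by (simp only:)
  qed simp
qed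

lemma dint_tendsto_distr:
  assumes f[measurable]: "case_prod f \<in> borel_measurable (borel \<Otimes>\<^sub>M borel)" and src: "source_bound T \<rho> M f"
    and M: "0 \<le> M" and \<rho>: "0 < \<rho>" and T: "0 < T"
    and [measurable]: "\<psi> \<in> borel_measurable borel" and B: "\<And>x. \<bar>\<psi> x\<bar> \<le> B" and supp: "\<And>x. R \<le> norm x \<Longrightarrow> \<psi> x = 0"
  shows "((\<lambda>t. \<integral>x. dint f x t * \<psi> x \<partial>lborel) \<longlongrightarrow> 0) (at_right 0)"
proof -
  have B0: "0 \<le> B" using B[of 0] by linarith
  obtain C where C: "0 \<le> C" "\<And>t. 0 < t \<Longrightarrow> t < T \<Longrightarrow>
      (\<integral>\<^sup>+x\<in>ball 0 R. ennreal \<bar>dint f x t\<bar> \<partial>lborel) \<le> ennreal (C * Lg t powr (- N))"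
    using dint_local_mass_small[OF f src M \<rho> T order_refl, of 0 R] by blast
  have bound: "\<bar>\<integral>x. dint f x t * \<psi> x \<partial>lborel\<bar> \<le> B * C * Lg t powr (- N)" if t: "0 < t" "t < T" for t
  proof (cases "integrable lborel (\<lambda>x. dint f x t * \<psi> x)")
    case True
    have "ennreal \<bar>\<integral>x. dint f x t * \<psi> x \<partial>lborel\<bar> \<le> (\<integral>\<^sup>+x. ennreal (norm (dint f x t * \<psi> x)) \<partial>lborel)"
      using integral_norm_bound_ennreal[OF True] by simp
    also have "\<dots> \<le> (\<integral>\<^sup>+x. ennreal B * (ennreal \<bar>dint f x t\<bar> * indicator (ball 0 R) x) \<partial>lborel)"
    proof (rule nn_integral_mono)
      fix x
      show "ennreal (norm (dint f x t * \<psi> x)) \<le> ennreal B * (ennreal \<bar>dint f x t\<bar> * indicator (ball 0 R) x)"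
      proof (cases "norm x < R")
        case True
        have "\<bar>dint f x t\<bar> * \<bar>\<psi> x\<bar> \<le> B * \<bar>dint f x t\<bar>"
          using mult_left_mono[OF B[of x], of "\<bar>dint f x t\<bar>"] by (simp add: mult.commute)
        then show ?thesis using True B0 by (simp add: ennreal_mult[symmetric] abs_mult ennreal_leI)
      qed (use supp in simp)
    qed
    also have "\<dots> = ennreal B * (\<integral>\<^sup>+x\<in>ball 0 R. ennreal \<bar>dint f x t\<bar> \<partial>lborel)" by (rule nn_integral_cmult) measurable
    also have "\<dots> \<le> ennreal B * ennreal (C * Lg t powr (- N))" by (intro mult_left_mono C t) auto
    also have "\<dots> = ennreal (B * C * Lg t powr (- N))" using B0 C by (simp add: ennreal_mult[symmetric] mult.assoc)
    finally show ?thesis using B0 C by (subst (asm) ennreal_le_iff) auto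
  next
    case False
    then show ?thesis using B0 C by (simp add: not_integrable_integral_eq)
  qed
  have ev: "eventually (\<lambda>t. 0 < t \<and> t < T) (at_right 0)"
    using T by (auto simp: eventually_at_right_field intro!: exI[of _ T])
  have "((\<lambda>t. B * C * Lg t powr (- N)) \<longlongrightarrow> 0) (at_right 0)"
    by (intro tendsto_mult_right_zero Lg_powr_tendsto_0 N_pos)
  then show ?thesis
    by (rule Lim_null_comparison[rotated]) (use ev bound in \<open>auto elim!: eventually_mono\<close>)
qed

end

section \<open>Solutions in the sense of the integral equation\<close>

context critical_exponent
begin

lemma frac_semigroup_eq_lin:
  assumes f: "f \<in> borel_measurable lebesgue" and g[measurable]: "g \<in> borel_measurable borel"
    and ae: "AE y in lborel. f y = g y"
  shows "frac_semigroup \<theta> t f x = lin g x t"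
    and "integrable lebesgue (\<lambda>y. G (x - y) t * f y) \<longleftrightarrow> integrable lborel (\<lambda>y. G (x - y) t * g y)"
proof -
  have g': "(\<lambda>y. G (x - y) t * g y) \<in> borel_measurable lborel" by measurable
  have m: "(\<lambda>y. G (x - y) t * f y) \<in> borel_measurable lebesgue"
    by (intro borel_measurable_times f measurable_completion) measurable
  have ae': "AE y in lebesgue. G (x - y) t * f y = G (x - y) t * g y"
    using ae by (intro AE_completion) auto
  have "frac_semigroup \<theta> t f x = (\<integral>y. G (x - y) t * g y \<partial>lebesgue)"
    unfolding frac_semigroup_def by (rule integral_cong_AE[OF m measurable_completion[OF g'] ae'])
  also have "\<dots> = lin g x t" unfolding lin_def by (rule integral_completion[OF g'])
  finally show "frac_semigroup \<theta> t f x = lin g x t" .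
  have "integrable lebesgue (\<lambda>y. G (x - y) t * f y) \<longleftrightarrow> integrable lebesgue (\<lambda>y. G (x - y) t * g y)"
    by (rule integrable_cong_AE[OF m measurable_completion[OF g'] ae'])
  also have "\<dots> \<longleftrightarrow> integrable lborel (\<lambda>y. G (x - y) t * g y)" by (rule integrable_completion[OF g'])
  finally show "integrable lebesgue (\<lambda>y. G (x - y) t * f y) \<longleftrightarrow> integrable lborel (\<lambda>y. G (x - y) t * g y)" .
qed

text \<open>The conditions hold at every (x, t) rather than almost everywhere. Fubini turns the
  single space-time integral of \<open>dint\<close> into the iterated integral of the notion of
  solution, and completion passes from Borel to Lebesgue measure.\<close>

lemma is_solution_of_mild:
  assumes \<phi>: "\<phi> \<in> borel_measurable lebesgue" and \<phi>'[measurable]: "\<phi>' \<in> borel_measurable borel"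
    and ae: "AE y in lborel. \<phi> y = \<phi>' y"
    and u[measurable]: "case_prod u \<in> borel_measurable (borel \<Otimes>\<^sub>M borel)"
    and fin: "\<And>x t. 0 < t \<Longrightarrow> t < T \<Longrightarrow> conv \<phi>' t x < \<infinity>" "\<And>x t. 0 < t \<Longrightarrow> t < T \<Longrightarrow> duh (nonlin u) x t < \<infinity>"
    and eq: "\<And>x t. 0 < t \<Longrightarrow> t < T \<Longrightarrow> u x t = lin \<phi>' x t + dint (nonlin u) x t"
  shows "is_solution \<theta> (1 + 1 / N) \<phi> T u"
  unfolding is_solution_def
proof (intro conjI AE_I2 impI)
  have "case_prod u \<in> borel_measurable lborel"
    using u by (simp add: borel_prod)
  then show "case_prod u \<in> borel_measurable (restrict_space lebesgue (UNIV \<times> {0<..<T}))"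
    by (intro measurable_restrict_space1 measurable_completion)
next
  fix z :: "'a \<times> real" assume z: "z \<in> UNIV \<times> {0<..<T}"
  obtain x t where xt: "z = (x, t)" by (cases z)
  then have t: "0 < t" "t < T" using z by auto
  have Fm: "case_prod (nonlin u) \<in> borel_measurable (borel \<Otimes>\<^sub>M borel)" by (rule borel_measurable_nonlin[OF u])
  have i: "integrable (lborel \<Otimes>\<^sub>M lborel) (dint_integrand (nonlin u) x t)"
    by (rule integrable_dint[OF Fm fin(2)[OF t]])
  have 1: "integrable lebesgue (\<lambda>y. G (x - y) t * \<phi> y)"
    unfolding frac_semigroup_eq_lin(2)[OF \<phi> \<phi>' ae] by (rule integrable_lin[OF \<phi>' t(1) fin(1)[OF t]])
  have e: "(\<lambda>z. indicator (UNIV \<times> {0<..<t}) z *\<^sub>R (case z of (y, s) \<Rightarrow> G (x - y) (t - s) * Fp (1 + 1 / N) (u y s))) = dint_integrand (nonlin u) x t"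
    by (auto simp: dint_integrand_def indicator_def)
  have 2: "set_integrable (lebesgue :: ('a \<times> real) measure) (UNIV \<times> {0<..<t})
      (\<lambda>(y, s). G (x - y) (t - s) * Fp (1 + 1 / N) (u y s))"
  proof -
    have "integrable lborel (dint_integrand (nonlin u) x t)" using i by (simp add: lborel_prod)
    then have "integrable lebesgue (dint_integrand (nonlin u) x t)"
      by (subst integrable_completion) auto
    then show ?thesis unfolding set_integrable_def e .
  qed
  have 3: "(LINT s:{0<..<t}|lebesgue. frac_semigroup \<theta> (t - s) (\<lambda>y. Fp (1 + 1 / N) (u y s)) x) = dint (nonlin u) x t"
  proof -
    have fs: "frac_semigroup \<theta> (t - s) (\<lambda>y. Fp (1 + 1 / N) (u y s)) x = lin (\<lambda>y. Fp (1 + 1 / N) (u y s)) x (t - s)" for s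
    proof (rule frac_semigroup_eq_lin(1))
      show "(\<lambda>y. Fp (1 + 1 / N) (u y s)) \<in> borel_measurable borel" by measurable
      then show "(\<lambda>y. Fp (1 + 1 / N) (u y s)) \<in> borel_measurable lebesgue" by (intro measurable_completion) simp
    qed simp
    have "(\<lambda>s. indicator {0<..<t} s *\<^sub>R lin (\<lambda>y. Fp (1 + 1 / N) (u y s)) x (t - s)) \<in> borel_measurable lborel"
      unfolding lin_def by measurable
    then have "(LINT s:{0<..<t}|lebesgue. frac_semigroup \<theta> (t - s) (\<lambda>y. Fp (1 + 1 / N) (u y s)) x)
       = (\<integral>s. indicator {0<..<t} s *\<^sub>R lin (\<lambda>y. Fp (1 + 1 / N) (u y s)) x (t - s) \<partial>lborel)"
      unfolding set_lebesgue_integral_def fs by (rule integral_completion)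
    also have "\<dots> = (\<integral>s. \<integral>y. dint_integrand (nonlin u) x t (y, s) \<partial>lborel \<partial>lborel)"
      by (simp add: dint_integrand_def lin_def)
    also have "\<dots> = dint (nonlin u) x t"
      using lborel_pair.integral_snd[of "\<lambda>y s. dint_integrand (nonlin u) x t (y, s)"] i
      by (simp add: dint_def)
    finally show ?thesis .
  qed
  show "case z of (x, t) \<Rightarrow>
          integrable lebesgue (\<lambda>y. G (x - y) t * \<phi> y) \<and>
          set_integrable (lebesgue :: ('a \<times> real) measure) (UNIV \<times> {0<..<t})
             (\<lambda>(y, s). G (x - y) (t - s) * Fp (1 + 1 / N) (u y s)) \<and>
          u x t = frac_semigroup \<theta> t \<phi> x +
             (LINT s:{0<..<t}|lebesgue. frac_semigroup \<theta> (t - s) (\<lambda>y. Fp (1 + 1 / N) (u y s)) x)"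
    unfolding xt prod.case 3 frac_semigroup_eq_lin(1)[OF \<phi> \<phi>' ae] using 1 2 eq[OF t] by blast
qed

lemma log_bounded_of_triple_norm:
  assumes "triple_norm 1 N \<rho> f \<le> ennreal K" "0 \<le> K"
  shows "log_bounded \<rho> K f"
  unfolding log_bounded_def
proof (intro allI impI)
  fix z :: 'a and E :: "'a set" and s
  assume E: "E \<in> sets borel \<and> 0 < s \<and> emeasure lborel E = ennreal s"
  let ?I = "\<integral>\<^sup>+x\<in>E \<inter> ball z \<rho>. ennreal \<bar>f x\<bar> \<partial>lborel"
  have L: "Lg s powr (- N) * Lg s powr N = 1" using Lg_pos[of s] E by (simp add: powr_minus)
  have "?I = ennreal (Lg s powr (- N)) * (ennreal (Lg s powr N) * ?I)"
    using L by (simp add: mult.assoc[symmetric] ennreal_mult[symmetric])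
  also have "\<dots> \<le> ennreal (Lg s powr (- N)) * ennreal K"
    using triple_norm_leD[OF assms(1)] E by (intro mult_left_mono) auto
  also have "\<dots> = ennreal (K * Lg s powr (- N))" using assms(2) by (simp add: ennreal_mult[symmetric] mult.commute)
  finally show "?I \<le> ennreal (K * Lg s powr (- N))" .
qed

lemma triple_norm_of_log_bounded:
  assumes "log_bounded \<rho> K f" "0 \<le> K"
  shows "triple_norm 1 N \<rho> f \<le> ennreal K"
proof (rule triple_norm_leI)
  fix z :: 'a and E :: "'a set" and s :: real
  assume E: "E \<in> sets borel" "emeasure lborel E = ennreal s" "0 < s"
  let ?I = "\<integral>\<^sup>+x\<in>E \<inter> ball z \<rho>. ennreal \<bar>f x\<bar> \<partial>lborel"
  have L: "Lg s powr N * Lg s powr (- N) = 1" using Lg_pos[of s] E by (simp add: powr_minus)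
  have "ennreal (Lg s powr N) * ?I \<le> ennreal (Lg s powr N) * ennreal (K * Lg s powr (- N))"
    using assms E by (intro mult_left_mono) (auto simp: log_bounded_def)
  also have "\<dots> = ennreal K" using L assms(2) by (simp add: ennreal_mult[symmetric] mult.left_commute)
  finally show "ennreal (Lg s powr N) * ?I \<le> ennreal K" .
qed

end

section \<open>Essential suprema, local integrability and test functions\<close>

lemma Linf_norm_le:
  fixes f :: "'a::euclidean_space \<Rightarrow> real"
  assumes "f \<in> borel_measurable borel" "\<And>x. \<bar>f x\<bar> \<le> B"
  shows "Linf_norm f \<le> ereal B"
  unfolding Linf_norm_def
proof (rule esssup_I)
  show "(\<lambda>x. ereal \<bar>f x\<bar>) \<in> borel_measurable lebesgue"
    using assms(1) by (intro measurable_completion) measurable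
qed (use assms(2) in auto)

lemma locally_integrable_bounded:
  fixes f :: "'a::euclidean_space \<Rightarrow> real"
  assumes f[measurable]: "f \<in> borel_measurable borel" and B: "\<And>x. \<bar>f x\<bar> \<le> B"
  shows "locally_integrable f"
  unfolding locally_integrable_def
proof (intro conjI allI impI)
  show "f \<in> borel_measurable lebesgue" by (intro measurable_completion) simp
  fix K :: "'a set" assume K: "compact K"
  then have [measurable]: "K \<in> sets borel" by (rule borel_compact)
  have "integrable lborel (\<lambda>x. indicator K x *\<^sub>R f x)"
    using B emeasure_compact_finite[OF K] by (intro integrableI_bounded_set_indicator) auto
  then show "set_integrable lebesgue K f"
    unfolding set_integrable_def by (subst integrable_completion) auto
qed

lemma test_funD:
  fixes \<psi> :: "'a::euclidean_space \<Rightarrow> real"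
  assumes "test_fun \<psi>"
  obtains B R where "continuous_on UNIV \<psi>" "\<And>x. \<bar>\<psi> x\<bar> \<le> B" "\<And>x. R \<le> norm x \<Longrightarrow> \<psi> x = 0"
proof -
  have sm: "smooth_fun \<psi>" using assms unfolding test_fun_def by (rule conjunct1)
  \<comment> \<open>Continuity of the function itself is the clause for the empty list of
    derivatives.\<close>
  have "continuous_on UNIV (iter_pd [] \<psi>)"
    by (rule conjunct1[OF mp[OF spec[OF sm[unfolded smooth_fun_def], of "[]"]]]) simp
  then have cont: "continuous_on UNIV \<psi>" unfolding iter_pd.simps(1) .
  have comp: "compact (closure {x. \<psi> x \<noteq> 0})" using assms unfolding test_fun_def by (rule conjunct2)
  obtain R where R: "\<forall>x\<in>closure {x. \<psi> x \<noteq> 0}. norm x \<le> R"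
    using compact_imp_bounded[OF comp] unfolding bounded_iff by (elim exE) (rule that)
  \<comment> \<open>The support satisfies |x| \<le> R with equality possible, so the radius is
    enlarged by 1 to have vanishing from the boundary on.\<close>
  have supp: "\<psi> x = 0" if "R + 1 \<le> norm x" for x
  proof (rule ccontr)
    assume "\<psi> x \<noteq> 0"
    then have "x \<in> closure {x. \<psi> x \<noteq> 0}" by (intro subsetD[OF closure_subset] CollectI)
    then have "norm x \<le> R" using R by (rule bspec[rotated])
    with that show False by simp
  qed
  have "bounded (\<psi> ` cball 0 (R + 1))"
    by (rule compact_imp_bounded[OF compact_continuous_image[OF continuous_on_subset[OF cont] compact_cball]]) simp
  then obtain B where B: "\<forall>y\<in>\<psi> ` cball 0 (R + 1). norm y \<le> B" unfolding bounded_iff by (elim exE) (rule that)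
  have "\<bar>\<psi> x\<bar> \<le> max B 0" for x
  proof (cases "norm x \<le> R + 1")
    case True
    then have "\<psi> x \<in> \<psi> ` cball 0 (R + 1)" by (intro imageI) simp
    then have "norm (\<psi> x) \<le> B" using B by (rule bspec[rotated])
    then show ?thesis by simp
  next
    case False
    then show ?thesis using supp[of x] by simp
  qed
  then show ?thesis by (rule that[OF cont _ supp])
qed

theorem theorem1p1:
  fixes \<theta> Tstar :: real
  assumes "0 < \<theta>" "\<theta> \<le> 2" "0 < Tstar"
  defines "n \<equiv> real DIM('a::euclidean_space)"
  defines "p \<equiv> 1 + \<theta> / n"
  shows "\<exists>\<epsilon>>0. \<forall>(\<phi> :: 'a \<Rightarrow> real) T.
    \<phi> \<in> ul_space 1 (n / \<theta>) \<and> 0 < T \<and> T \<le> Tstar \<and>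
    triple_norm 1 (n / \<theta>) (T powr (1 / \<theta>)) \<phi> \<le> ennreal \<epsilon> \<longrightarrow>
    (\<exists>u :: 'a \<Rightarrow> real \<Rightarrow> real.
       is_solution \<theta> p \<phi> T u \<and>
       (\<forall>t\<in>{0<..<T}. (\<lambda>x. u x t) \<in> ul_space 1 (n / \<theta>)) \<and>
       (\<forall>t\<in>{0<..<T}. ((\<lambda>s. ul_norm 1 (n / \<theta>) (\<lambda>x. u x s - u x t)) \<longlongrightarrow> 0)
                          (at t within {0<..<T})) \<and>
       (\<forall>a b. 0 < a \<and> a \<le> b \<and> b < T \<longrightarrow>
          (SUP t\<in>{a..b}. Linf_norm (\<lambda>x. u x t)) < \<infinity>) \<and>
       (SUP t\<in>{0<..<T}. triple_norm 1 (n / \<theta>) (T powr (1 / \<theta>)) (\<lambda>x. u x t)) < \<infinity> \<and>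
       (SUP t\<in>{0<..<T}. ereal (t powr (n / \<theta>) * ln (exp 1 + 1 / t) powr (n / \<theta>))
                          * Linf_norm (\<lambda>x. u x t)) < \<infinity> \<and>
       (\<forall>\<gamma>. 0 \<le> \<gamma> \<and> \<gamma> < n / \<theta> \<longrightarrow>
          ((\<lambda>t. ul_norm 1 \<gamma> (\<lambda>x. u x t - frac_semigroup \<theta> t \<phi> x)) \<longlongrightarrow> 0) (at_right 0)) \<and>
       (\<forall>\<psi>. test_fun \<psi> \<longrightarrow>
          ((\<lambda>t. \<integral>x. u x t * \<psi> x \<partial>lebesgue) \<longlongrightarrow> (\<integral>x. \<phi> x * \<psi> x \<partial>lebesgue))
            (at_right 0)))"
proof -
  define N where N_eq: "N = n / \<theta>"
  interpret critical_exponent \<theta> N "TYPE('a)"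
    by (rule critical_exponent.intro[OF assms(1,2)]) (simp only: N_eq n_def)
  have p: "p = 1 + 1 / N" unfolding p_def N_eq by simp
  obtain \<kappa> M where \<kappa>: "0 < \<kappa>" and M: "0 \<le> M" and
    ex: "\<forall>T \<phi>. 0 < T \<and> T \<le> Tstar \<and> \<phi> \<in> borel_measurable borel \<and> adm T (T powr (1 / \<theta>)) (\<kappa> / 2) (lin \<phi>) \<longrightarrow>
     (\<exists>u. case_prod u \<in> borel_measurable (borel \<Otimes>\<^sub>M borel) \<and> adm T (T powr (1 / \<theta>)) \<kappa> u \<and>
        source_bound T (T powr (1 / \<theta>)) M (nonlin u) \<and>
        (\<forall>t\<in>{0<..<T}. \<forall>x. duh (nonlin u) x t < \<infinity> \<and> u x t = lin \<phi> x t + dint (nonlin u) x t))"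
    using mild_solution_exists[OF assms(3)] by (elim exE conjE) (rule that)
  obtain C where C: "1 \<le> C" and linC: "\<forall>\<phi> T K. \<phi> \<in> borel_measurable borel \<and> 0 < T \<and> T \<le> Tstar \<and> 0 \<le> K \<and> log_bounded (T powr (1 / \<theta>)) K \<phi> \<longrightarrow>
     adm T (T powr (1 / \<theta>)) (C * K) (lin \<phi>) \<and> (\<forall>t\<in>{0<..<T}. \<forall>x. conv \<phi> t x < \<infinity>)"
    using lin_adm[OF assms(3)] by (elim exE conjE) (rule that)
  \<comment> \<open>The linear term of data of norm \<epsilon> then has constant C \<epsilon> =
    \<kappa>/2, half of what the iteration allows.\<close>
  define \<epsilon> where "\<epsilon> = \<kappa> / (2 * C)"
  have \<epsilon>: "0 < \<epsilon>" "C * \<epsilon> = \<kappa> / 2" using \<kappa> C by (auto simp: \<epsilon>_def)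
  show ?thesis
    unfolding N_eq[symmetric] p Lg_def[symmetric]
  proof (intro exI[of _ \<epsilon>] conjI \<epsilon>(1) allI impI, elim conjE)
    fix \<phi> :: "'a \<Rightarrow> real" and T
    assume \<phi>ul: "\<phi> \<in> ul_space 1 N" and T: "0 < T" "T \<le> Tstar"
      and small: "triple_norm 1 N (T powr (1 / \<theta>)) \<phi> \<le> ennreal \<epsilon>"
    define \<rho> where "\<rho> = T powr (1 / \<theta>)"
    have \<rho>: "0 < \<rho>" using T by (simp add: \<rho>_def)
    have \<phi>m: "\<phi> \<in> borel_measurable lebesgue" using \<phi>ul by (simp add: ul_space_def locally_integrable_def)
    \<comment> \<open>A Borel representative of the data. The norm and the semigroup are insensitive
      to this change on a null set.\<close>
    obtain \<phi>' where \<phi>'[measurable]: "\<phi>' \<in> borel_measurable borel" and ae: "AE x in lborel. \<phi> x = \<phi>' x"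
      using completion_ex_borel_measurable_real[OF \<phi>m] by auto
    have lb: "log_bounded \<rho> \<epsilon> \<phi>'"
      using small \<epsilon>(1) unfolding triple_norm_cong_AE[OF ae] \<rho>_def by (intro log_bounded_of_triple_norm) simp_all
    have linb: "adm T \<rho> (C * \<epsilon>) (lin \<phi>') \<and> (\<forall>t\<in>{0<..<T}. \<forall>x. conv \<phi>' t x < \<infinity>)"
      unfolding \<rho>_def
      by (intro linC[rule_format] conjI \<phi>' T less_imp_le[OF \<epsilon>(1)] lb[unfolded \<rho>_def])
    note lin = conjunct1[OF linb[unfolded \<epsilon>(2)]] conjunct2[OF linb]
    obtain u where u[measurable]: "case_prod u \<in> borel_measurable (borel \<Otimes>\<^sub>M borel)" and adm: "adm T \<rho> \<kappa> u"
      and src: "source_bound T \<rho> M (nonlin u)"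
      and sol: "\<forall>t\<in>{0<..<T}. \<forall>x. duh (nonlin u) x t < \<infinity> \<and> u x t = lin \<phi>' x t + dint (nonlin u) x t"
      using ex[rule_format, OF conjI[OF T(1) conjI[OF T(2) conjI[OF \<phi>' lin(1)[unfolded \<rho>_def]]]]]
      unfolding \<rho>_def[symmetric] by (elim exE conjE) (rule that)
    have fin: "duh (nonlin u) x t < \<infinity>" and eq: "u x t = lin \<phi>' x t + dint (nonlin u) x t" if "0 < t" "t < T" for x t
      using sol that by auto
    have Fm[measurable]: "case_prod (nonlin u) \<in> borel_measurable (borel \<Otimes>\<^sub>M borel)" by (rule borel_measurable_nonlin[OF u])
    have ut[measurable]: "(\<lambda>x. u x t) \<in> borel_measurable borel" for t by measurable
    define b where "b t = \<kappa> * (t powr (- N) * Lg t powr (- N))" for t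
    have b0: "0 \<le> b t" for t using \<kappa> by (simp add: b_def)
    have ub: "\<bar>u x t\<bar> \<le> b t" if "0 < t" "t < T" for x t
      unfolding b_def by (rule adm_supD[OF adm that])
    have mass: "(\<integral>\<^sup>+y\<in>ball z \<rho>. ennreal \<bar>\<phi>' y\<bar> \<partial>lborel) \<le> ennreal \<epsilon>" for z
      by (rule log_bounded_ball[OF lb \<rho>]) (use \<epsilon> in simp)
    obtain CN where CN: "0 < CN" and ulC: "\<forall>(f::'a \<Rightarrow> real) B. 0 \<le> B \<and> (\<forall>x. \<bar>f x\<bar> \<le> B) \<longrightarrow> ul_norm 1 N f \<le> ennreal (CN * B)"
      using ul_norm_le_sup[OF less_imp_le[OF N_pos], where 'a='a] by (elim exE conjE) (rule that)
    have evT: "eventually (\<lambda>t. 0 < t \<and> t < T) (at_right 0)"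
      using T by (auto simp: eventually_at_right_field intro!: exI[of _ T])
    \<comment> \<open>The deviation from the free evolution is exactly the Duhamel term, so its
      decay in norm is \<open>dint_ul_norm_small\<close>.\<close>
    have diff: "u x t - frac_semigroup \<theta> t \<phi> x = dint (nonlin u) x t" if "0 < t" "t < T" for x t
      using eq[OF that, of x] by (simp add: frac_semigroup_eq_lin(1)[OF \<phi>m \<phi>' ae])
    show "\<exists>u :: 'a \<Rightarrow> real \<Rightarrow> real.
       is_solution \<theta> (1 + 1 / N) \<phi> T u \<and>
       (\<forall>t\<in>{0<..<T}. (\<lambda>x. u x t) \<in> ul_space 1 N) \<and>
       (\<forall>t\<in>{0<..<T}. ((\<lambda>s. ul_norm 1 N (\<lambda>x. u x s - u x t)) \<longlongrightarrow> 0) (at t within {0<..<T})) \<and>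
       (\<forall>a b. 0 < a \<and> a \<le> b \<and> b < T \<longrightarrow> (SUP t\<in>{a..b}. Linf_norm (\<lambda>x. u x t)) < \<infinity>) \<and>
       (SUP t\<in>{0<..<T}. triple_norm 1 N (T powr (1 / \<theta>)) (\<lambda>x. u x t)) < \<infinity> \<and>
       (SUP t\<in>{0<..<T}. ereal (t powr N * Lg t powr N) * Linf_norm (\<lambda>x. u x t)) < \<infinity> \<and>
       (\<forall>\<gamma>. 0 \<le> \<gamma> \<and> \<gamma> < N \<longrightarrow>
          ((\<lambda>t. ul_norm 1 \<gamma> (\<lambda>x. u x t - frac_semigroup \<theta> t \<phi> x)) \<longlongrightarrow> 0) (at_right 0)) \<and>
       (\<forall>\<psi>. test_fun \<psi> \<longrightarrow>
          ((\<lambda>t. \<integral>x. u x t * \<psi> x \<partial>lebesgue) \<longlongrightarrow> (\<integral>x. \<phi> x * \<psi> x \<partial>lebesgue)) (at_right 0))"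
    proof (intro exI[of _ u] conjI ballI allI impI, goal_cases)
      case 1
      show ?case by (rule is_solution_of_mild[OF \<phi>m \<phi>' ae u]) (use lin(2) fin eq in auto)
    next
      case (2 t)
      \<comment> \<open>For a fixed positive time the sup bound alone gives finiteness of the norm,
        with a constant that may grow as t tends to 0.\<close>
      have "ul_norm 1 N (\<lambda>x. u x t) \<le> ennreal (CN * b t)"
        using ub[of t] 2 b0[of t] by (intro ulC[rule_format]) auto
      then have "ul_norm 1 N (\<lambda>x. u x t) < \<infinity>" by (auto intro: le_less_trans)
      moreover have "locally_integrable (\<lambda>x. u x t)"
        using ub[of t] 2 by (intro locally_integrable_bounded[of _ "b t"]) auto
      ultimately show ?case by (simp add: ul_space_def)
    next
      case (3 t)
      then have t: "0 < t" "t < T" by auto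
      show ?case
      proof (rule tendsto_ennreal_zeroI)
        fix e :: real assume e: "0 < e"
        \<comment> \<open>The linear and Duhamel terms may each vary by e', and passing from the
          uniform bound to the norm costs the factor \<open>CN\<close>.\<close>
        define e' where "e' = e / (2 * CN)"
        have e': "0 < e'" using e CN by (simp add: e'_def)
        obtain d1 where d1: "0 < d1" "\<And>r s x. t - d1 < r \<Longrightarrow> r \<le> s \<Longrightarrow> s < t + d1 \<Longrightarrow> \<bar>lin \<phi>' x s - lin \<phi>' x r\<bar> \<le> e'"
          using lin_time_cont[OF \<phi>' \<rho> less_imp_le[OF \<epsilon>(1)] mass t(1) e'] by blast
        obtain d2 where d2: "0 < d2" "\<And>r s x. t - d2 < r \<Longrightarrow> r \<le> s \<Longrightarrow> s < t + d2 \<Longrightarrow> s < T \<Longrightarrow>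
            \<bar>dint (nonlin u) x s - dint (nonlin u) x r\<bar> \<le> e'"
          using dint_time_cont[OF Fm src M \<rho> t T(2) e' fin] by blast
        have close: "\<bar>u x s - u x r\<bar> \<le> 2 * e'"
          if "0 < r" "r \<le> s" "s < T" "t - min d1 d2 < r" "s < t + min d1 d2" for r s x
        proof -
          have "\<bar>lin \<phi>' x s - lin \<phi>' x r\<bar> \<le> e'" using that by (intro d1(2)) auto
          moreover have "\<bar>dint (nonlin u) x s - dint (nonlin u) x r\<bar> \<le> e'" using that by (intro d2(2)) auto
          moreover have "u x s = lin \<phi>' x s + dint (nonlin u) x s" "u x r = lin \<phi>' x r + dint (nonlin u) x r"
            using that by (auto intro!: eq)
          ultimately show ?thesis by linarith
        qed
        have "ul_norm 1 N (\<lambda>x. u x s - u x t) \<le> ennreal e" if s: "s \<in> {0<..<T}" "dist s t < min d1 d2" for s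
        proof -
          have "\<bar>u x s - u x t\<bar> \<le> 2 * e'" for x
          \<comment> \<open>The continuity estimates are stated for an ordered pair of times, so s
            before t is handled by exchanging the roles.\<close>
          proof (cases "t \<le> s")
            case True
            then show ?thesis using s t by (intro close) (auto simp: dist_real_def)
          next
            case False
            then have "\<bar>u x t - u x s\<bar> \<le> 2 * e'" using s t by (intro close) (auto simp: dist_real_def)
            then show ?thesis by (simp add: abs_minus_commute)
          qed
          then have "ul_norm 1 N (\<lambda>x. u x s - u x t) \<le> ennreal (CN * (2 * e'))"
            using e' by (intro ulC[rule_format]) auto
          then show ?thesis using CN by (simp add: e'_def)
        qed
        then show "eventually (\<lambda>s. ul_norm 1 N (\<lambda>x. u x s - u x t) \<le> ennreal e) (at t within {0<..<T})"
          unfolding eventually_at using d1(1) d2(1) by (intro exI[of _ "min d1 d2"]) auto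
      qed
    next
      case (4 a c)
      have "(SUP t\<in>{a..c}. Linf_norm (\<lambda>x. u x t)) \<le> ereal (\<kappa> * a powr (- N))"
      proof (rule SUP_least)
        fix t assume "t \<in> {a..c}"
        then have t: "0 < t" "t < T" "a \<le> t" using 4 by auto
        have "b t \<le> \<kappa> * (a powr (- N) * 1)"
          unfolding b_def using \<kappa> t 4 N_pos Lg_powr_le_1[OF t(1), of N]
          by (intro mult_left_mono mult_mono powr_mono2') auto
        then show "Linf_norm (\<lambda>x. u x t) \<le> ereal (\<kappa> * a powr (- N))"
          using ub[OF t(1,2)] by (intro Linf_norm_le ut) (auto intro: order_trans)
      qed
      then show ?case by (auto intro: le_less_trans)
    next
      case 5
      have "(SUP t\<in>{0<..<T}. triple_norm 1 N (T powr (1 / \<theta>)) (\<lambda>x. u x t)) \<le> ennreal \<kappa>"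
        using adm \<kappa> unfolding \<rho>_def by (intro SUP_least triple_norm_of_log_bounded) (auto simp: adm_def)
      then show ?case by (auto intro: le_less_trans)
    next
      case 6
      have "(SUP t\<in>{0<..<T}. ereal (t powr N * Lg t powr N) * Linf_norm (\<lambda>x. u x t)) \<le> ereal \<kappa>"
      proof (rule SUP_least)
        fix t assume "t \<in> {0<..<T}"
        then have t: "0 < t" "t < T" by auto
        have "ereal (t powr N * Lg t powr N) * Linf_norm (\<lambda>x. u x t) \<le> ereal (t powr N * Lg t powr N) * ereal (b t)"
          using ub[OF t] by (intro ereal_mult_left_mono Linf_norm_le ut) auto
        also have "\<dots> = ereal \<kappa>"
          using t Lg_pos[OF t(1)] by (simp add: b_def powr_minus field_simps)
        finally show "ereal (t powr N * Lg t powr N) * Linf_norm (\<lambda>x. u x t) \<le> ereal \<kappa>" .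
      qed
      then show ?case by (auto intro: le_less_trans)
    next
      case (7 \<gamma>)
      then have \<gamma>: "0 \<le> \<gamma>" "\<gamma> < N" by auto
      obtain C' where C': "0 \<le> C'" "\<And>t. 0 < t \<Longrightarrow> t < T \<Longrightarrow> ul_norm 1 \<gamma> (\<lambda>x. dint (nonlin u) x t) \<le> ennreal (C' * Lg t powr (- (N - \<gamma>)))"
        using dint_ul_norm_small[OF Fm src M \<rho> assms(3) T(2) \<gamma>] by blast
      have lim: "((\<lambda>t. C' * Lg t powr (- (N - \<gamma>))) \<longlongrightarrow> 0) (at_right 0)"
        using \<gamma> by (intro tendsto_mult_right_zero Lg_powr_tendsto_0) simp
      show ?case
      proof (rule tendsto_ennreal_zeroI)
        fix e :: real assume "0 < e"
        then have "eventually (\<lambda>t. C' * Lg t powr (- (N - \<gamma>)) < e) (at_right 0)"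
          using order_tendstoD(2)[OF lim] by simp
        with evT show "eventually (\<lambda>t. ul_norm 1 \<gamma> (\<lambda>x. u x t - frac_semigroup \<theta> t \<phi> x) \<le> ennreal e) (at_right 0)"
        proof eventually_elim
          case (elim t)
          then have "(\<lambda>x. u x t - frac_semigroup \<theta> t \<phi> x) = (\<lambda>x. dint (nonlin u) x t)" by (simp add: diff)
          then have "ul_norm 1 \<gamma> (\<lambda>x. u x t - frac_semigroup \<theta> t \<phi> x) \<le> ennreal (C' * Lg t powr (- (N - \<gamma>)))"
            using C'(2)[of t] elim by simp
          also have "\<dots> \<le> ennreal e" by (rule ennreal_leI) (use elim in linarith)
          finally show ?case .
        qed
      qed
    next
      case (8 \<psi>)
      obtain B R where \<psi>: "continuous_on UNIV \<psi>" and B: "\<And>x. \<bar>\<psi> x\<bar> \<le> B" and supp: "\<And>x. R \<le> norm x \<Longrightarrow> \<psi> x = 0"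
        using test_funD[OF 8] by blast
      have [measurable]: "\<psi> \<in> borel_measurable borel" by (rule borel_measurable_continuous_onI[OF \<psi>])
      have int: "integrable lborel (\<lambda>x. g x * \<psi> x)" if [measurable]: "g \<in> borel_measurable borel" and g: "\<And>x. \<bar>g x\<bar> \<le> D" for g D
      proof (rule integrableI_bounded_set[where A="ball 0 R" and B="D * B"])
        have "\<bar>g x\<bar> * \<bar>\<psi> x\<bar> \<le> D * B" for x
          using g[of x] B[of x] by (intro mult_mono) auto
        then show "AE x in lborel. x \<in> ball 0 R \<longrightarrow> norm (g x * \<psi> x) \<le> D * B" by (simp add: abs_mult)
        show "AE x in lborel. x \<notin> ball 0 R \<longrightarrow> g x * \<psi> x = 0" using supp by simp
      qed (use emeasure_lborel_ball_finite[of "0::'a" R] in auto)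
      have split: "(\<integral>x. u x t * \<psi> x \<partial>lebesgue) = (\<integral>x. lin \<phi>' x t * \<psi> x \<partial>lborel) + (\<integral>x. dint (nonlin u) x t * \<psi> x \<partial>lborel)"
        if t: "0 < t" "t < T" for t
      proof -
        have lb: "\<bar>lin \<phi>' x t\<bar> \<le> \<kappa> / 2 * (t powr (- N) * Lg t powr (- N))" for x
          by (rule adm_supD[OF lin(1) t])
        \<comment> \<open>The Duhamel term is bounded as a difference of two bounded functions. With
          the compact support of \<psi> this yields the integrability needed to split the
          pairing.\<close>
        have "dint (nonlin u) x t = u x t - lin \<phi>' x t" for x using eq[OF t, of x] by simp
        then have db: "\<bar>dint (nonlin u) x t\<bar> \<le> b t + \<kappa> / 2 * (t powr (- N) * Lg t powr (- N))" for x
          using ub[OF t, of x] lb[of x] by simp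
        have "(\<integral>x. u x t * \<psi> x \<partial>lebesgue) = (\<integral>x. u x t * \<psi> x \<partial>lborel)"
          by (rule integral_completion) measurable
        also have "\<dots> = (\<integral>x. lin \<phi>' x t * \<psi> x + dint (nonlin u) x t * \<psi> x \<partial>lborel)"
          by (intro Bochner_Integration.integral_cong refl) (simp add: eq[OF t] distrib_right)
        also have "\<dots> = (\<integral>x. lin \<phi>' x t * \<psi> x \<partial>lborel) + (\<integral>x. dint (nonlin u) x t * \<psi> x \<partial>lborel)"
          by (intro Bochner_Integration.integral_add int[OF _ lb] int[OF _ db]) measurable
        finally show ?thesis .
      qed
      have "(\<integral>x. \<phi> x * \<psi> x \<partial>lebesgue) = (\<integral>x. \<phi>' x * \<psi> x \<partial>lebesgue)"
        by (intro integral_cong_AE AE_completion borel_measurable_times \<phi>m measurable_completion)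
           (use ae in auto)
      also have "\<dots> = (\<integral>x. \<phi>' x * \<psi> x \<partial>lborel)" by (rule integral_completion) measurable
      finally have lim: "(\<integral>x. \<phi> x * \<psi> x \<partial>lebesgue) = (\<integral>x. \<phi>' x * \<psi> x \<partial>lborel)" .
      have "((\<lambda>t. (\<integral>x. lin \<phi>' x t * \<psi> x \<partial>lborel) + (\<integral>x. dint (nonlin u) x t * \<psi> x \<partial>lborel))
          \<longlongrightarrow> (\<integral>x. \<phi>' x * \<psi> x \<partial>lborel) + 0) (at_right 0)"
        by (intro tendsto_add lin_tendsto_distr[OF \<phi>' \<rho> less_imp_le[OF \<epsilon>(1)] mass \<psi> B supp]
            dint_tendsto_distr[OF Fm src M \<rho> T(1) _ B supp]) auto
      then show ?case
        unfolding lim add_0_right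
        by (rule Lim_transform_eventually) (use evT in \<open>auto elim!: eventually_mono simp: split\<close>)
    qed
  qed
qed

end
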